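(* For every dimension $d$, the model $$\mathcal{M}_d=\{\rho \mid \rho\in\mathcal{B}(\mathcal{H}_d),\ \mathrm{Tr}(\rho)=1,\ \rho\geq 0\}$$ of density matrices on the $d$-dimensional Hilbert space $\mathcal{H}_d$ satisfies metric-projected local asymptotic normality (MP-LAN); that is, $\mathcal{M}_d$ is a convex subset of some model $\mathcal{M}'$ that satisfies local asymptotic normality (LAN).
   Context: Setting (quantum state tomography). $\mathcal{H}_d$ is a $d$-dimensional complex Hilbert space and $\mathcal{B}(\mathcal{H}_d)$ its algebra of linear operators. $N$ copies of a true state $\rho_0$ are each measured with the same positive operator-valued measure (POVM) $\{E_j\}$ (positive operators with $\sum_j E_j=\mathbb{1}$); outcome $j$ has probability $\mathrm{Tr}(\rho_0E_j)$. If outcome $j$ is observed $n_j$ times, with $\sum_j n_j=N$, the likelihood function is $\mathcal{L}(\rho)=\prod_j \mathrm{Tr}(\rho E_j)^{n_j}$. A model is a set of values of the parameter $\rho$ together with this likelihood. A model containing $\mathcal{M}_d$ may contain Hermitian matrices that are not positive semidefinite; the likelihood is then given by the same formula. The maximum likelihood (ML) estimate over a model $\mathcal{M}$ is $\hat\rho_{\mathrm{ML},\mathcal{M}}=\mathrm{argmax}_{\rho\in\mathcal{M}}\mathcal{L}(\rho)$. $\mathcal{I}$ denotes the (classical) Fisher information matrix at $\rho_0$ associated with the POVM and the $N$ samples; it is assumed to exist and to be invertible. In expressions involving $\mathcal{I}$, matrices $\rho$ are treated as vectors in the real vector space of Hermitian matrices with the Hilbert-Schmidt inner product, and $\mathcal{I}$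 is a matrix acting on that space, so $\mathrm{Tr}[\rho\,\mathcal{I}\rho]$ is the quadratic form of $\mathcal{I}$ evaluated at $\rho$. Definition (LAN). A model $\mathcal{M}$ satisfies local asymptotic normality if, as $N\to\infty$: (i) the ML estimate $\hat\rho_{\mathrm{ML},\mathcal{M}}$ is normally distributed around $\rho_0$ with covariance matrix $\mathcal{I}^{-1}$, i.e. $\Pr(\hat\rho_{\mathrm{ML},\mathcal{M}})\propto\exp\left(-\mathrm{Tr}[(\rho_0-\hat\rho_{\mathrm{ML},\mathcal{M}})\mathcal{I}(\rho_0-\hat\rho_{\mathrm{ML},\mathcal{M}})]/2\right)$; and (ii) the likelihood function in a neighborhood of $\hat\rho_{\mathrm{ML},\mathcal{M}}$ is locally Gaussian with Hessian $\mathcal{I}$, i.e. $\mathcal{L}(\rho)\propto\exp\left(-\mathrm{Tr}[(\rho-\hat\rho_{\mathrm{ML},\mathcal{M}})\mathcal{I}(\rho-\hat\rho_{\mathrm{ML},\mathcal{M}})]/2\right)$. Definition (MP-LAN). A model $\mathcal{M}$ satisfies metric-projected local asymptotic normality if $\mathcal{M}$ is a convex subset of a model $\mathcal{M}'$ that satisfies LAN. *)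

theory Defs
  imports "HOL-Probability.Probability"
begin

section \<open>Operators, states and measurements\<close>

definition adjoint_matrix :: "complex^'n^'n \<Rightarrow> complex^'n^'n" where
  "adjoint_matrix A = (\<chi> i j. cnj (A $ j $ i))"

definition hermitian_matrices :: "(complex^'n^'n) set" where
  "hermitian_matrices = {A. adjoint_matrix A = A}"

definition positive_semidefinite :: "complex^'n^'n \<Rightarrow> bool" where
  "positive_semidefinite A \<longleftrightarrow>
     A \<in> hermitian_matrices \<and> (\<forall>v. 0 \<le> Re (\<Sum>i\<in>UNIV. cnj (v $ i) * (A *v v) $ i))"

definition density_matrices :: "(complex^'n^'n) set" where
  "density_matrices = {\<rho>. trace \<rho> = 1 \<and> positive_semidefinite \<rho>}"

definition povm :: "('j::finite \<Rightarrow> complex^'n^'n) \<Rightarrow> bool" where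
  "povm E \<longleftrightarrow> (\<forall>j. positive_semidefinite (E j)) \<and> (\<Sum>j\<in>UNIV. E j) = mat 1"

text \<open>On Hermitian matrices the trace below is real, so taking the real part loses nothing.\<close>

definition born :: "complex^'n^'n \<Rightarrow> complex^'n^'n \<Rightarrow> real" where
  "born \<rho> A = Re (trace (\<rho> ** A))"

text \<open>The library's real inner product on \<^typ>\<open>complex^'n^'n\<close> is the Hilbert--Schmidt inner
  product; all inner products, norms, gradients and limits below refer to it.\<close>

lemma inner_eq_trace: "A \<bullet> B = Re (trace (adjoint_matrix A ** B))"
  for A B :: "complex^'n^'n"
proof -
  have "Re (trace (adjoint_matrix A ** B)) = (\<Sum>i\<in>UNIV. \<Sum>k\<in>UNIV. A $ k $ i \<bullet> B $ k $ i)"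
    by (simp add: trace_def adjoint_matrix_def matrix_matrix_mult_def inner_complex_def)
  also have "\<dots> = (\<Sum>k\<in>UNIV. \<Sum>i\<in>UNIV. A $ k $ i \<bullet> B $ k $ i)"
    by (rule sum.swap)
  finally show ?thesis
    by (simp add: inner_vec_def)
qed

section \<open>Data, likelihood and maximum likelihood estimate\<close>

definition outcome_pmf :: "('j::finite \<Rightarrow> complex^'n^'n) \<Rightarrow> complex^'n^'n \<Rightarrow> 'j pmf" where
  "outcome_pmf E \<rho>\<^sub>0 = embed_pmf (\<lambda>j. born \<rho>\<^sub>0 (E j))"

text \<open>All sample sizes are realised on one probability space: an infinite sequence of independent
  outcomes, of which the first \<open>N\<close> entries are the data obtained from \<open>N\<close> copies.\<close>

definition samples :: "('j::finite \<Rightarrow> complex^'n^'n) \<Rightarrow> complex^'n^'n \<Rightarrow> (nat \<Rightarrow> 'j) measure" where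
  "samples E \<rho>\<^sub>0 = (\<Pi>\<^sub>M i\<in>UNIV. measure_pmf (outcome_pmf E \<rho>\<^sub>0))"

definition counts :: "nat \<Rightarrow> (nat \<Rightarrow> 'j) \<Rightarrow> 'j \<Rightarrow> nat" where
  "counts N \<omega> j = card {i. i < N \<and> \<omega> i = j}"

definition likelihood ::
    "('j::finite \<Rightarrow> complex^'n^'n) \<Rightarrow> ('j \<Rightarrow> nat) \<Rightarrow> complex^'n^'n \<Rightarrow> real" where
  "likelihood E n \<rho> = (\<Prod>j\<in>UNIV. born \<rho> (E j) ^ n j)"

definition is_ml_estimate ::
    "('j::finite \<Rightarrow> complex^'n^'n) \<Rightarrow> (complex^'n^'n) set \<Rightarrow> ('j \<Rightarrow> nat) \<Rightarrow> complex^'n^'n \<Rightarrow> bool" where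
  "is_ml_estimate E M n \<rho> \<longleftrightarrow> is_arg_max (likelihood E n) (\<lambda>\<sigma>. \<sigma> \<in> M) \<rho>"

definition ml_estimate ::
    "('j::finite \<Rightarrow> complex^'n^'n) \<Rightarrow> (complex^'n^'n) set \<Rightarrow> ('j \<Rightarrow> nat) \<Rightarrow> complex^'n^'n" where
  "ml_estimate E M n = arg_max (likelihood E n) (\<lambda>\<sigma>. \<sigma> \<in> M)"

section \<open>Fisher information\<close>

text \<open>The score of outcome \<open>j\<close> is the gradient of its log-probability at \<open>\<rho>\<^sub>0\<close>. It is automatically
  Hermitian when \<open>E j\<close> is. It fails to exist exactly when \<open>E j \<noteq> 0\<close> has probability \<open>0\<close>; since
  \<open>ln 0 = 0\<close> here, the vacuous effect \<open>E j = 0\<close> has score \<open>0\<close> and is harmless.\<close>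

definition is_score ::
    "('j::finite \<Rightarrow> complex^'n^'n) \<Rightarrow> complex^'n^'n \<Rightarrow> 'j \<Rightarrow> complex^'n^'n \<Rightarrow> bool" where
  "is_score E \<rho>\<^sub>0 j S \<longleftrightarrow> (GDERIV (\<lambda>\<sigma>. ln (born \<sigma> (E j))) \<rho>\<^sub>0 :> S)"

definition score ::
    "('j::finite \<Rightarrow> complex^'n^'n) \<Rightarrow> complex^'n^'n \<Rightarrow> 'j \<Rightarrow> complex^'n^'n" where
  "score E \<rho>\<^sub>0 j = (THE S. is_score E \<rho>\<^sub>0 j S)"

definition fisher_exists :: "('j::finite \<Rightarrow> complex^'n^'n) \<Rightarrow> complex^'n^'n \<Rightarrow> bool" where
  "fisher_exists E \<rho>\<^sub>0 \<longleftrightarrow> (\<forall>j. \<exists>S. is_score E \<rho>\<^sub>0 j S)"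

text \<open>The expected outer product of the score with itself, acting as a linear map
  \<open>Y \<mapsto> E[(S \<bullet> Y) S]\<close>, times \<open>N\<close> because information is additive over independent samples.\<close>

definition fisher_information ::
    "('j::finite \<Rightarrow> complex^'n^'n) \<Rightarrow> complex^'n^'n \<Rightarrow> nat \<Rightarrow> complex^'n^'n \<Rightarrow> complex^'n^'n" where
  "fisher_information E \<rho>\<^sub>0 N Y =
     real N *\<^sub>R measure_pmf.expectation (outcome_pmf E \<rho>\<^sub>0)
       (\<lambda>j. (score E \<rho>\<^sub>0 j \<bullet> Y) *\<^sub>R score E \<rho>\<^sub>0 j)"

definition fisher_invertible :: "('j::finite \<Rightarrow> complex^'n^'n) \<Rightarrow> complex^'n^'n \<Rightarrow> nat \<Rightarrow> bool" where
  "fisher_invertible E \<rho>\<^sub>0 N \<longleftrightarrow>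
     bij_betw (fisher_information E \<rho>\<^sub>0 N) hermitian_matrices hermitian_matrices"

definition fisher_quadratic_form ::
    "('j::finite \<Rightarrow> complex^'n^'n) \<Rightarrow> complex^'n^'n \<Rightarrow> nat \<Rightarrow> complex^'n^'n \<Rightarrow> real" where
  "fisher_quadratic_form E \<rho>\<^sub>0 N X = X \<bullet> fisher_information E \<rho>\<^sub>0 N X"

section \<open>Gaussian distributions on a subspace\<close>

text \<open>Lebesgue measure on a linear subspace \<open>V\<close>, transported from coordinates with respect to an
  orthonormal basis of \<open>V\<close>; the choice of basis is immaterial.\<close>

definition subspace_lborel :: "'a::euclidean_space set \<Rightarrow> 'a measure" where
  "subspace_lborel V =
     (let B = (SOME B. B \<subseteq> V \<and> pairwise orthogonal B \<and> (\<forall>b\<in>B. norm b = 1) \<and> span B = V)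
      in distr (\<Pi>\<^sub>M b\<in>B. lborel) borel (\<lambda>c. \<Sum>b\<in>B. c b *\<^sub>R b))"

definition gaussian_on :: "'a::euclidean_space set \<Rightarrow> ('a \<Rightarrow> real) \<Rightarrow> 'a measure" where
  "gaussian_on V q =
     (let Z = (\<integral>\<^sup>+ x. ennreal (exp (- q x / 2)) \<partial>subspace_lborel V)
      in density (subspace_lborel V) (\<lambda>x. ennreal (exp (- q x / 2)) / Z))"

definition direction_space :: "'a::real_vector set \<Rightarrow> 'a set" where
  "direction_space M = span {x - y | x y. x \<in> M \<and> y \<in> M}"

section \<open>Local asymptotic normality\<close>

text \<open>The argmax is asymptotically well defined: with probability tending to \<open>1\<close> there is exactly
  one maximiser.\<close>

definition ml_well_defined ::
    "('j::finite \<Rightarrow> complex^'n^'n) \<Rightarrow> complex^'n^'n \<Rightarrow> (complex^'n^'n) set \<Rightarrow> bool" where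
  "ml_well_defined E \<rho>\<^sub>0 M \<longleftrightarrow>
     (\<lambda>N. measure (samples E \<rho>\<^sub>0)
        {\<omega> \<in> space (samples E \<rho>\<^sub>0). \<exists>!\<rho>. is_ml_estimate E M (counts N \<omega>) \<rho>}) \<longlonglongrightarrow> 1"

text \<open>Convergence in distribution of the estimate, rescaled by \<open>sqrt N\<close>. The substitution
  \<open>x = sqrt N * (\<rho> - \<rho>\<^sub>0)\<close> turns the quadratic form of the \<open>N\<close>-sample Fisher information into the
  one-sample form, so the limit does not depend on \<open>N\<close>. The Gaussian density is taken on the
  directions available inside the model.\<close>

definition ml_asymptotically_normal ::
    "('j::finite \<Rightarrow> complex^'n^'n) \<Rightarrow> complex^'n^'n \<Rightarrow> (complex^'n^'n) set \<Rightarrow> bool" where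
  "ml_asymptotically_normal E \<rho>\<^sub>0 M \<longleftrightarrow>
     (\<forall>f :: complex^'n^'n \<Rightarrow> real. continuous_on UNIV f \<longrightarrow> bounded (range f) \<longrightarrow>
        (\<lambda>N. \<integral>\<omega>. f (sqrt (real N) *\<^sub>R (ml_estimate E M (counts N \<omega>) - \<rho>\<^sub>0)) \<partial>samples E \<rho>\<^sub>0)
          \<longlonglongrightarrow> (\<integral>x. f x \<partial>gaussian_on (direction_space M) (fisher_quadratic_form E \<rho>\<^sub>0 1)))"

text \<open>Uniformly over neighbourhoods of the estimate of radius of order \<open>1 / sqrt N\<close>, the likelihood
  ratio to the maximum approaches, in probability, the Gaussian profile. Evaluating at the estimate
  itself shows that its likelihood is the constant of proportionality.\<close>

definition likelihood_locally_gaussian ::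
    "('j::finite \<Rightarrow> complex^'n^'n) \<Rightarrow> complex^'n^'n \<Rightarrow> (complex^'n^'n) set \<Rightarrow> bool" where
  "likelihood_locally_gaussian E \<rho>\<^sub>0 M \<longleftrightarrow>
     (\<forall>R>0. \<forall>\<epsilon>>0.
        (\<lambda>N. measure (samples E \<rho>\<^sub>0)
          {\<omega> \<in> space (samples E \<rho>\<^sub>0).
             let n = counts N \<omega>; \<rho>' = ml_estimate E M n in
             \<forall>\<rho>\<in>M. norm (\<rho> - \<rho>') \<le> R / sqrt (real N) \<longrightarrow>
               \<bar>likelihood E n \<rho> / likelihood E n \<rho>'
                  - exp (- fisher_quadratic_form E \<rho>\<^sub>0 N (\<rho> - \<rho>') / 2)\<bar> \<le> \<epsilon>}) \<longlonglongrightarrow> 1)"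

definition LAN ::
    "('j::finite \<Rightarrow> complex^'n^'n) \<Rightarrow> complex^'n^'n \<Rightarrow> (complex^'n^'n) set \<Rightarrow> bool" where
  "LAN E \<rho>\<^sub>0 M \<longleftrightarrow>
     M \<subseteq> hermitian_matrices \<and> ml_well_defined E \<rho>\<^sub>0 M \<and>
     ml_asymptotically_normal E \<rho>\<^sub>0 M \<and> likelihood_locally_gaussian E \<rho>\<^sub>0 M"

definition MP_LAN ::
    "('j::finite \<Rightarrow> complex^'n^'n) \<Rightarrow> complex^'n^'n \<Rightarrow> (complex^'n^'n) set \<Rightarrow> bool" where
  "MP_LAN E \<rho>\<^sub>0 M \<longleftrightarrow> convex M \<and> (\<exists>M'. M \<subseteq> M' \<and> LAN E \<rho>\<^sub>0 M')"

end

theory Submission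
  imports Defs
begin

text \<open>The larger model is the set of Hermitian matrices of trace one on which all Born probabilities
  are nonnegative. Invertibility of the Fisher information makes the effects span the Hermitian
  matrices, so this model is compact and \<open>\<rho>\<^sub>0\<close> lies in its relative interior. The likelihood is
  strictly log-concave there and its maximiser is a smooth function of the observed frequencies:
  the first-order condition gives, for \<open>x = freq - p\<close>, the expansion
  \<open>\<rho> - \<rho>\<^sub>0 = \<Sum>\<^sub>j x\<^sub>j a\<^sub>j + O(x\<^sup>2)\<close> with fixed vectors \<open>a\<^sub>j\<close>. The linear part, scaled
  by \<open>sqrt N\<close>, is a normalised sum of independent vectors; the one-dimensional central limit theorem
  applied to its projections, together with approximation of test functions by trigonometric
  polynomials, gives convergence in distribution. The law of a projection of the Gaussian limit
  follows from translation invariance of Lebesgue measure. A second-order expansion of the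
  log-likelihood at the maximiser gives the Gaussian profile.\<close>

section \<open>Gaussian measures on a subspace\<close>

text \<open>Over the density matrices themselves LAN can fail: a rank-deficient
  \<open>\<rho>\<^sub>0\<close> lies on the boundary of the positive cone, which cuts off the
  fluctuations of the estimate. Dropping all inequalities fails too: where some Born probability is
  negative, even counts keep the likelihood positive and possibly unbounded. Keeping exactly the
  inequalities for the Born probabilities avoids both: existence of the scores forces every nonzero
  effect to have positive probability at \<open>\<rho>\<^sub>0\<close>, so no nontrivial inequality
  is tight there. Analysis and probability meet only in the event \<open>near n \<delta>\<close>, on
  which the frequencies are within \<delta> of the true probabilities. On it all estimates are
  deterministic, with errors of order \<delta>^2 for the linearised estimate and N \<delta>^3 for
  the log-likelihood. With \<delta> = R / sqrt N the rescaled errors vanish for each fixed R as N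
  grows, while Chebyshev's inequality makes the event as likely as desired once R is large.\<close>

lemma subspace_lborel_eq:
  fixes V :: "'a::euclidean_space set"
  assumes "subspace V"
  obtains B where "finite B" "pairwise orthogonal B" "\<And>b. b \<in> B \<Longrightarrow> norm b = 1" "span B = V"
    "subspace_lborel V = distr (\<Pi>\<^sub>M b\<in>B. lborel) borel (\<lambda>c. \<Sum>b\<in>B. c b *\<^sub>R b)"
proof -
  let ?P = "\<lambda>B. B \<subseteq> V \<and> pairwise orthogonal B \<and> (\<forall>b\<in>B. norm b = 1) \<and> span B = V"
  obtain C where "C \<subseteq> V" "pairwise orthogonal C" "\<And>x. x \<in> C \<Longrightarrow> norm x = 1" "span C = V"
    using orthonormal_basis_subspace [OF assms] by metis
  then have ex: "\<exists>B. ?P B" by blast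
  define B where "B = (SOME B. ?P B)"
  have B: "?P B" unfolding B_def by (rule someI_ex[OF ex])
  have "0 \<notin> B" using B by (metis norm_zero zero_neq_one)
  then have "independent B" using B pairwise_orthogonal_independent by blast
  then have "finite B" by (rule independent_imp_finite)
  moreover have "subspace_lborel V = distr (\<Pi>\<^sub>M b\<in>B. lborel) borel (\<lambda>c. \<Sum>b\<in>B. c b *\<^sub>R b)"
    unfolding subspace_lborel_def Let_def B_def by (rule refl)
  ultimately show ?thesis
    using B by (intro that[of B]) auto
qed

text \<open>The preimage of a box under the shift is again a box, with translated sides, and boxes
  determine the product measure. Restricting to \<open>B\<close> keeps the shifted function
  extensional, hence inside the space of the product.\<close>

lemma nn_integral_PiM_lborel_shift:
  fixes d :: "'i \<Rightarrow> 'a::euclidean_space"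
  assumes "finite B" and f [measurable]: "f \<in> borel_measurable (\<Pi>\<^sub>M b\<in>B. lborel)"
  shows "(\<integral>\<^sup>+c. f (\<lambda>b\<in>B. c b + d b) \<partial>(\<Pi>\<^sub>M b\<in>B. lborel)) = (\<integral>\<^sup>+c. f c \<partial>(\<Pi>\<^sub>M b\<in>B. lborel))"
proof -
  interpret product_sigma_finite "\<lambda>b::'i. lborel :: 'a measure" ..
  let ?P = "\<Pi>\<^sub>M b\<in>B. lborel :: 'a measure"
  let ?T = "\<lambda>c. \<lambda>b\<in>B. c b + d b"
  have T [measurable]: "?T \<in> measurable ?P ?P"
    by measurable
  have "distr ?P ?P ?T = ?P"
  proof (rule PiM_eqI)
    fix A :: "'i \<Rightarrow> 'a set" assume A: "\<And>i. i \<in> B \<Longrightarrow> A i \<in> sets lborel"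
    have "emeasure (distr ?P ?P ?T) (Pi\<^sub>E B A) = emeasure ?P (?T -` Pi\<^sub>E B A \<inter> space ?P)"
      using A \<open>finite B\<close> by (intro emeasure_distr T sets_PiM_I_finite) auto
    also have "?T -` Pi\<^sub>E B A \<inter> space ?P = Pi\<^sub>E B (\<lambda>b. (\<lambda>x. x + d b) -` A b)"
      by (auto simp: space_PiM PiE_def Pi_def extensional_def restrict_def)
    also have "emeasure ?P \<dots> = (\<Prod>b\<in>B. emeasure lborel ((\<lambda>x. x + d b) -` A b))"
      using A \<open>finite B\<close>
      by (intro emeasure_PiM) (auto intro!: measurable_sets_borel[where M=borel])
    also have "\<dots> = (\<Prod>b\<in>B. emeasure lborel (A b))"
    proof (rule prod.cong[OF refl])
      fix b assume b: "b \<in> B"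
      have commute: "(+) (d b) = (\<lambda>x. x + d b)" by (auto simp: add.commute)
      have "emeasure lborel (A b) = emeasure (distr lborel borel (\<lambda>x. d b + x)) (A b)"
        by (simp add: lborel_distr_plus)
      also have "\<dots> = emeasure lborel ((\<lambda>x. x + d b) -` A b)"
        using A[OF b] commute by (subst emeasure_distr) auto
      finally show "emeasure lborel ((\<lambda>x. x + d b) -` A b) = emeasure lborel (A b)" by simp
    qed
    finally show "emeasure (distr ?P ?P ?T) (Pi\<^sub>E B A) = (\<Prod>i\<in>B. emeasure lborel (A i))" .
  qed (simp_all add: \<open>finite B\<close>)
  then show ?thesis
    using nn_integral_distr[OF T, of f] f by simp
qed

lemma sets_subspace_lborel [simp, measurable_cong]: "sets (subspace_lborel V) = sets borel"
  by (simp add: subspace_lborel_def Let_def)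

lemma space_subspace_lborel [simp]: "space (subspace_lborel V) = UNIV"
  by (simp add: subspace_lborel_def Let_def)

text \<open>Makes identities that hold only on \<open>V\<close>, such as completing the square,
  usable under integrals over the ambient space.\<close>

lemma AE_subspace_lborel:
  fixes V :: "'a::euclidean_space set"
  assumes "subspace V"
  shows "AE x in subspace_lborel V. x \<in> V"
proof -
  obtain B where B: "finite B" "pairwise orthogonal B" "\<And>b. b \<in> B \<Longrightarrow> norm b = 1" "span B = V"
    and eq: "subspace_lborel V = distr (\<Pi>\<^sub>M b\<in>B. lborel) borel (\<lambda>c. \<Sum>b\<in>B. c b *\<^sub>R b)"
    by (rule subspace_lborel_eq[OF assms]) (rule that)
  have [measurable]: "V \<in> sets borel"
    using closed_subspace[OF assms] by (rule borel_closed)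
  have "(\<Sum>b\<in>B. c b *\<^sub>R b) \<in> V" for c
    unfolding B(4)[symmetric] by (intro span_sum span_scale span_base)
  then show ?thesis
    unfolding eq by (subst AE_distr_iff) auto
qed

text \<open>In coordinates, translation by \<open>a\<close> is the shift by the coordinates
  \<open>d\<close> of \<open>a\<close>; these exist because \<open>a\<close> lies in
  \<open>V\<close>.\<close>

lemma nn_integral_subspace_lborel_translate:
  fixes V :: "'a::euclidean_space set"
  assumes V: "subspace V" and a: "a \<in> V" and f [measurable]: "f \<in> borel_measurable borel"
  shows "(\<integral>\<^sup>+x. f (x + a) \<partial>subspace_lborel V) = (\<integral>\<^sup>+x. f x \<partial>subspace_lborel V)"
proof -
  obtain B where B: "finite B" "pairwise orthogonal B" "\<And>b. b \<in> B \<Longrightarrow> norm b = 1" "span B = V"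
    and eq: "subspace_lborel V = distr (\<Pi>\<^sub>M b\<in>B. lborel) borel (\<lambda>c. \<Sum>b\<in>B. c b *\<^sub>R b)"
    by (rule subspace_lborel_eq[OF V]) (rule that)
  obtain d where d: "a = (\<Sum>b\<in>B. d b *\<^sub>R b)"
    using a B(1,4) by (auto simp: span_finite)
  have "(\<integral>\<^sup>+x. f (x + a) \<partial>subspace_lborel V)
      = (\<integral>\<^sup>+c. f ((\<Sum>b\<in>B. (\<lambda>b\<in>B. c b + d b) b *\<^sub>R b)) \<partial>(\<Pi>\<^sub>M b\<in>B. lborel))"
    by (simp add: eq nn_integral_distr d scaleR_add_left sum.distrib)
  also have "\<dots> = (\<integral>\<^sup>+c. f (\<Sum>b\<in>B. c b *\<^sub>R b) \<partial>(\<Pi>\<^sub>M b\<in>B. lborel))"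
    by (rule nn_integral_PiM_lborel_shift[OF B(1)]) measurable
  also have "\<dots> = (\<integral>\<^sup>+x. f x \<partial>subspace_lborel V)"
    by (simp add: eq nn_integral_distr)
  finally show ?thesis .
qed

lemma nn_integral_gaussian_1d_finite:
  assumes "\<kappa> > (0::real)"
  shows "(\<integral>\<^sup>+y. ennreal (exp (- (\<kappa> * y\<^sup>2) / 2)) \<partial>lborel) < \<infinity>"
proof -
  \<comment> \<open>The standard deviation belonging to precision \<kappa>: the integrand is a
    constant multiple of the normal density with this deviation.\<close>
  define s where "s = 1 / sqrt \<kappa>"
  have s: "s > 0" "s\<^sup>2 = 1 / \<kappa>" using assms by (auto simp: s_def power_divide)
  have "(\<integral>\<^sup>+y. ennreal (exp (- (\<kappa> * y\<^sup>2) / 2)) \<partial>lborel)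
      = (\<integral>\<^sup>+y. ennreal (sqrt (2 * pi * s\<^sup>2)) * ennreal (normal_density 0 s y) \<partial>lborel)"
  proof (rule nn_integral_cong)
    fix y
    have "2 * s\<^sup>2 = 2 / \<kappa>" by (simp add: s)
    then have "- (\<kappa> * y\<^sup>2) / 2 = - (y - 0)\<^sup>2 / (2 * s\<^sup>2)"
      using assms by (simp only: ) (simp add: field_simps)
    moreover have "sqrt (2 * pi * s\<^sup>2) \<noteq> 0" using s(1) by simp
    ultimately have "exp (- (\<kappa> * y\<^sup>2) / 2) = sqrt (2 * pi * s\<^sup>2) * normal_density 0 s y"
      by (simp add: normal_density_def)
    then show "ennreal (exp (- (\<kappa> * y\<^sup>2) / 2)) = ennreal (sqrt (2 * pi * s\<^sup>2)) * ennreal (normal_density 0 s y)"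
      by (simp add: ennreal_mult[symmetric])
  qed
  also have "\<dots> = ennreal (sqrt (2 * pi * s\<^sup>2)) * (\<integral>\<^sup>+y. ennreal (normal_density 0 s y) \<partial>lborel)"
    by (rule nn_integral_cmult) simp
  also have "(\<integral>\<^sup>+y. ennreal (normal_density 0 s y) \<partial>lborel) = 1"
    using prob_space.emeasure_space_1[OF prob_space_normal_density[OF s(1)]]
    by (simp add: emeasure_density)
  finally show ?thesis by simp
qed

text \<open>Finiteness: by Pythagoras the lower bound on \<open>q\<close> dominates the integrand by
  a product of one-dimensional Gaussians. Positivity: the integrand vanishes nowhere and the measure
  is not null, even for V = {0}, where the empty product gives mass 1.\<close>

lemma gaussian_on_normalizer:
  fixes V :: "'a::euclidean_space set"
  assumes V: "subspace V" and q [measurable]: "q \<in> borel_measurable borel"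
    and "\<kappa> > 0" and lower: "\<And>x. x \<in> V \<Longrightarrow> q x \<ge> \<kappa> * (norm x)\<^sup>2"
  defines "Z \<equiv> (\<integral>\<^sup>+ x. ennreal (exp (- q x / 2)) \<partial>subspace_lborel V)"
  shows "Z \<noteq> 0" "Z \<noteq> \<infinity>"
proof -
  obtain B where B: "finite B" "pairwise orthogonal B" "\<And>b. b \<in> B \<Longrightarrow> norm b = 1" "span B = V"
    and eq: "subspace_lborel V = distr (\<Pi>\<^sub>M b\<in>B. lborel) borel (\<lambda>c. \<Sum>b\<in>B. c b *\<^sub>R b)"
    by (rule subspace_lborel_eq[OF V]) (rule that)
  interpret product_sigma_finite "\<lambda>b::'a. lborel :: real measure" ..
  have nrm: "(norm (\<Sum>b\<in>B. c b *\<^sub>R b))\<^sup>2 = (\<Sum>b\<in>B. (c b)\<^sup>2)" for c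
  proof -
    have "(norm (\<Sum>b\<in>B. c b *\<^sub>R b))\<^sup>2 = (\<Sum>b\<in>B. (norm (c b *\<^sub>R b))\<^sup>2)"
      using B(1,2) by (intro norm_sum_Pythagorean)
        (auto simp: pairwise_def orthogonal_def)
    also have "\<dots> = (\<Sum>b\<in>B. (c b)\<^sup>2)"
      by (intro sum.cong) (auto simp: B(3))
    finally show ?thesis .
  qed
  have inV: "(\<Sum>b\<in>B. c b *\<^sub>R b) \<in> V" for c
    unfolding B(4)[symmetric] by (intro span_sum span_scale span_base)
  have "Z = (\<integral>\<^sup>+ c. ennreal (exp (- q (\<Sum>b\<in>B. c b *\<^sub>R b) / 2)) \<partial>(\<Pi>\<^sub>M b\<in>B. lborel))"
    by (simp add: Z_def eq nn_integral_distr)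
  also have "\<dots> \<le> (\<integral>\<^sup>+ c. (\<Prod>b\<in>B. ennreal (exp (- (\<kappa> * (c b)\<^sup>2) / 2))) \<partial>(\<Pi>\<^sub>M b\<in>B. lborel))"
  proof (rule nn_integral_mono)
    fix c :: "'a \<Rightarrow> real"
    have "(\<Prod>b\<in>B. exp (- (\<kappa> * (c b)\<^sup>2) / 2)) = exp (- (\<kappa> * (\<Sum>b\<in>B. (c b)\<^sup>2)) / 2)"
      by (simp add: exp_sum[symmetric] B(1) sum_divide_distrib sum_distrib_left sum_negf)
    moreover have "q (\<Sum>b\<in>B. c b *\<^sub>R b) \<ge> \<kappa> * (\<Sum>b\<in>B. (c b)\<^sup>2)"
      using lower[OF inV] by (simp add: nrm)
    ultimately have "exp (- q (\<Sum>b\<in>B. c b *\<^sub>R b) / 2) \<le> (\<Prod>b\<in>B. exp (- (\<kappa> * (c b)\<^sup>2) / 2))"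
      by simp
    then show "ennreal (exp (- q (\<Sum>b\<in>B. c b *\<^sub>R b) / 2)) \<le> (\<Prod>b\<in>B. ennreal (exp (- (\<kappa> * (c b)\<^sup>2) / 2)))"
      by (subst prod_ennreal) (auto intro: ennreal_leI)
  qed
  also have "\<dots> = (\<Prod>b\<in>B. \<integral>\<^sup>+y. ennreal (exp (- (\<kappa> * y\<^sup>2) / 2)) \<partial>lborel)"
    by (intro product_nn_integral_prod[OF B(1)]) measurable
  also have "\<dots> < \<infinity>"
    using nn_integral_gaussian_1d_finite[OF \<open>\<kappa> > 0\<close>]
    by (auto simp: less_top[symmetric] ennreal_prod_eq_top simp del: prod_constant)
  finally show "Z \<noteq> \<infinity>" by simp
  have "emeasure (subspace_lborel V) UNIV = emeasure (\<Pi>\<^sub>M b\<in>B. lborel) (Pi\<^sub>E B (\<lambda>_. UNIV :: real set))"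
    by (simp add: eq emeasure_distr space_PiM)
  also have "\<dots> = (\<Prod>b\<in>B. emeasure lborel (UNIV::real set))"
    using B(1) by (intro emeasure_PiM) auto
  also have "\<dots> \<noteq> 0"
    using B(1) by simp
  finally have "emeasure (subspace_lborel V) UNIV \<noteq> 0" .
  then show "Z \<noteq> 0"
    unfolding Z_def by (subst nn_integral_0_iff) auto
qed

lemma sets_gaussian_on [simp, measurable_cong]: "sets (gaussian_on V q) = sets borel"
  by (simp add: gaussian_on_def Let_def)

lemma space_gaussian_on [simp]: "space (gaussian_on V q) = UNIV"
  by (simp add: gaussian_on_def Let_def)

lemma AE_gaussian_on:
  fixes V :: "'a::euclidean_space set"
  assumes V: "subspace V" and q [measurable]: "q \<in> borel_measurable borel"
  shows "AE x in gaussian_on V q. x \<in> V"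
  using AE_subspace_lborel[OF V] unfolding gaussian_on_def Let_def
  by (subst AE_density) (auto elim: eventually_mono)

lemma prob_space_gaussian_on:
  fixes V :: "'a::euclidean_space set"
  assumes V: "subspace V" and q [measurable]: "q \<in> borel_measurable borel"
    and "\<kappa> > 0" and lower: "\<And>x. x \<in> V \<Longrightarrow> q x \<ge> \<kappa> * (norm x)\<^sup>2"
  shows "prob_space (gaussian_on V q)"
proof
  define Z where "Z = (\<integral>\<^sup>+ x. ennreal (exp (- q x / 2)) \<partial>subspace_lborel V)"
  note Z = gaussian_on_normalizer[OF assms, folded Z_def]
  have "emeasure (gaussian_on V q) (space (gaussian_on V q))
      = (\<integral>\<^sup>+ x. ennreal (exp (- q x / 2)) / Z \<partial>subspace_lborel V)"
    by (simp add: gaussian_on_def Let_def Z_def emeasure_density)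
  also have "\<dots> = Z / Z"
    by (simp add: nn_integral_divide Z_def)
  also have "\<dots> = 1" using Z by (simp add: ennreal_divide_self less_top)
  finally show "emeasure (gaussian_on V q) (space (gaussian_on V q)) = 1" .
qed

section \<open>Projections of a Gaussian measure\<close>

text \<open>The assumption \<open>inv\<close> is the quasi-invariance of the standard normal law
  under shifts. Reweighting \<nu> by \<open>w\<close> turns it into genuine translation invariance,
  and a translation-invariant measure is a multiple of Lebesgue measure.\<close>

lemma std_normal_eqI:
  fixes \<nu> :: "real measure"
  assumes "prob_space \<nu>" and sets [measurable_cong]: "sets \<nu> = sets borel"
    and inv: "\<And>h s. h \<in> borel_measurable borel \<Longrightarrow>
      (\<integral>\<^sup>+y. h (y + s) * ennreal (exp (- s * y - s\<^sup>2 / 2)) \<partial>\<nu>) = (\<integral>\<^sup>+y. h y \<partial>\<nu>)"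
  shows "\<nu> = std_normal_distribution"
proof -
  interpret prob_space \<nu> by fact
  interpret pair_sigma_finite lborel \<nu> ..
  define w :: "real \<Rightarrow> ennreal" where "w = (\<lambda>y. ennreal (exp (y\<^sup>2 / 2)))"
  have [measurable]: "w \<in> borel_measurable borel" by (simp add: w_def)
  have winv: "(\<integral>\<^sup>+y. k (y + s) * w y \<partial>\<nu>) = (\<integral>\<^sup>+y. k y * w y \<partial>\<nu>)"
    if [measurable]: "k \<in> borel_measurable borel" for k s
  proof -
    have "w (y + s) * ennreal (exp (- s * y - s\<^sup>2 / 2)) = w y" for y
      by (simp add: w_def ennreal_mult[symmetric] exp_add[symmetric] power2_sum add_divide_distrib)
    then show ?thesis
      using inv[of "\<lambda>y. k y * w y" s] by (simp add: mult.assoc)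
  qed
  \<comment> \<open>The mass that the reweighted measure gives to the interval from -1 to 0. It need
    not be known to be finite, since all integrals are nonnegative.\<close>
  define c where "c = (\<integral>\<^sup>+y. indicator {0..1} (- y) * w y \<partial>\<nu>)"
  \<comment> \<open>The uniqueness argument for Haar measure: average over shifts \<open>u\<close>
    in the unit interval, exchange the integrals, substitute v = y + u, exchange back, and use
    invariance in \<open>y\<close> once more to free the inner integral of \<open>v\<close>.\<close>
  have key: "(\<integral>\<^sup>+y. k y * w y \<partial>\<nu>) = c * (\<integral>\<^sup>+v. k v \<partial>lborel)"
    if [measurable]: "k \<in> borel_measurable borel" for k
  proof -
    let ?I = "indicator {0..1::real} :: real \<Rightarrow> ennreal"
    have "(\<integral>\<^sup>+y. k y * w y \<partial>\<nu>) = (\<integral>\<^sup>+u. ?I u * (\<integral>\<^sup>+y. k y * w y \<partial>\<nu>) \<partial>lborel)"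
      by (simp add: nn_integral_multc)
    also have "\<dots> = (\<integral>\<^sup>+u. (\<integral>\<^sup>+y. ?I u * (k (y + u) * w y) \<partial>\<nu>) \<partial>lborel)"
      by (subst nn_integral_cmult) (auto simp: winv)
    also have "\<dots> = (\<integral>\<^sup>+y. (\<integral>\<^sup>+u. ?I u * (k (y + u) * w y) \<partial>lborel) \<partial>\<nu>)"
      by (rule Fubini'[symmetric]) measurable
    also have "\<dots> = (\<integral>\<^sup>+y. (\<integral>\<^sup>+v. ?I (v - y) * (k v * w y) \<partial>lborel) \<partial>\<nu>)"
    proof (rule nn_integral_cong)
      fix y
      show "(\<integral>\<^sup>+u. ?I u * (k (y + u) * w y) \<partial>lborel) = (\<integral>\<^sup>+v. ?I (v - y) * (k v * w y) \<partial>lborel)"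
        by (subst (2) nn_integral_real_affine[where c=1 and t=y]) auto
    qed
    also have "\<dots> = (\<integral>\<^sup>+v. (\<integral>\<^sup>+y. ?I (v - y) * (k v * w y) \<partial>\<nu>) \<partial>lborel)"
      by (rule Fubini') measurable
    also have "\<dots> = (\<integral>\<^sup>+v. k v * c \<partial>lborel)"
    proof (rule nn_integral_cong)
      fix v
      have "(\<integral>\<^sup>+y. ?I (v - y) * (k v * w y) \<partial>\<nu>) = (\<integral>\<^sup>+y. k v * (?I (- (y + - v)) * w y) \<partial>\<nu>)"
        by (intro nn_integral_cong) (simp add: mult_ac)
      also have "\<dots> = k v * (\<integral>\<^sup>+y. ?I (- (y + - v)) * w y \<partial>\<nu>)"
        by (rule nn_integral_cmult) measurable
      also have "(\<integral>\<^sup>+y. ?I (- (y + - v)) * w y \<partial>\<nu>) = c"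
        unfolding c_def by (rule winv) measurable
      finally show "(\<integral>\<^sup>+y. ?I (v - y) * (k v * w y) \<partial>\<nu>) = k v * c" .
    qed
    also have "\<dots> = c * (\<integral>\<^sup>+v. k v \<partial>lborel)"
      by (subst nn_integral_multc) (auto simp: mult.commute)
    finally show ?thesis .
  qed
  define C where "C = c * ennreal (sqrt (2 * pi))"
  have int: "(\<integral>\<^sup>+y. h y \<partial>\<nu>) = C * (\<integral>\<^sup>+v. h v * ennreal (std_normal_density v) \<partial>lborel)"
    if [measurable]: "h \<in> borel_measurable borel" for h
  proof -
    have 1: "ennreal (exp (- (y\<^sup>2 / 2))) * w y = 1" for y
      by (simp add: w_def ennreal_mult[symmetric] exp_add[symmetric])
    have 2: "ennreal (exp (- (y\<^sup>2 / 2))) = ennreal (sqrt (2 * pi)) * ennreal (std_normal_density y)" for y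
      by (simp add: std_normal_density_def ennreal_mult[symmetric])
    have "(\<integral>\<^sup>+y. h y \<partial>\<nu>) = (\<integral>\<^sup>+y. (h y * ennreal (exp (- (y\<^sup>2 / 2)))) * w y \<partial>\<nu>)"
      by (simp add: mult.assoc 1)
    also have "\<dots> = c * (\<integral>\<^sup>+y. h y * ennreal (exp (- (y\<^sup>2 / 2))) \<partial>lborel)"
      by (rule key) measurable
    also have "(\<integral>\<^sup>+y. h y * ennreal (exp (- (y\<^sup>2 / 2))) \<partial>lborel)
        = ennreal (sqrt (2 * pi)) * (\<integral>\<^sup>+v. h v * ennreal (std_normal_density v) \<partial>lborel)"
      by (subst nn_integral_cmult[symmetric]) (auto simp: 2 mult_ac)
    finally show ?thesis by (simp add: C_def mult.assoc)
  qed
  have "(\<integral>\<^sup>+v. ennreal (std_normal_density v) \<partial>lborel) = 1"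
    using prob_space.emeasure_space_1[OF prob_space_normal_density[of 1 0]]
    by (simp add: emeasure_density)
  \<comment> \<open>Both measures have total mass 1, so testing with the constant 1 determines the
    factor.\<close>
  then have C: "C = 1"
    using int[of "\<lambda>_. 1"] emeasure_space_1 by simp
  show ?thesis
  proof (rule measure_eqI)
    show "sets \<nu> = sets std_normal_distribution" by (simp add: sets)
    fix A assume "A \<in> sets \<nu>"
    then have [measurable]: "A \<in> sets borel" by (simp add: sets)
    show "emeasure \<nu> A = emeasure std_normal_distribution A"
      using int[of "indicator A"] by (simp add: C emeasure_density sets mult.commute)
  qed
qed

text \<open>\<open>r\<close> is the direction dual to \<open>t\<close> under the quadratic form. By
  completing the square, a translation along \<open>r\<close> multiplies the Gaussian density by the
  factor occurring in \<open>std_normal_eqI\<close>, so the projection is identified without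
  diagonalising \<open>q\<close>. The condition \<open>t \<bullet> r = 1\<close> normalises its
  variance.\<close>

lemma distr_gaussian_on_inner:
  fixes V :: "'a::euclidean_space set"
  assumes V: "subspace V" and q [measurable]: "q \<in> borel_measurable borel"
    and "\<kappa> > 0" and lower: "\<And>x. x \<in> V \<Longrightarrow> q x \<ge> \<kappa> * (norm x)\<^sup>2"
    and r: "r \<in> V" "t \<bullet> r = 1"
    and shift: "\<And>x s. x \<in> V \<Longrightarrow> q (x + s *\<^sub>R r) = q x + 2 * s * (t \<bullet> x) + s\<^sup>2"
  shows "distr (gaussian_on V q) borel (\<lambda>x. t \<bullet> x) = std_normal_distribution"
proof -
  interpret prob_space "gaussian_on V q"
    by (rule prob_space_gaussian_on[OF V q \<open>\<kappa> > 0\<close> lower])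
  have prob: "prob_space (distr (gaussian_on V q) borel (\<lambda>x. t \<bullet> x))"
    by (rule prob_space_distr) measurable
  have inv: "(\<integral>\<^sup>+y. h (y + s) * ennreal (exp (- s * y - s\<^sup>2 / 2)) \<partial>distr (gaussian_on V q) borel ((\<bullet>) t))
     = (\<integral>\<^sup>+y. h y \<partial>distr (gaussian_on V q) borel ((\<bullet>) t))"
    if [measurable]: "h \<in> borel_measurable borel" for h :: "real \<Rightarrow> ennreal" and s
  proof -
    define Z where "Z = (\<integral>\<^sup>+ x. ennreal (exp (- q x / 2)) \<partial>subspace_lborel V)"
    have G: "(\<integral>\<^sup>+x. g x \<partial>gaussian_on V q) = (\<integral>\<^sup>+x. ennreal (exp (- q x / 2)) / Z * g x \<partial>subspace_lborel V)"
      if [measurable]: "g \<in> borel_measurable borel" for g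
      by (simp add: gaussian_on_def Let_def Z_def nn_integral_density)
    have "(\<integral>\<^sup>+y. h (y + s) * ennreal (exp (- s * y - s\<^sup>2 / 2)) \<partial>distr (gaussian_on V q) borel ((\<bullet>) t))
        = (\<integral>\<^sup>+x. ennreal (exp (- q x / 2)) / Z * (h (t \<bullet> x + s) * ennreal (exp (- s * (t \<bullet> x) - s\<^sup>2 / 2))) \<partial>subspace_lborel V)"
      by (simp add: nn_integral_distr G)
    also have "\<dots> = (\<integral>\<^sup>+x. (ennreal (exp (- q (x + s *\<^sub>R r) / 2)) / Z * h (t \<bullet> (x + s *\<^sub>R r))) \<partial>subspace_lborel V)"
    proof (rule nn_integral_cong_AE)
      show "AE x in subspace_lborel V.
        ennreal (exp (- q x / 2)) / Z * (h (t \<bullet> x + s) * ennreal (exp (- s * (t \<bullet> x) - s\<^sup>2 / 2)))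
        = ennreal (exp (- q (x + s *\<^sub>R r) / 2)) / Z * h (t \<bullet> (x + s *\<^sub>R r))"
        using AE_subspace_lborel[OF V]
      proof eventually_elim
        case (elim x)
        have "exp (- q (x + s *\<^sub>R r) / 2) = exp (- q x / 2) * exp (- s * (t \<bullet> x) - s\<^sup>2 / 2)"
          unfolding shift[OF elim] exp_add[symmetric] by (rule arg_cong[where f=exp]) (simp add: field_simps)
        then show ?case
          using r(2) by (simp only: inner_add_right inner_scaleR_right mult_1_right mult_1_left
              ennreal_mult[OF exp_ge_zero exp_ge_zero] divide_ennreal_def mult_ac)
      qed
    qed
    also have "\<dots> = (\<integral>\<^sup>+x. (ennreal (exp (- q x / 2)) / Z * h (t \<bullet> x)) \<partial>subspace_lborel V)"
      by (rule nn_integral_subspace_lborel_translate[OF V subspace_scale[OF V r(1)],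
            where f="\<lambda>x. ennreal (exp (- q x / 2)) / Z * h (t \<bullet> x)"]) measurable
    also have "\<dots> = (\<integral>\<^sup>+y. h y \<partial>distr (gaussian_on V q) borel ((\<bullet>) t))"
      by (simp add: nn_integral_distr G)
    finally show ?thesis .
  qed
  show ?thesis
    by (rule std_normal_eqI[OF prob _ inv]) simp_all
qed

section \<open>Convergence in distribution from trigonometric test functions\<close>

text \<open>The phase \<open>c\<close> brings sines and constants into the class, so one kind of
  generator suffices. Linearity of the expectation carries convergence from the generators to the
  whole class.\<close>

inductive trig_poly :: "('a::euclidean_space \<Rightarrow> real) \<Rightarrow> bool" where
  cos: "trig_poly (\<lambda>x. a * cos (t \<bullet> x + c))"
| add: "trig_poly f \<Longrightarrow> trig_poly g \<Longrightarrow> trig_poly (\<lambda>x. f x + g x)"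

lemma trig_poly_cos_mult:
  assumes "trig_poly g"
  shows "trig_poly (\<lambda>x. a * cos (t \<bullet> x + c) * g x)"
  using assms
proof induction
  case (cos b s d)
  have "(\<lambda>x. a * cos (t \<bullet> x + c) * (b * cos (s \<bullet> x + d)))
      = (\<lambda>x. (a * b / 2) * cos ((t - s) \<bullet> x + (c - d)) + (a * b / 2) * cos ((t + s) \<bullet> x + (c + d)))"
  proof
    fix x
    have "a * cos (t \<bullet> x + c) * (b * cos (s \<bullet> x + d)) = a * b * (cos (t \<bullet> x + c) * cos (s \<bullet> x + d))"
      by simp
    also have "\<dots> = a * b * ((cos ((t \<bullet> x + c) - (s \<bullet> x + d)) + cos ((t \<bullet> x + c) + (s \<bullet> x + d))) / 2)"
      by (simp only: cos_times_cos)
    also have "(t \<bullet> x + c) - (s \<bullet> x + d) = (t - s) \<bullet> x + (c - d)"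
      by (simp add: inner_diff_left)
    also have "(t \<bullet> x + c) + (s \<bullet> x + d) = (t + s) \<bullet> x + (c + d)"
      by (simp add: inner_add_left)
    finally show "a * cos (t \<bullet> x + c) * (b * cos (s \<bullet> x + d))
        = (a * b / 2) * cos ((t - s) \<bullet> x + (c - d)) + (a * b / 2) * cos ((t + s) \<bullet> x + (c + d))"
      by (simp add: algebra_simps)
  qed
  then show ?case by (simp only:) (intro trig_poly.intros)
next
  case (add f g)
  then show ?case using trig_poly.add by (simp add: distrib_left)
qed

lemma trig_poly_mult:
  assumes "trig_poly f" "trig_poly g"
  shows "trig_poly (\<lambda>x. f x * g x)"
  using assms(1)
proof induction
  case cos
  then show ?case by (rule trig_poly_cos_mult[OF assms(2)])
next
  case (add f f')
  then show ?case using trig_poly.add by (simp add: distrib_right)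
qed

lemma trig_poly_const: "trig_poly (\<lambda>x. c)"
  using trig_poly.cos[of c 0 0] by simp

lemma trig_poly_sum:
  assumes "finite A" "\<And>i. i \<in> A \<Longrightarrow> trig_poly (f i)"
  shows "trig_poly (\<lambda>x. \<Sum>i\<in>A. f i x)"
  using assms by (induction A rule: finite_induct) (auto intro: trig_poly_const trig_poly.add)

lemma trig_poly_sin: "trig_poly (\<lambda>x. a * sin (\<delta> * (x \<bullet> b)))"
proof -
  have "a * sin (\<delta> * (x \<bullet> b)) = a * cos ((\<delta> *\<^sub>R b) \<bullet> x + (- pi / 2))" for x
    by (simp add: cos_diff inner_commute)
  then show ?thesis by (simp only: trig_poly.cos)
qed

lemma trig_poly_polynomial_sin:
  fixes P :: "'a::euclidean_space \<Rightarrow> real"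
  assumes "real_polynomial_function P"
  shows "trig_poly (\<lambda>x::'a. P (\<Sum>b\<in>Basis. sin (\<delta> * (x \<bullet> b)) *\<^sub>R b))"
  using assms
proof induction
  case (linear h)
  then interpret bounded_linear h .
  have "trig_poly (\<lambda>x::'a. \<Sum>b\<in>Basis. h b * sin (\<delta> * (x \<bullet> b)))"
    by (intro trig_poly_sum trig_poly_sin) simp
  then show ?case by (simp add: sum scaleR mult.commute)
qed (auto intro: trig_poly_const trig_poly.add trig_poly_mult)

text \<open>Polynomials in the \<open>sin (\<delta> x\<^sub>b)\<close> approximate uniformly on a box, because \<open>sin\<close> is invertible
  there, and they stay bounded everywhere, because \<open>sin\<close> never leaves \<open>[-1, 1]\<close>.\<close>

lemma trig_poly_approximation:
  fixes f :: "'a::euclidean_space \<Rightarrow> real"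
  assumes f: "continuous_on UNIV f" and K: "\<And>x. \<bar>f x\<bar> \<le> K" and "\<epsilon> > 0" "R > 0"
  obtains g where "trig_poly g" "\<And>x. norm x \<le> R \<Longrightarrow> \<bar>f x - g x\<bar> \<le> \<epsilon>" "\<And>x. \<bar>g x\<bar> \<le> K + \<epsilon>"
proof -
  \<comment> \<open>Scales coordinates of size at most \<open>R\<close> into the interval from -pi/2
    to pi/2, on which \<open>arcsin\<close> inverts \<open>sin\<close>.\<close>
  define \<delta> where "\<delta> = pi / (2 * R)"
  have \<delta>: "\<delta> > 0" using \<open>R > 0\<close> by (simp add: \<delta>_def)
  define F where "F y = f (\<Sum>b\<in>Basis. (arcsin (y \<bullet> b) / \<delta>) *\<^sub>R b)" for y :: 'a
  define S where "S x = (\<Sum>b\<in>Basis. sin (\<delta> * (x \<bullet> b)) *\<^sub>R b)" for x :: 'a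
  let ?Q = "cbox (- One) One :: 'a set"
  have "continuous_on ?Q (\<lambda>y. \<Sum>b\<in>Basis. (arcsin (y \<bullet> b) / \<delta>) *\<^sub>R b)"
    using \<delta> by (intro continuous_intros) (auto simp: mem_box)
  then have "continuous_on ?Q F"
    unfolding F_def by (rule continuous_on_compose2[OF f]) auto
  then obtain P where P: "real_polynomial_function P" "\<And>y. y \<in> ?Q \<Longrightarrow> \<bar>F y - P y\<bar> < \<epsilon>"
    by (rule Stone_Weierstrass_real_polynomial_function[OF compact_cbox _ \<open>\<epsilon> > 0\<close>]) auto
  have S: "S x \<in> ?Q" for x
    by (simp add: mem_box S_def inner_sum_left_Basis)
  show ?thesis
  proof (rule that[of "\<lambda>x. P (S x)"])
    show "trig_poly (\<lambda>x. P (S x))"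
      unfolding S_def by (rule trig_poly_polynomial_sin[OF P(1)])
    fix x :: 'a
    show "\<bar>P (S x)\<bar> \<le> K + \<epsilon>"
      using P(2)[OF S, of x] K[of "\<Sum>b\<in>Basis. (arcsin (S x \<bullet> b) / \<delta>) *\<^sub>R b"] by (simp add: F_def)
    assume x: "norm x \<le> R"
    have "F (S x) = f x"
    proof -
      have "arcsin (S x \<bullet> b) / \<delta> = x \<bullet> b" if b: "b \<in> Basis" for b
      proof -
        have "\<bar>x \<bullet> b\<bar> \<le> R" using x Basis_le_norm[OF b, of x] by linarith
        then have "\<bar>\<delta> * (x \<bullet> b)\<bar> \<le> \<delta> * R" using \<delta> by (simp add: abs_mult)
        also have "\<delta> * R = pi / 2" using \<open>R > 0\<close> by (simp add: \<delta>_def)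
        finally have "arcsin (sin (\<delta> * (x \<bullet> b))) = \<delta> * (x \<bullet> b)"
          by (intro arcsin_sin) auto
        then show ?thesis using \<delta> b by (simp add: S_def inner_sum_left_Basis)
      qed
      then show ?thesis by (simp add: F_def euclidean_representation)
    qed
    then show "\<bar>f x - P (S x)\<bar> \<le> \<epsilon>" using P(2)[OF S, of x] by simp
  qed
qed

lemma continuous_on_trig_poly: "trig_poly g \<Longrightarrow> continuous_on UNIV g"
  by (induction rule: trig_poly.induct) (intro continuous_intros; assumption)+

lemma bounded_trig_poly: "trig_poly g \<Longrightarrow> bounded (range g)"
proof (induction rule: trig_poly.induct)
  case (cos a t c)
  have "\<bar>a * cos (t \<bullet> x + c)\<bar> \<le> \<bar>a\<bar>" for x
    by (simp add: abs_mult mult_left_le)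
  then show ?case by (auto simp: bounded_iff)
next
  case (add f g)
  then show ?case by (intro bounded_plus_comp)
qed

lemma (in prob_space) abs_expectation_split_le:
  fixes X :: "'a \<Rightarrow> 'b::euclidean_space"
  assumes X [measurable]: "random_variable borel X" and h [measurable]: "h \<in> borel_measurable borel"
    and A: "\<And>x. \<bar>h x\<bar> \<le> A" and \<epsilon>: "\<And>x. norm x \<le> R \<Longrightarrow> \<bar>h x\<bar> \<le> \<epsilon>" and "\<epsilon> \<ge> 0"
    and \<eta>: "prob {\<omega>\<in>space M. norm (X \<omega>) > R} \<le> \<eta>"
  shows "\<bar>expectation (\<lambda>\<omega>. h (X \<omega>))\<bar> \<le> \<epsilon> + A * \<eta>"
proof -
  let ?B = "{\<omega>\<in>space M. norm (X \<omega>) > R}"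
  have A0: "A \<ge> 0" using A[of 0] by linarith
  have int: "integrable M (\<lambda>\<omega>. h (X \<omega>))"
    by (rule integrable_const_bound[of _ A]) (auto simp: A)
  have ind: "integrable M (indicator ?B :: 'a \<Rightarrow> real)"
    by (rule integrable_const_bound[of _ 1]) auto
  have "\<bar>expectation (\<lambda>\<omega>. h (X \<omega>))\<bar> \<le> expectation (\<lambda>\<omega>. \<bar>h (X \<omega>)\<bar>)"
    by (rule integral_abs_bound)
  also have "\<dots> \<le> expectation (\<lambda>\<omega>. \<epsilon> + A * indicator ?B \<omega>)"
  proof (rule integral_mono)
    fix \<omega> assume "\<omega> \<in> space M"
    then show "\<bar>h (X \<omega>)\<bar> \<le> \<epsilon> + A * indicator ?B \<omega>"
      using A[of "X \<omega>"] \<epsilon>[of "X \<omega>"] \<open>\<epsilon> \<ge> 0\<close> by (cases "norm (X \<omega>) \<le> R") auto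
  next
    show "integrable M (\<lambda>\<omega>. \<epsilon> + A * indicator ?B \<omega>)"
      by (rule integrable_const_bound[of _ "\<epsilon> + A"])
        (use A0 \<open>\<epsilon> \<ge> 0\<close> in \<open>auto split: split_indicator\<close>)
  qed (use int in auto)
  also have "\<dots> = \<epsilon> + A * prob ?B"
    using ind by (subst Bochner_Integration.integral_add) (auto simp: prob_space)
  also have "\<dots> \<le> \<epsilon> + A * \<eta>"
    using \<eta> A0 by (simp add: mult_left_mono)
  finally show ?thesis .
qed

lemma (in prob_space) tight_single:
  fixes X :: "'a \<Rightarrow> 'b::euclidean_space"
  assumes X [measurable]: "random_variable borel X" and "\<epsilon> > 0"
  shows "\<exists>R0. \<forall>R\<ge>R0. prob {\<omega>\<in>space M. norm (X \<omega>) > R} \<le> \<epsilon>"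
proof -
  let ?B = "\<lambda>n::nat. {\<omega>\<in>space M. norm (X \<omega>) > real n}"
  have "(\<lambda>n. prob (?B n)) \<longlonglongrightarrow> prob (\<Inter>n. ?B n)"
    by (intro finite_Lim_measure_decseq) (auto simp: decseq_def)
  also have "(\<Inter>n. ?B n) = {}"
  proof -
    have "\<exists>n. norm (X \<omega>) \<le> real n" for \<omega> by (rule real_arch_simple)
    then show ?thesis by (fastforce simp: not_less[symmetric])
  qed
  finally have "(\<lambda>n. prob (?B n)) \<longlonglongrightarrow> 0" by simp
  then have "eventually (\<lambda>n. prob (?B n) < \<epsilon>) sequentially"
    using \<open>\<epsilon> > 0\<close> by (rule order_tendstoD)
  then obtain n where n: "prob (?B n) < \<epsilon>"
    by (auto simp: eventually_sequentially)
  have "prob {\<omega>\<in>space M. norm (X \<omega>) > R} \<le> \<epsilon>" if "R \<ge> real n" for R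
  proof -
    have "prob {\<omega>\<in>space M. norm (X \<omega>) > R} \<le> prob (?B n)"
      using that by (intro finite_measure_mono) auto
    then show ?thesis using n by simp
  qed
  then show ?thesis by blast
qed

text \<open>A multivariate continuity theorem with tightness assumed. A trigonometric polynomial is
  close to \<open>f\<close> on a large ball and bounded outside it, where tightness leaves little
  mass. The form of \<open>tight\<close> allows one radius to serve both the sequence and the
  limit.\<close>

theorem (in prob_space) convergence_in_distribution_from_cos:
  fixes Y :: "nat \<Rightarrow> 'a \<Rightarrow> 'b::euclidean_space" and f :: "'b \<Rightarrow> real"
  assumes Y [measurable]: "\<And>n. random_variable borel (Y n)"
    and G: "prob_space G" and sets_G [measurable_cong]: "sets G = sets borel"
    and tight: "\<And>\<epsilon>. \<epsilon> > 0 \<Longrightarrow>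
      \<exists>R0. \<forall>R\<ge>R0. \<forall>\<^sub>F n in sequentially. prob {\<omega>\<in>space M. norm (Y n \<omega>) > R} \<le> \<epsilon>"
    and conv: "\<And>t c. (\<lambda>n. expectation (\<lambda>\<omega>. cos (t \<bullet> Y n \<omega> + c))) \<longlonglongrightarrow> (\<integral>x. cos (t \<bullet> x + c) \<partial>G)"
    and f: "continuous_on UNIV f" "bounded (range f)"
  shows "(\<lambda>n. expectation (\<lambda>\<omega>. f (Y n \<omega>))) \<longlonglongrightarrow> (\<integral>x. f x \<partial>G)"
proof (rule LIMSEQ_I)
  interpret G: prob_space G by fact
  have f_meas [measurable]: "f \<in> borel_measurable borel"
    using f(1) by (rule borel_measurable_continuous_onI)
  have intY: "integrable M (\<lambda>\<omega>. g (Y n \<omega>))" and intG: "integrable G g"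
    if g: "continuous_on UNIV g" "bounded (range g)" for g :: "'b \<Rightarrow> real" and n
  proof -
    obtain B where B: "\<And>x. \<bar>g x\<bar> \<le> B" using g(2) by (auto simp: bounded_iff)
    have [measurable]: "g \<in> borel_measurable borel"
      using g(1) by (rule borel_measurable_continuous_onI)
    show "integrable M (\<lambda>\<omega>. g (Y n \<omega>))"
      by (rule integrable_const_bound[of _ B]) (auto simp: B)
    show "integrable G g"
      by (rule G.integrable_const_bound[of _ B]) (auto simp: B)
  qed
  have trig: "(\<lambda>n. expectation (\<lambda>\<omega>. g (Y n \<omega>))) \<longlonglongrightarrow> (\<integral>x. g x \<partial>G)" if "trig_poly g" for g
    using that
  proof induction
    case (cos a t c)
    then show ?case using tendsto_mult_left[OF conv] by simp
  next
    case (add g h)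
    note c = continuous_on_trig_poly bounded_trig_poly
    show ?case
      using tendsto_add[OF add.IH] add.hyps
      by (simp add: Bochner_Integration.integral_add intY intG c)
  qed
  obtain K where K: "\<And>x. \<bar>f x\<bar> \<le> K" using f(2) by (auto simp: bounded_iff)
  have "K \<ge> 0" using K[of 0] by linarith
  fix r :: real assume "r > 0"
  \<comment> \<open>Chosen so that replacing \<open>f\<close> by \<open>g\<close> costs at most
    \<epsilon> + (2K + 1) \<eta> \<le> r/4. This is paid twice, and a further r/4 goes to the
    convergence for \<open>g\<close>; here 2K + 1 bounds the difference of \<open>f\<close> and
    \<open>g\<close> everywhere.\<close>
  define \<epsilon> where "\<epsilon> = min 1 (r / 8)"
  have \<epsilon>: "\<epsilon> > 0" "\<epsilon> \<le> 1" "\<epsilon> \<le> r / 8" using \<open>r > 0\<close> by (auto simp: \<epsilon>_def)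
  define \<eta> where "\<eta> = r / 8 / (2 * K + 1)"
  have "2 * K + 1 \<noteq> 0" using \<open>K \<ge> 0\<close> by linarith
  then have \<eta>: "\<eta> > 0" "(2 * K + 1) * \<eta> = r / 8"
    using \<open>r > 0\<close> \<open>K \<ge> 0\<close> unfolding \<eta>_def
    by (simp, subst times_divide_eq_right, subst nonzero_mult_div_cancel_left) simp_all
  obtain R1 where R1: "\<And>R. R \<ge> R1 \<Longrightarrow> \<forall>\<^sub>F n in sequentially. prob {\<omega>\<in>space M. norm (Y n \<omega>) > R} \<le> \<eta>"
    using tight[OF \<eta>(1)] by blast
  obtain R2 where R2: "\<And>R. R \<ge> R2 \<Longrightarrow> G.prob {x\<in>space G. norm x > R} \<le> \<eta>"
    using G.tight_single[of "\<lambda>x. x", OF _ \<eta>(1)] sets_G by (auto simp: measurable_ident_sets)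
  define R where "R = max 1 (max R1 R2)"
  obtain g where g: "trig_poly g" "\<And>x. norm x \<le> R \<Longrightarrow> \<bar>f x - g x\<bar> \<le> \<epsilon>" "\<And>x. \<bar>g x\<bar> \<le> K + \<epsilon>"
    by (rule trig_poly_approximation[OF f(1) K \<epsilon>(1), of R]) (auto simp: R_def)
  have g_meas [measurable]: "g \<in> borel_measurable borel"
    using continuous_on_trig_poly[OF g(1)] by (rule borel_measurable_continuous_onI)
  note cb = f continuous_on_trig_poly[OF g(1)] bounded_trig_poly[OF g(1)]
  have d: "\<bar>f x - g x\<bar> \<le> 2 * K + 1" for x
    using K[of x] g(3)[of x] \<epsilon> by linarith
  have 1: "\<bar>expectation (\<lambda>\<omega>. f (Y n \<omega>)) - expectation (\<lambda>\<omega>. g (Y n \<omega>))\<bar> \<le> r / 4"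
    if "prob {\<omega>\<in>space M. norm (Y n \<omega>) > R} \<le> \<eta>" for n
    using abs_expectation_split_le[of "Y n" "\<lambda>x. f x - g x" "2 * K + 1" R \<epsilon> \<eta>] d g(2) \<epsilon> \<eta> that
    by (simp add: Bochner_Integration.integral_diff intY cb)
  have 2: "\<bar>(\<integral>x. f x \<partial>G) - (\<integral>x. g x \<partial>G)\<bar> \<le> r / 4"
    using G.abs_expectation_split_le[of "\<lambda>x. x" "\<lambda>x. f x - g x" "2 * K + 1" R \<epsilon> \<eta>] d g(2) \<epsilon> \<eta> R2[of R]
    by (simp add: Bochner_Integration.integral_diff intG cb R_def sets_G measurable_ident_sets)
  have "\<forall>\<^sub>F n in sequentially. dist (expectation (\<lambda>\<omega>. g (Y n \<omega>))) (\<integral>x. g x \<partial>G) < r / 4"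
    using trig[OF g(1)] \<open>r > 0\<close> by (intro tendstoD) auto
  moreover have "\<forall>\<^sub>F n in sequentially. prob {\<omega>\<in>space M. norm (Y n \<omega>) > R} \<le> \<eta>"
    by (rule R1) (simp add: R_def)
  ultimately have "\<forall>\<^sub>F n in sequentially. norm (expectation (\<lambda>\<omega>. f (Y n \<omega>)) - (\<integral>x. f x \<partial>G)) < r"
  proof eventually_elim
    case (elim n)
    then show ?case using 1[of n] 2 \<open>r > 0\<close> unfolding dist_real_def real_norm_def by linarith
  qed
  then show "\<exists>no. \<forall>n\<ge>no. norm (expectation (\<lambda>\<omega>. f (Y n \<omega>)) - (\<integral>x. f x \<partial>G)) < r"
    by (simp add: eventually_sequentially)
qed

section \<open>Positive semidefinite matrices\<close>

lemma subspace_hermitian: "subspace (hermitian_matrices :: (complex^'n^'n) set)"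
  by (auto simp: subspace_def hermitian_matrices_def adjoint_matrix_def vec_eq_iff)

lemma hermitian_component: "A \<in> hermitian_matrices \<Longrightarrow> cnj (A $ j $ i) = A $ i $ j"
  by (auto simp: hermitian_matrices_def adjoint_matrix_def vec_eq_iff)

lemma mat_1_hermitian: "mat 1 \<in> hermitian_matrices"
  by (auto simp: hermitian_matrices_def adjoint_matrix_def vec_eq_iff mat_def)

lemma born_eq_inner:
  fixes A :: "complex^'n^'n"
  assumes "A \<in> hermitian_matrices"
  shows "born \<rho> A = \<rho> \<bullet> A"
proof -
  have "born \<rho> A = (\<Sum>i\<in>UNIV. \<Sum>k\<in>UNIV. Re (\<rho> $ i $ k * A $ k $ i))"
    by (simp add: born_def trace_def matrix_matrix_mult_def)
  also have "\<dots> = (\<Sum>i\<in>UNIV. \<Sum>k\<in>UNIV. \<rho> $ i $ k \<bullet> A $ i $ k)"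
  proof (intro sum.cong refl)
    fix i k
    show "Re (\<rho> $ i $ k * A $ k $ i) = \<rho> $ i $ k \<bullet> A $ i $ k"
      by (subst hermitian_component[OF assms, symmetric, of k i]) (simp add: inner_complex_def)
  qed
  finally show ?thesis by (simp add: inner_vec_def)
qed

lemma trace_hermitian_eq:
  assumes "\<rho> \<in> hermitian_matrices"
  shows "trace \<rho> = of_real (\<rho> \<bullet> mat 1)"
proof -
  have "\<rho> \<bullet> mat 1 = Re (trace \<rho>)"
    using born_eq_inner[OF mat_1_hermitian, of \<rho>] by (simp add: born_def)
  moreover have "Im (trace \<rho>) = 0"
  proof -
    have "Im (\<rho> $ i $ i) = 0" for i
      using hermitian_component[OF assms, of i i] by (simp add: complex_eq_iff)
    then show ?thesis by (simp add: trace_def)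
  qed
  ultimately show ?thesis by (simp add: complex_eq_iff)
qed

subsection \<open>Positivity of the trace pairing\<close>

text \<open>The sesquilinear form of \<open>A\<close>, with both arguments kept apart so that a
  perturbation of the vector can be expanded.\<close>

definition herm_form :: "complex^'n^'n \<Rightarrow> complex^'n \<Rightarrow> complex^'n \<Rightarrow> complex" where
  "herm_form A v w = (\<Sum>i\<in>UNIV. cnj (v $ i) * (A *v w) $ i)"

lemma herm_form_add_left: "herm_form A (v + v') w = herm_form A v w + herm_form A v' w"
  by (simp add: herm_form_def sum.distrib distrib_right)

lemma herm_form_add_right: "herm_form A v (w + w') = herm_form A v w + herm_form A v w'"
  by (simp add: herm_form_def sum.distrib distrib_left matrix_vector_right_distrib)

lemma herm_form_axis_left: "herm_form A (axis k z) w = cnj z * (A *v w) $ k"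
proof -
  have "herm_form A (axis k z) w = (\<Sum>i\<in>UNIV. if i = k then cnj z * (A *v w) $ k else 0)"
    unfolding herm_form_def by (intro sum.cong) (auto simp: axis_def)
  then show ?thesis by simp
qed

lemma matrix_vector_axis: "(A *v axis k z) $ i = A $ i $ k * z"
proof -
  have "(A *v axis k z) $ i = (\<Sum>j\<in>UNIV. if j = k then A $ i $ k * z else 0)"
    unfolding matrix_vector_mult_def vec_lambda_beta
    by (intro sum.cong refl) (auto simp: axis_def)
  then show ?thesis by simp
qed

lemma herm_form_cnj:
  assumes "A \<in> hermitian_matrices"
  shows "cnj (herm_form A v w) = herm_form A w v"
proof -
  have "cnj (herm_form A v w) = (\<Sum>i\<in>UNIV. \<Sum>j\<in>UNIV. cnj (w $ j) * (A $ j $ i * v $ i))"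
    by (simp add: herm_form_def matrix_vector_mult_def sum_distrib_left
        hermitian_component[OF assms] mult_ac)
  also have "\<dots> = herm_form A w v"
    by (subst sum.swap) (simp add: herm_form_def matrix_vector_mult_def sum_distrib_left)
  finally show ?thesis .
qed

lemma positive_semidefinite_herm_form:
  "positive_semidefinite A \<longleftrightarrow> A \<in> hermitian_matrices \<and> (\<forall>v. 0 \<le> Re (herm_form A v v))"
  by (simp add: positive_semidefinite_def herm_form_def)

text \<open>Changing one coordinate changes the form by a quadratic polynomial in \<open>z\<close>.
  The consequences of positivity below come from evaluating it at a suitable
  \<open>z\<close>.\<close>

lemma herm_form_perturb:
  assumes "A \<in> hermitian_matrices"
  shows "Re (herm_form A (v + axis k z) (v + axis k z))
    = Re (herm_form A v v) + 2 * Re (cnj z * (A *v v) $ k) + (norm z)\<^sup>2 * Re (A $ k $ k)"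
proof -
  have "Re (herm_form A v (axis k z)) = Re (cnj (herm_form A v (axis k z)))" by simp
  also have "\<dots> = Re (cnj z * (A *v v) $ k)"
    by (simp only: herm_form_cnj[OF assms] herm_form_axis_left)
  finally have 1: "Re (herm_form A v (axis k z)) = Re (cnj z * (A *v v) $ k)" .
  have "herm_form A (axis k z) (axis k z) = cnj z * z * A $ k $ k"
    by (simp add: herm_form_axis_left matrix_vector_axis mult_ac)
  also have "cnj z * z = of_real ((norm z)\<^sup>2)"
    by (metis complex_norm_square mult.commute)
  finally have 2: "Re (herm_form A (axis k z) (axis k z)) = (norm z)\<^sup>2 * Re (A $ k $ k)"
    by simp
  have 3: "Re (herm_form A (axis k z) v) = Re (cnj z * (A *v v) $ k)"
    by (simp only: herm_form_axis_left)
  show ?thesis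
    unfolding herm_form_add_left herm_form_add_right plus_complex.sel 1 2 3 by linarith
qed

lemma psd_diagonal:
  assumes "positive_semidefinite A"
  shows "Re (A $ k $ k) \<ge> 0" "Im (A $ k $ k) = 0"
proof -
  have A: "A \<in> hermitian_matrices" and pos: "0 \<le> Re (herm_form A v v)" for v
    using assms by (auto simp: positive_semidefinite_herm_form)
  show "Re (A $ k $ k) \<ge> 0"
    using pos[of "0 + axis k 1"] unfolding herm_form_perturb[OF A] by (simp add: herm_form_def)
  show "Im (A $ k $ k) = 0"
    using hermitian_component[OF A, of k k] by (simp add: complex_eq_iff)
qed

text \<open>With a zero diagonal entry the quadratic term in \<open>herm_form_perturb\<close>
  disappears. What remains is an affine function of the step size, which can be nonnegative
  everywhere only if its slope is zero.\<close>

lemma psd_zero_diagonal: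
  assumes "positive_semidefinite A" "Re (A $ k $ k) = 0"
  shows "A $ k $ i = 0"
proof -
  have A: "A \<in> hermitian_matrices" and pos: "0 \<le> Re (herm_form A v v)" for v
    using assms by (auto simp: positive_semidefinite_herm_form)
  define v where "v = axis i (1::complex)"
  have Av: "(A *v v) $ k = A $ k $ i" by (simp add: v_def matrix_vector_axis)
  define a b where "a = Re (herm_form A v v)" and "b = (norm (A $ k $ i))\<^sup>2"
  have ab: "0 \<le> a + 2 * s * b" for s
  proof -
    have "Re (cnj (of_real s * A $ k $ i) * (A *v v) $ k) = s * b"
      unfolding Av b_def cmod_power2 by (simp add: power2_eq_square algebra_simps)
    then show ?thesis
      using pos[of "v + axis k (of_real s * A $ k $ i)"] assms(2)
      unfolding herm_form_perturb[OF A] by (simp add: a_def)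
  qed
  have "b = 0"
  proof (rule ccontr)
    assume "b \<noteq> 0"
    \<comment> \<open>The step size at which the affine function takes the value -1.\<close>
    then have "2 * (- (a + 1) / (2 * b)) * b = - (a + 1)" by (simp add: field_simps)
    then show False using ab[of "- (a + 1) / (2 * b)"] by linarith
  qed
  then show ?thesis by (simp add: b_def)
qed

definition rank_one :: "complex^'n \<Rightarrow> complex^'n^'n" where
  "rank_one v = (\<chi> i j. v $ i * cnj (v $ j))"

lemma rank_one_hermitian: "rank_one v \<in> hermitian_matrices"
  by (simp add: rank_one_def hermitian_matrices_def adjoint_matrix_def vec_eq_iff)

lemma inner_rank_one:
  assumes "B \<in> hermitian_matrices"
  shows "rank_one v \<bullet> B = Re (herm_form B v v)"
proof -
  have "rank_one v \<bullet> B = (\<Sum>i\<in>UNIV. \<Sum>j\<in>UNIV. Re (v $ i * cnj (v $ j) * B $ j $ i))"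
  proof -
    have "(v $ i * cnj (v $ j)) \<bullet> B $ i $ j = Re (v $ i * cnj (v $ j) * B $ j $ i)" for i j
      by (subst hermitian_component[OF assms, symmetric, of i j]) (simp add: inner_complex_def)
    then show ?thesis by (simp add: inner_vec_def rank_one_def)
  qed
  also have "\<dots> = (\<Sum>j\<in>UNIV. \<Sum>i\<in>UNIV. Re (v $ i * cnj (v $ j) * B $ j $ i))"
    by (rule sum.swap)
  also have "\<dots> = (\<Sum>j\<in>UNIV. \<Sum>i\<in>UNIV. Re (cnj (v $ j) * (B $ j $ i * v $ i)))"
    by (intro sum.cong refl arg_cong[where f=Re]) (simp add: mult_ac)
  also have "\<dots> = Re (herm_form B v v)"
    by (simp add: herm_form_def matrix_vector_mult_def sum_distrib_left)
  finally show ?thesis .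
qed

text \<open>One step of Gaussian elimination; iterating it writes a positive matrix as a sum of rank-one
  matrices.\<close>

lemma psd_schur_complement:
  fixes A :: "complex^'n^'n"
  assumes A: "positive_semidefinite A" and pos: "Re (A $ k $ k) > 0"
  defines "u \<equiv> (\<chi> i. A $ i $ k / of_real (sqrt (Re (A $ k $ k))))"
  shows "positive_semidefinite (A - rank_one u)" "(A - rank_one u) $ k $ i = 0"
    "A $ i $ i = 0 \<Longrightarrow> (A - rank_one u) $ i $ i = 0"
proof -
  define d where "d = Re (A $ k $ k)"
  have d: "d > 0" "A $ k $ k = of_real d"
    using psd_diagonal[OF A, of k] pos by (auto simp: d_def complex_eq_iff)
  have AH: "A \<in> hermitian_matrices" and form: "0 \<le> Re (herm_form A v v)" for v
    using A by (auto simp: positive_semidefinite_herm_form)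
  have sq: "complex_of_real (sqrt d) * complex_of_real (sqrt d) = of_real d"
    using d(1) by (simp flip: of_real_mult)
  have R: "rank_one u $ i $ j = A $ i $ k * A $ k $ j / of_real d" for i j
    by (simp add: rank_one_def u_def d_def[symmetric] hermitian_component[OF AH] sq)
  show "(A - rank_one u) $ k $ i = 0"
    using d by (simp add: R)
  have RH: "A - rank_one u \<in> hermitian_matrices"
    by (rule subspace_diff[OF subspace_hermitian AH rank_one_hermitian])
  have "0 \<le> Re (herm_form (A - rank_one u) v v)" for v
  proof -
    define c where "c = (A *v v) $ k"
    have Rv: "(rank_one u *v v) $ i = A $ i $ k * c / of_real d" for i
      by (simp add: matrix_vector_mult_def R c_def sum_distrib_left sum_divide_distrib mult_ac)
    have "herm_form (A - rank_one u) v v = herm_form A v v - (\<Sum>i\<in>UNIV. cnj (v $ i) * (A $ i $ k * c / of_real d))"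
      by (simp add: herm_form_def matrix_vector_mult_diff_rdistrib right_diff_distrib sum_subtractf Rv)
    also have "(\<Sum>i\<in>UNIV. cnj (v $ i) * (A $ i $ k * c / of_real d))
        = (\<Sum>i\<in>UNIV. cnj (v $ i) * A $ i $ k) * c / of_real d"
      by (simp add: sum_distrib_left sum_distrib_right sum_divide_distrib mult_ac)
    also have "(\<Sum>i\<in>UNIV. cnj (v $ i) * A $ i $ k) = cnj c"
      by (simp add: c_def matrix_vector_mult_def hermitian_component[OF AH] mult_ac)
    also have "cnj c * c = of_real ((norm c)\<^sup>2)"
      by (metis complex_norm_square mult.commute)
    finally have 1: "Re (herm_form (A - rank_one u) v v) = Re (herm_form A v v) - (norm c)\<^sup>2 / d"
      by (simp flip: of_real_divide)
    \<comment> \<open>The minimiser of the form of \<open>A\<close> along coordinate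
      \<open>k\<close>. The minimum equals the form of the Schur complement at \<open>v\<close>,
      which is therefore nonnegative.\<close>
    define z where "z = - c / of_real d"
    have "cnj z * c = - of_real ((norm c)\<^sup>2 / d)"
      by (simp add: z_def complex_norm_square mult.commute flip: of_real_power)
    then have z1: "Re (cnj z * c) = - ((norm c)\<^sup>2 / d)" by simp
    have z2: "(norm z)\<^sup>2 * d = (norm c)\<^sup>2 / d"
      using d(1) by (simp add: z_def norm_divide power_divide power2_eq_square)
    have "0 \<le> Re (herm_form A v v) + 2 * Re (cnj z * c) + (norm z)\<^sup>2 * d"
      using form[of "v + axis k z"] unfolding herm_form_perturb[OF AH] by (simp add: c_def d_def)
    then show ?thesis using 1 z1 z2 by linarith
  qed
  then show "positive_semidefinite (A - rank_one u)"
    using RH by (simp add: positive_semidefinite_herm_form)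
  show "(A - rank_one u) $ i $ i = 0" if "A $ i $ i = 0"
    using psd_zero_diagonal[OF A, of i k] that by (simp add: R)
qed

text \<open>Pairing a rank-one matrix with \<open>B\<close> gives a value of the form of
  \<open>B\<close>, so it suffices to split off rank-one pieces of \<open>A\<close>. Each
  elimination clears one nonzero diagonal entry and spoils no zero one, so their number decreases; a
  positive matrix with zero diagonal vanishes.\<close>

theorem inner_psd_nonneg:
  fixes A B :: "complex^'n^'n"
  assumes "positive_semidefinite A" "positive_semidefinite B"
  shows "0 \<le> A \<bullet> B"
  using assms(1)
proof (induction "card {k. A $ k $ k \<noteq> 0}" arbitrary: A rule: less_induct)
  case less
  show ?case
  proof (cases "\<exists>k. A $ k $ k \<noteq> 0")
    case False
    then have "A = 0" using psd_zero_diagonal[OF less.prems] by (simp add: vec_eq_iff)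
    then show ?thesis by simp
  next
    case True
    then obtain k where k: "A $ k $ k \<noteq> 0" by blast
    then have pos: "Re (A $ k $ k) > 0"
      using psd_diagonal[OF less.prems, of k] by (auto simp: complex_eq_iff)
    define u where "u = (\<chi> i. A $ i $ k / of_real (sqrt (Re (A $ k $ k))))"
    note S = psd_schur_complement[OF less.prems pos, folded u_def]
    have "{i. (A - rank_one u) $ i $ i \<noteq> 0} \<subset> {i. A $ i $ i \<noteq> 0}"
      using S(2,3) k by blast
    then have "card {i. (A - rank_one u) $ i $ i \<noteq> 0} < card {i. A $ i $ i \<noteq> 0}"
      by (intro psubset_card_mono) auto
    then have "0 \<le> (A - rank_one u) \<bullet> B"
      using less.hyps S(1) by blast
    moreover have "0 \<le> rank_one u \<bullet> B"
      using assms(2) by (simp add: positive_semidefinite_herm_form inner_rank_one)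
    ultimately show ?thesis by (simp add: inner_diff_left)
  qed
qed

lemma convex_density_matrices: "convex (density_matrices :: (complex^'n^'n) set)"
proof -
  have "trace (u *\<^sub>R A + v *\<^sub>R B) = u *\<^sub>R trace A + v *\<^sub>R trace B" for u v and A B :: "complex^'n^'n"
    by (simp add: trace_def sum.distrib scaleR_sum_right)
  moreover have "herm_form (u *\<^sub>R A + v *\<^sub>R B) x x = u *\<^sub>R herm_form A x x + v *\<^sub>R herm_form B x x"
    for u v and A B :: "complex^'n^'n" and x
    by (simp add: herm_form_def matrix_vector_mult_def sum_distrib_left sum.distrib
        distrib_left distrib_right scaleR_sum_right mult_ac)
  ultimately show ?thesis
    by (auto simp: convex_def density_matrices_def positive_semidefinite_herm_form
        intro!: subspace_add[OF subspace_hermitian] subspace_scale[OF subspace_hermitian]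
        simp flip: scaleR_add_left)
qed

section \<open>Maximum likelihood in a linear model\<close>

text \<open>The remainder \<open>?g\<close> vanishes at 0 and has derivative
  \<open>t\<^sup>2 / (1 + t)\<close>, which is at most \<open>2 * u\<^sup>2\<close> as long as 1 + t
  is at least 1/2. The mean value bound supplies the third factor.\<close>

lemma ln_one_plus_second_order:
  fixes u :: real
  assumes "\<bar>u\<bar> \<le> 1 / 2"
  shows "\<bar>ln (1 + u) - u + u\<^sup>2 / 2\<bar> \<le> 2 * \<bar>u\<bar> ^ 3"
proof -
  let ?g = "\<lambda>t::real. ln (1 + t) - t + t\<^sup>2 / 2"
  let ?S = "{- \<bar>u\<bar>..\<bar>u\<bar>}"
  have "norm (?g u - ?g 0) \<le> (2 * u\<^sup>2) * norm (u - 0)"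
  proof (rule field_differentiable_bound[where S="?S" and f'="\<lambda>t. t\<^sup>2 / (1 + t)"])
    fix t assume t: "t \<in> ?S"
    then have t2: "1 / 2 \<le> 1 + t" using assms by auto
    have "(?g has_field_derivative (1 / (1 + t) - 1 + t)) (at t within ?S)"
      using t2 by (auto intro!: derivative_eq_intros)
    also have "1 / (1 + t) - 1 + t = t\<^sup>2 / (1 + t)"
      using t2 by (simp add: field_simps power2_eq_square)
    finally show "(?g has_field_derivative t\<^sup>2 / (1 + t)) (at t within ?S)" .
    have "t\<^sup>2 / (1 + t) \<le> t\<^sup>2 / (1 / 2)"
      using t2 by (intro divide_left_mono) auto
    also have "\<dots> \<le> 2 * u\<^sup>2"
      using t by (auto simp: abs_le_square_iff[symmetric])
    finally show "norm (t\<^sup>2 / (1 + t)) \<le> 2 * u\<^sup>2"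
      using t2 by simp
  qed auto
  then show ?thesis by (simp add: power3_eq_cube power2_eq_square abs_mult mult.assoc)
qed

text \<open>Transfers an estimate for the log-likelihood ratio to the ratio itself. The ratio to the
  maximum is at most 1, which puts its logarithm in the range where \<open>exp\<close> is a
  contraction.\<close>

lemma abs_exp_diff_le:
  fixes a b :: real
  assumes "a \<le> 0" "b \<le> 0"
  shows "\<bar>exp a - exp b\<bar> \<le> \<bar>a - b\<bar>"
proof -
  have le: "exp y - exp x \<le> y - x" if "x \<le> y" "y \<le> 0" for x y :: real
  proof -
    have "exp y - exp x = exp y * (1 - exp (x - y))"
      by (simp add: algebra_simps exp_diff)
    also have "\<dots> \<le> 1 - exp (x - y)"
      using that by (intro mult_left_le_one_le) auto
    also have "\<dots> \<le> y - x"
      using exp_ge_add_one_self[of "x - y"] by (simp add: algebra_simps)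
    finally show ?thesis .
  qed
  then show ?thesis
    using le[of a b] le[of b a] assms exp_le_cancel_iff[of a b] by (cases "a \<le> b") auto
qed

text \<open>Hermitian matrices with the trace pairing, abstracted to a subspace \<open>H\<close> of a Euclidean space
  in which outcome \<open>j\<close> has probability \<open>\<rho> \<bullet> e j\<close>. Vacuous outcomes \<open>e j = 0\<close> have \<open>p j = 0\<close> and
  drop out of all sums with denominator \<open>p j\<close> because \<open>x / 0 = 0\<close>.\<close>

locale linear_model =
  fixes e :: "'j::finite \<Rightarrow> 'a::euclidean_space" and H :: "'a set" and \<rho>\<^sub>0 :: 'a
  assumes subspace_H: "subspace H"
    and e_in: "e j \<in> H"
    and \<rho>0_in: "\<rho>\<^sub>0 \<in> H"
    and pos: "e j \<noteq> 0 \<Longrightarrow> \<rho>\<^sub>0 \<bullet> e j > 0"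
    and total: "(\<Sum>j\<in>UNIV. \<rho>\<^sub>0 \<bullet> e j) = 1"
    and bij: "bij_betw (\<lambda>y. \<Sum>j\<in>UNIV. ((e j \<bullet> y) / (\<rho>\<^sub>0 \<bullet> e j)) *\<^sub>R e j) H H"
begin

definition p :: "'j \<Rightarrow> real" where "p j = \<rho>\<^sub>0 \<bullet> e j"

text \<open>The one-sample Fisher information as an operator; \<open>B\<close> below is its bilinear
  form.\<close>

definition F :: "'a \<Rightarrow> 'a" where "F y = (\<Sum>j\<in>UNIV. ((e j \<bullet> y) / p j) *\<^sub>R e j)"

definition B :: "'a \<Rightarrow> 'a \<Rightarrow> real" where "B x y = (\<Sum>j\<in>UNIV. (x \<bullet> e j) * (y \<bullet> e j) / p j)"

text \<open>The tangent space of the model. The effects of a POVM sum to the identity, so the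
  condition then says that the trace vanishes.\<close>

definition V :: "'a set" where "V = {x \<in> H. (\<Sum>j\<in>UNIV. x \<bullet> e j) = 0}"

definition model :: "'a set" where
  "model = {\<rho> \<in> H. (\<Sum>j\<in>UNIV. \<rho> \<bullet> e j) = 1 \<and> (\<forall>j. 0 \<le> \<rho> \<bullet> e j)}"

definition lik :: "('j \<Rightarrow> nat) \<Rightarrow> 'a \<Rightarrow> real" where
  "lik n \<rho> = (\<Prod>j\<in>UNIV. (\<rho> \<bullet> e j) ^ n j)"

definition is_max :: "('j \<Rightarrow> nat) \<Rightarrow> 'a \<Rightarrow> bool" where
  "is_max n \<rho> \<longleftrightarrow> \<rho> \<in> model \<and> (\<forall>\<sigma>\<in>model. lik n \<sigma> \<le> lik n \<rho>)"

definition sample_size :: "('j \<Rightarrow> nat) \<Rightarrow> real" where "sample_size n = (\<Sum>j\<in>UNIV. real (n j))"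

text \<open>The good event for the data. The absolute bound \<delta> drives the error estimates. The
  relative bound ensures that every nonzero effect is observed and, since \<open>p j = 0\<close> for
  a vacuous one, that no vacuous outcome is.\<close>

definition near :: "('j \<Rightarrow> nat) \<Rightarrow> real \<Rightarrow> bool" where
  "near n \<delta> \<longleftrightarrow> sample_size n > 0 \<and> (\<forall>j. \<bar>n j / sample_size n - p j\<bar> \<le> \<delta> \<and> \<bar>n j / sample_size n - p j\<bar> \<le> p j / 2)"

text \<open>A lower bound for the probabilities of all nonvacuous outcomes, both at
  \<open>\<rho>\<^sub>0\<close> and at a maximiser with \<open>near\<close> data; the expression
  comes from \<open>mle_lower_bound\<close>. The inserted 1 keeps the set nonempty.\<close>

definition c :: real where "c = Min (insert 1 ((\<lambda>j. (p j)\<^sup>2 / 2) ` {j. e j \<noteq> 0}))"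

lemma p_pos: "e j \<noteq> 0 \<Longrightarrow> p j > 0" using pos by (simp add: p_def)

lemma p_zero: "e j = 0 \<Longrightarrow> p j = 0" by (simp add: p_def)

lemma p_nonneg: "p j \<ge> 0" using p_pos[of j] p_zero[of j] by (cases "e j = 0") auto

lemma sum_p: "(\<Sum>j\<in>UNIV. p j) = 1" using total by (simp add: p_def)

lemma model_le_1:
  assumes "\<rho> \<in> model"
  shows "\<rho> \<bullet> e j \<le> 1"
proof -
  have "\<rho> \<bullet> e j \<le> (\<Sum>j\<in>UNIV. \<rho> \<bullet> e j)"
    using assms by (intro member_le_sum) (auto simp: model_def)
  then show ?thesis using assms by (simp add: model_def)
qed

lemma \<rho>0_model: "\<rho>\<^sub>0 \<in> model"
  using \<rho>0_in total p_nonneg by (simp add: model_def p_def)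

lemma p_le_1: "p j \<le> 1"
  using model_le_1[OF \<rho>0_model] by (simp add: p_def)

lemma c_pos: "c > 0"
  unfolding c_def by (subst Min_gr_iff) (auto dest: p_pos)

lemma c_le: "e j \<noteq> 0 \<Longrightarrow> c \<le> (p j)\<^sup>2 / 2"
  unfolding c_def by (rule Min_le) auto

lemma c_le_p: "e j \<noteq> 0 \<Longrightarrow> c \<le> p j"
proof -
  assume "e j \<noteq> 0"
  then have "c \<le> (p j)\<^sup>2 / 2" by (rule c_le)
  also have "\<dots> \<le> p j" using p_nonneg[of j] p_le_1[of j] mult_left_mono[of "p j" 1 "p j"]
    by (simp add: power2_eq_square)
  finally show ?thesis .
qed

lemma subspace_V: "subspace V"
  using subspace_H
  by (auto simp: V_def subspace_def inner_add_left sum.distrib simp flip: sum_distrib_left)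

lemma V_subset: "V \<subseteq> H" by (auto simp: V_def)

lemma model_diff_V: "\<rho> \<in> model \<Longrightarrow> \<sigma> \<in> model \<Longrightarrow> \<rho> - \<sigma> \<in> V"
  by (auto simp: model_def V_def inner_diff_left sum_subtractf intro: subspace_diff[OF subspace_H])

lemma inner_F: "x \<bullet> F y = B x y"
  by (simp add: F_def B_def inner_sum_right mult_ac inner_commute)

lemma B_commute: "B x y = B y x"
  by (simp add: B_def mult_ac)

lemma bij_F: "bij_betw F H H"
  using bij by (simp add: F_def[abs_def] p_def)

lemma B_add_right: "B x (y + z) = B x y + B x z"
  by (simp add: B_def inner_add_left distrib_left add_divide_distrib sum.distrib)

lemma B_diff_right: "B x (y - z) = B x y - B x z"
  by (simp add: B_def inner_diff_left right_diff_distrib diff_divide_distrib sum_subtractf)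

lemma B_scale_right: "B x (s *\<^sub>R y) = s * B x y"
  by (simp add: B_def sum_distrib_left mult_ac)

lemma B_sum_right: "finite A \<Longrightarrow> B x (\<Sum>i\<in>A. f i) = (\<Sum>i\<in>A. B x (f i))"
  by (induction A rule: finite_induct) (auto simp: B_add_right, simp add: B_def)

lemma B_nonneg: "B x x \<ge> 0"
  unfolding B_def using p_nonneg by (intro sum_nonneg) simp

text \<open>This is where invertibility of the Fisher information acts: a null vector of
  \<open>B\<close> pairs to zero with all effects, hence has the same image under \<open>F\<close>
  as 0.\<close>

lemma B_eq_0:
  assumes "x \<in> H" "B x x = 0"
  shows "x = 0"
proof -
  have "x \<bullet> e j = 0" for j
  proof (cases "e j = 0")
    case False
    have "(x \<bullet> e j) * (x \<bullet> e j) / p j = 0"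
      using assms(2) p_nonneg unfolding B_def by (subst (asm) sum_nonneg_eq_0_iff) auto
    then show ?thesis using p_pos[OF False] by simp
  qed simp
  then have "F x = F 0" by (simp add: F_def inner_commute)
  then show ?thesis
    using bij_F assms(1) subspace_0[OF subspace_H] by (auto simp: bij_betw_def inj_on_def)
qed

lemma V_eq_0: "w \<in> V \<Longrightarrow> (\<And>v. v \<in> V \<Longrightarrow> B v w = 0) \<Longrightarrow> w = 0"
  using B_eq_0 V_subset by blast

text \<open>\<kappa> is the minimum of the form on the unit sphere of \<open>H\<close>, positive by
  definiteness and compactness. The sphere is empty when \<open>H\<close> is trivial, which explains
  the case split.\<close>

lemma B_coercive: "\<exists>\<kappa>>0. \<forall>x\<in>H. B x x \<ge> \<kappa> * (norm x)\<^sup>2"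
proof (cases "H \<inter> sphere 0 1 = {}")
  case True
  have "x = 0" if "x \<in> H" for x
  proof (rule ccontr)
    assume "x \<noteq> 0"
    then have "(1 / norm x) *\<^sub>R x \<in> H \<inter> sphere 0 1"
      using that subspace_scale[OF subspace_H] by auto
    then show False using True by blast
  qed
  then show ?thesis using B_nonneg by (intro exI[of _ 1]) force
next
  case False
  have "compact (H \<inter> sphere 0 1)"
    using closed_subspace[OF subspace_H] by (simp add: closed_Int_compact)
  moreover have "continuous_on (H \<inter> sphere 0 1) (\<lambda>x. B x x)"
    unfolding B_def divide_inverse by (intro continuous_intros)
  ultimately obtain y where y: "y \<in> H \<inter> sphere 0 1" "\<And>x. x \<in> H \<inter> sphere 0 1 \<Longrightarrow> B y y \<le> B x x"
    using continuous_attains_inf[OF _ False] by blast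
  have "B y y \<noteq> 0" using y B_eq_0[of y] by auto
  then have "B y y > 0" using B_nonneg[of y] by linarith
  moreover have "B x x \<ge> B y y * (norm x)\<^sup>2" if "x \<in> H" for x
  proof (cases "x = 0")
    case False
    define z where "z = (1 / norm x) *\<^sub>R x"
    have "z \<in> H \<inter> sphere 0 1"
      using that False subspace_scale[OF subspace_H] by (auto simp: z_def)
    then have "B y y \<le> B z z" by (rule y(2))
    also have "B z z = B x x / (norm x)\<^sup>2"
      by (simp add: z_def B_scale_right B_commute[of "(1 / norm x) *\<^sub>R x"] power2_eq_square)
    finally show ?thesis using False by (simp add: field_simps)
  qed (simp add: B_nonneg)
  ultimately show ?thesis by blast
qed

subsection \<open>Influence vectors\<close>

text \<open>Represents the score functional of outcome \<open>j\<close> on \<open>V\<close> with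
  respect to \<open>B\<close>. To first order, an excess x in the frequency of \<open>j\<close>
  moves the maximiser by x times \<open>a j\<close>. For a vacuous outcome the general formula would
  give \<open>- \<rho>\<^sub>0\<close>, which is outside \<open>V\<close>.\<close>

definition a :: "'j \<Rightarrow> 'a" where
  "a j = (if e j = 0 then 0 else inv_into H F ((1 / p j) *\<^sub>R e j) - \<rho>\<^sub>0)"

lemma F_\<rho>0: "F \<rho>\<^sub>0 = (\<Sum>j\<in>UNIV. e j)"
proof -
  have "((e j \<bullet> \<rho>\<^sub>0) / p j) *\<^sub>R e j = e j" for j
    using p_pos[of j] by (cases "e j = 0") (auto simp: p_def inner_commute)
  then show ?thesis by (simp add: F_def)
qed

text \<open>The true state is orthogonal to \<open>V\<close> for the Fisher form, so projecting \<open>F\<inverse> z\<close> to \<open>V\<close>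
  means subtracting a multiple of it.\<close>

lemma B_V_\<rho>0: "v \<in> V \<Longrightarrow> B v \<rho>\<^sub>0 = 0"
  by (simp add: inner_F[symmetric] F_\<rho>0 inner_sum_right V_def)

lemma
  shows a_in_V: "a j \<in> V"
    and B_V_a: "v \<in> V \<Longrightarrow> B v (a j) = (v \<bullet> e j) / p j"
proof -
  have "a j \<in> V \<and> (v \<in> V \<longrightarrow> B v (a j) = (v \<bullet> e j) / p j)" for v
  proof (cases "e j = 0")
    case True
    then show ?thesis using subspace_0[OF subspace_V] by (simp add: a_def B_def)
  next
    case False
    define w where "w = inv_into H F ((1 / p j) *\<^sub>R e j)"
    have e: "(1 / p j) *\<^sub>R e j \<in> F ` H"
      using bij_F subspace_scale[OF subspace_H e_in] by (auto simp: bij_betw_def)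
    have w: "w \<in> H" "F w = (1 / p j) *\<^sub>R e j"
      using inv_into_into[OF e] f_inv_into_f[OF e] by (auto simp: w_def)
    have aw: "a j = w - \<rho>\<^sub>0" using False by (simp add: a_def w_def)
    \<comment> \<open>Symmetry of \<open>B\<close> moves \<open>F\<close> from
      \<open>\<rho>\<^sub>0\<close> to \<open>w\<close> and shows that \<open>w\<close> has total
      probability 1, as \<open>\<rho>\<^sub>0\<close> has; the difference therefore lies in
      \<open>V\<close>.\<close>
    have "(\<Sum>i\<in>UNIV. w \<bullet> e i) = w \<bullet> F \<rho>\<^sub>0" by (simp add: F_\<rho>0 inner_sum_right)
    also have "\<dots> = \<rho>\<^sub>0 \<bullet> F w" by (simp add: inner_F B_commute)
    also have "\<dots> = 1" using p_pos[OF False] by (simp add: w(2) p_def)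
    finally have "a j \<in> V"
      using w(1) \<rho>0_in total subspace_diff[OF subspace_H]
      by (simp add: aw V_def inner_diff_left sum_subtractf)
    moreover have "B v (a j) = (v \<bullet> e j) / p j" if "v \<in> V"
      using B_V_\<rho>0[OF that] by (simp add: aw B_diff_right inner_F[symmetric, of v w] w(2))
    ultimately show ?thesis by blast
  qed
  then show "a j \<in> V" "v \<in> V \<Longrightarrow> B v (a j) = (v \<bullet> e j) / p j" by auto
qed

lemma sum_a_in_V: "(\<Sum>j\<in>UNIV. s j *\<^sub>R a j) \<in> V"
  by (intro subspace_sum[OF subspace_V] subspace_scale[OF subspace_V] a_in_V)

text \<open>The score has mean zero. Hence the linear part may be written with the frequencies
  themselves in place of their deviations from \<open>p\<close>, and the summands in the central
  limit theorem are centred.\<close>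

lemma sum_p_a: "(\<Sum>j\<in>UNIV. p j *\<^sub>R a j) = 0"
proof (rule V_eq_0[OF sum_a_in_V])
  fix v assume v: "v \<in> V"
  have "B v (\<Sum>j\<in>UNIV. p j *\<^sub>R a j) = (\<Sum>j\<in>UNIV. p j * ((v \<bullet> e j) / p j))"
    by (simp add: B_sum_right B_scale_right B_V_a[OF v])
  also have "\<dots> = (\<Sum>j\<in>UNIV. v \<bullet> e j)"
  proof (intro sum.cong refl)
    fix j show "p j * ((v \<bullet> e j) / p j) = v \<bullet> e j"
      using p_pos[of j] by (cases "e j = 0") auto
  qed
  finally show "B v (\<Sum>j\<in>UNIV. p j *\<^sub>R a j) = 0" using v by (simp add: V_def)
qed

text \<open>Linear inversion: a direction is recovered from its outcome probabilities, because both
  sides have the same \<open>B\<close>-pairing with every vector of \<open>V\<close>.\<close>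

lemma V_expand: "v \<in> V \<Longrightarrow> (\<Sum>j\<in>UNIV. (v \<bullet> e j) *\<^sub>R a j) = v"
proof -
  assume v: "v \<in> V"
  have "(\<Sum>j\<in>UNIV. (v \<bullet> e j) *\<^sub>R a j) - v = 0"
  proof (rule V_eq_0)
    show "(\<Sum>j\<in>UNIV. (v \<bullet> e j) *\<^sub>R a j) - v \<in> V"
      by (intro subspace_diff[OF subspace_V] sum_a_in_V v)
    fix w assume w: "w \<in> V"
    show "B w ((\<Sum>j\<in>UNIV. (v \<bullet> e j) *\<^sub>R a j) - v) = 0"
      by (simp add: B_diff_right B_sum_right B_scale_right B_V_a[OF w]) (simp add: B_def mult_ac)
  qed
  then show ?thesis by simp
qed

text \<open>Represents the functional \<open>t\<close> on \<open>V\<close> with respect to the Fisher form \<open>B\<close>; \<open>t \<bullet> riesz t\<close> is the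
  variance of \<open>t \<bullet> a j\<close> for \<open>j\<close> distributed according to \<open>p\<close>.\<close>

definition riesz :: "'a \<Rightarrow> 'a" where "riesz t = (\<Sum>j\<in>UNIV. (p j * (t \<bullet> a j)) *\<^sub>R a j)"

lemma riesz_in_V: "riesz t \<in> V"
  unfolding riesz_def by (rule sum_a_in_V)

lemma B_V_riesz: "v \<in> V \<Longrightarrow> B v (riesz t) = t \<bullet> v"
proof -
  assume v: "v \<in> V"
  have "B v (riesz t) = (\<Sum>j\<in>UNIV. (p j * (t \<bullet> a j)) * ((v \<bullet> e j) / p j))"
    by (simp add: riesz_def B_sum_right B_scale_right B_V_a[OF v])
  also have "\<dots> = (\<Sum>j\<in>UNIV. (v \<bullet> e j) * (t \<bullet> a j))"
  proof (intro sum.cong refl)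
    fix j show "(p j * (t \<bullet> a j)) * ((v \<bullet> e j) / p j) = (v \<bullet> e j) * (t \<bullet> a j)"
      using p_pos[of j] by (cases "e j = 0") auto
  qed
  also have "\<dots> = t \<bullet> (\<Sum>j\<in>UNIV. (v \<bullet> e j) *\<^sub>R a j)" by (simp add: inner_sum_right)
  finally show ?thesis by (simp add: V_expand[OF v])
qed

lemma inner_riesz: "t \<bullet> riesz t = (\<Sum>j\<in>UNIV. p j * (t \<bullet> a j)\<^sup>2)"
  by (simp add: riesz_def inner_sum_right power2_eq_square mult_ac)

subsection \<open>Existence and uniqueness of the maximiser\<close>

text \<open>In the model all probabilities lie between 0 and 1, which bounds
  \<open>B \<rho> \<rho>\<close>; coercivity turns this into a bound on the norm.\<close>

lemma compact_model: "compact model"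
proof -
  obtain \<kappa> where \<kappa>: "\<kappa> > 0" "\<And>x. x \<in> H \<Longrightarrow> \<kappa> * (norm x)\<^sup>2 \<le> B x x"
    using B_coercive by blast
  have "norm \<rho> \<le> sqrt ((\<Sum>j\<in>UNIV. 1 / p j) / \<kappa>)" if \<rho>: "\<rho> \<in> model" for \<rho>
  proof -
    have "(\<rho> \<bullet> e j) * (\<rho> \<bullet> e j) \<le> 1" for j
      using \<rho> model_le_1[OF \<rho>, of j] by (intro mult_le_one) (auto simp: model_def)
    then have "B \<rho> \<rho> \<le> (\<Sum>j\<in>UNIV. 1 / p j)"
      unfolding B_def by (intro sum_mono divide_right_mono p_nonneg)
    then have "\<kappa> * (norm \<rho>)\<^sup>2 \<le> (\<Sum>j\<in>UNIV. 1 / p j)"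
      using \<kappa>(2)[of \<rho>] \<rho> by (auto simp: model_def)
    then show ?thesis using \<kappa>(1) by (intro real_le_rsqrt) (simp add: field_simps)
  qed
  then have "bounded model" by (auto simp: bounded_iff)
  moreover have "closed model"
  proof -
    have "model = H \<inter> {\<rho>. (\<Sum>j\<in>UNIV. \<rho> \<bullet> e j) = 1} \<inter> (\<Inter>j. {\<rho>. 0 \<le> \<rho> \<bullet> e j})"
      by (auto simp: model_def)
    also have "closed \<dots>"
      by (intro closed_Int closed_INT closed_subspace[OF subspace_H] closed_Collect_eq
          closed_Collect_le ballI continuous_intros)
    finally show ?thesis .
  qed
  ultimately show ?thesis by (simp add: compact_eq_bounded_closed)
qed

lemma ex_is_max: "\<exists>\<rho>. is_max n \<rho>"
proof -
  have "continuous_on model (lik n)"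
    unfolding lik_def by (intro continuous_intros)
  then show ?thesis
    using continuous_attains_sup[OF compact_model] \<rho>0_model unfolding is_max_def by blast
qed

text \<open>A count at a vacuous effect would make the likelihood vanish identically, while an
  unobserved nonzero effect would let its probability drop to 0 at a maximiser. Excluding both makes
  maximisers interior.\<close>

definition supported :: "('j \<Rightarrow> nat) \<Rightarrow> bool" where
  "supported n \<longleftrightarrow> (\<forall>j. n j > 0 \<longleftrightarrow> e j \<noteq> 0)"

lemma supportedD: "supported n \<Longrightarrow> e j = 0 \<Longrightarrow> n j = 0" "supported n \<Longrightarrow> e j \<noteq> 0 \<Longrightarrow> n j > 0"
  unfolding supported_def by auto

lemma lik_eq_exp:
  assumes "\<And>j. e j = 0 \<Longrightarrow> n j = 0" "\<And>j. e j \<noteq> 0 \<Longrightarrow> \<rho> \<bullet> e j > 0"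
  shows "lik n \<rho> = exp (\<Sum>j\<in>UNIV. n j * ln (\<rho> \<bullet> e j))"
proof -
  have "(\<rho> \<bullet> e j) ^ n j = exp (n j * ln (\<rho> \<bullet> e j))" for j
    using assms[of j] by (cases "e j = 0") (auto simp: exp_of_nat_mult)
  then show ?thesis by (simp add: lik_def exp_sum)
qed

text \<open>The likelihood is positive at \<open>\<rho>\<^sub>0\<close>, hence at the maximiser, so
  none of its factors with positive exponent can vanish.\<close>

lemma is_max_pos:
  assumes "supported n" "is_max n \<rho>" "e j \<noteq> 0"
  shows "\<rho> \<bullet> e j > 0"
proof -
  have "0 < lik n \<rho>\<^sub>0"
    using supportedD(1)[OF assms(1)] pos by (subst lik_eq_exp) auto
  also have "\<dots> \<le> lik n \<rho>"
    using assms(2) \<rho>0_model by (simp add: is_max_def)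
  finally have "(\<Prod>j\<in>UNIV. (\<rho> \<bullet> e j) ^ n j) \<noteq> 0"
    unfolding lik_def by (rule less_imp_neq[symmetric])
  then have "(\<rho> \<bullet> e j) ^ n j \<noteq> 0" by (subst (asm) prod_zero_iff) auto
  then have "\<rho> \<bullet> e j \<noteq> 0"
    using supportedD(2)[OF assms(1,3)] by (auto simp: zero_power)
  moreover have "0 \<le> \<rho> \<bullet> e j"
    using assms(2) by (simp add: is_max_def model_def)
  ultimately show ?thesis by linarith
qed

text \<open>By \<open>is_max_pos\<close> a short segment through \<rho> in direction
  \<open>v\<close> stays in the model on both sides, so the log-likelihood \<open>g\<close> along it
  has a local maximum at 0.\<close>

lemma first_order_condition:
  assumes n: "supported n" and \<rho>: "is_max n \<rho>" and v: "v \<in> V"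
  shows "(\<Sum>j\<in>UNIV. n j * (v \<bullet> e j) / (\<rho> \<bullet> e j)) = 0"
proof -
  have q: "\<rho> \<bullet> e j > 0" if "e j \<noteq> 0" for j
    using is_max_pos[OF n \<rho> that] .
  define g where "g t = (\<Sum>j\<in>UNIV. n j * ln (\<rho> \<bullet> e j + t * (v \<bullet> e j)))" for t
  have "eventually (\<lambda>t. e j \<noteq> 0 \<longrightarrow> 0 < \<rho> \<bullet> e j + t * (v \<bullet> e j)) (nhds 0)" for j
  proof (cases "e j = 0")
    case False
    have "((\<lambda>t. \<rho> \<bullet> e j + t * (v \<bullet> e j)) \<longlongrightarrow> \<rho> \<bullet> e j + 0 * (v \<bullet> e j)) (nhds 0)"
      by (intro tendsto_intros filterlim_ident)
    then show ?thesis using order_tendstoD(1) q[OF False] by fastforce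
  qed simp
  then have "eventually (\<lambda>t. \<forall>j. e j \<noteq> 0 \<longrightarrow> 0 < \<rho> \<bullet> e j + t * (v \<bullet> e j)) (nhds 0)"
    by (rule eventually_all_finite)
  then obtain d where d: "d > 0" "\<And>t j. \<bar>t\<bar> < d \<Longrightarrow> e j \<noteq> 0 \<Longrightarrow> 0 < \<rho> \<bullet> e j + t * (v \<bullet> e j)"
    by (auto simp: eventually_nhds_metric dist_real_def)
  have lik: "lik n (\<rho> + t *\<^sub>R v) = exp (g t)" if "\<bar>t\<bar> < d" for t
    using supportedD(1)[OF n] d(2)[OF that]
    by (subst lik_eq_exp) (auto simp: g_def inner_add_left)
  have mod: "\<rho> + t *\<^sub>R v \<in> model" if "\<bar>t\<bar> < d" for t
  proof -
    have "0 \<le> \<rho> \<bullet> e j + t * (v \<bullet> e j)" for j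
      using d(2)[OF that, of j] by (cases "e j = 0") auto
    then show ?thesis
      using \<rho> v subspace_H
      by (auto simp: is_max_def model_def V_def inner_add_left sum.distrib subspace_def
          simp flip: sum_distrib_left)
  qed
  have "DERIV g 0 :> (\<Sum>j\<in>UNIV. n j * (v \<bullet> e j) / (\<rho> \<bullet> e j))"
    unfolding g_def
  proof (rule DERIV_sum)
    fix j
    show "((\<lambda>t. n j * ln (\<rho> \<bullet> e j + t * (v \<bullet> e j))) has_real_derivative
        n j * (v \<bullet> e j) / (\<rho> \<bullet> e j)) (at 0)"
    proof (cases "e j = 0")
      case False
      then show ?thesis using q[OF False] by (auto intro!: derivative_eq_intros)
    qed simp
  qed
  moreover have "\<forall>t. \<bar>0 - t\<bar> < d \<longrightarrow> g t \<le> g 0"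
  proof (intro allI impI)
    fix t assume "\<bar>0 - t\<bar> < d"
    then have t: "\<bar>t\<bar> < d" by simp
    have "exp (g t) \<le> exp (g 0)"
      using \<rho> mod[OF t] lik[OF t] lik[of 0] d(1) by (auto simp: is_max_def)
    then show "g t \<le> g 0" by simp
  qed
  ultimately show ?thesis using DERIV_local_max d(1) by blast
qed

lemma V_eq_0_pairing: "v \<in> V \<Longrightarrow> (\<And>j. e j \<noteq> 0 \<Longrightarrow> v \<bullet> e j = 0) \<Longrightarrow> v = 0"
proof -
  assume v: "v \<in> V" and z: "\<And>j. e j \<noteq> 0 \<Longrightarrow> v \<bullet> e j = 0"
  have "v \<bullet> e j = 0" for j using z[of j] by (cases "e j = 0") auto
  then show "v = 0" using v V_subset by (intro B_eq_0) (auto simp: B_def)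
qed

text \<open>Subtracting the first-order conditions of two maximisers, both tested on their
  difference, leaves a vanishing sum of nonnegative terms. This is strict concavity in a form
  without second derivatives.\<close>

lemma is_max_unique:
  assumes n: "supported n" and \<rho>: "is_max n \<rho>" and \<sigma>: "is_max n \<sigma>"
  shows "\<rho> = \<sigma>"
proof -
  define v where "v = \<sigma> - \<rho>"
  have v: "v \<in> V" using \<rho> \<sigma> by (simp add: v_def is_max_def model_diff_V)
  have z: "n j * (v \<bullet> e j)\<^sup>2 / ((\<rho> \<bullet> e j) * (\<sigma> \<bullet> e j))
      = n j * (v \<bullet> e j) / (\<rho> \<bullet> e j) - n j * (v \<bullet> e j) / (\<sigma> \<bullet> e j)" for j
  proof (cases "e j = 0")
    case False
    have sig: "\<sigma> \<bullet> e j = \<rho> \<bullet> e j + v \<bullet> e j" by (simp add: v_def inner_diff_left)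
    have "\<rho> \<bullet> e j > 0" "\<rho> \<bullet> e j + v \<bullet> e j > 0"
      using is_max_pos[OF n \<rho> False] is_max_pos[OF n \<sigma> False] by (simp_all add: sig)
    then show ?thesis unfolding sig by (simp add: field_simps power2_eq_square)
  qed simp
  have nn: "0 \<le> n j * (v \<bullet> e j)\<^sup>2 / ((\<rho> \<bullet> e j) * (\<sigma> \<bullet> e j))" for j
    using \<rho> \<sigma> by (auto simp: is_max_def model_def)
  have "(\<Sum>j\<in>UNIV. n j * (v \<bullet> e j)\<^sup>2 / ((\<rho> \<bullet> e j) * (\<sigma> \<bullet> e j))) = 0"
    by (simp add: z sum_subtractf first_order_condition[OF n \<rho> v] first_order_condition[OF n \<sigma> v])
  then have eq0: "n j * (v \<bullet> e j)\<^sup>2 / ((\<rho> \<bullet> e j) * (\<sigma> \<bullet> e j)) = 0" for j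
    using nn by (subst (asm) sum_nonneg_eq_0_iff) auto
  have "v \<bullet> e j = 0" if "e j \<noteq> 0" for j
    using eq0[of j] supportedD(2)[OF n that] is_max_pos[OF n \<rho> that] is_max_pos[OF n \<sigma> that] by auto
  then have "v = 0" by (rule V_eq_0_pairing[OF v])
  then show ?thesis by (simp add: v_def)
qed

section \<open>Quantitative bounds for frequencies close to the true probabilities\<close>

definition freq :: "('j \<Rightarrow> nat) \<Rightarrow> 'j \<Rightarrow> real" where "freq n j = n j / sample_size n"

lemma near_size: "near n \<delta> \<Longrightarrow> sample_size n > 0" by (simp add: near_def)

lemma near_le: "near n \<delta> \<Longrightarrow> \<bar>freq n j - p j\<bar> \<le> \<delta>" by (simp add: near_def freq_def)

lemma near_ge_half: "near n \<delta> \<Longrightarrow> freq n j \<ge> p j / 2"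
  unfolding near_def freq_def using abs_le_D2[of "n j / sample_size n - p j" "p j / 2"] by fastforce

lemma near_nonneg: "near n \<delta> \<Longrightarrow> \<delta> \<ge> 0"
  using near_le[of n \<delta> undefined] by linarith

lemma near_supported:
  assumes "near n \<delta>"
  shows "supported n"
  unfolding supported_def
proof
  fix j
  show "(0 < n j) = (e j \<noteq> 0)"
  proof (cases "e j = 0")
    case True
    have "\<bar>n j / sample_size n - p j\<bar> \<le> p j / 2" using assms by (simp add: near_def)
    then show ?thesis using near_size[OF assms] p_zero[OF True] True by (simp add: divide_le_0_iff)
  next
    case False
    have "freq n j > 0"
      using near_ge_half[OF assms, of j] p_pos[OF False] by linarith
    then have "n j / sample_size n > 0" by (simp only: freq_def)
    then show ?thesis using False by (auto intro: gr0I)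
  qed
qed

lemma sum_freq: "near n \<delta> \<Longrightarrow> (\<Sum>j\<in>UNIV. freq n j) = 1"
  using near_size[of n \<delta>] by (simp add: freq_def sum_divide_distrib[symmetric]) (simp add: sample_size_def)

lemma freq_nonneg: "near n \<delta> \<Longrightarrow> 0 \<le> freq n j"
  using near_size[of n \<delta>] by (simp add: freq_def)

lemma freq_le_1:
  assumes "near n \<delta>"
  shows "freq n j \<le> 1"
  using member_le_sum[of j UNIV "freq n"] freq_nonneg[OF assms] sum_freq[OF assms] by simp

lemma first_order_condition_freq:
  assumes n: "near n \<delta>" and \<rho>: "is_max n \<rho>" and v: "v \<in> V"
  shows "(\<Sum>j\<in>UNIV. freq n j * (v \<bullet> e j) / (\<rho> \<bullet> e j)) = 0"
proof -
  have "(\<Sum>j\<in>UNIV. freq n j * (v \<bullet> e j) / (\<rho> \<bullet> e j))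
      = (\<Sum>j\<in>UNIV. n j * (v \<bullet> e j) / (\<rho> \<bullet> e j)) / sample_size n"
    by (simp add: freq_def sum_divide_distrib mult_ac)
  then show ?thesis by (simp add: first_order_condition[OF near_supported[OF n] \<rho> v])
qed

text \<open>The first-order condition in direction \<open>\<rho> - \<rho>\<^sub>0\<close> says that
  the terms \<open>freq n i * p i / (\<rho> \<bullet> e i)\<close> add up to 1. Each of them is thus
  at most 1, and \<open>freq n j\<close> is at least half of \<open>p j\<close>.\<close>

lemma mle_lower_bound:
  assumes n: "near n \<delta>" and \<rho>: "is_max n \<rho>" and j: "e j \<noteq> 0"
  shows "c \<le> \<rho> \<bullet> e j"
proof -
  note S = near_supported[OF n]
  have v: "\<rho> - \<rho>\<^sub>0 \<in> V" using \<rho> \<rho>0_model by (simp add: is_max_def model_diff_V)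
  have q: "\<rho> \<bullet> e i > 0" if "e i \<noteq> 0" for i using is_max_pos[OF S \<rho> that] .
  have "freq n i * p i / (\<rho> \<bullet> e i) = freq n i - freq n i * ((\<rho> - \<rho>\<^sub>0) \<bullet> e i) / (\<rho> \<bullet> e i)" for i
  proof (cases "e i = 0")
    case True
    then show ?thesis using supportedD(1)[OF S True] by (simp add: freq_def)
  next
    case False
    then show ?thesis using q[OF False] by (simp add: p_def inner_diff_left field_simps)
  qed
  then have "(\<Sum>i\<in>UNIV. freq n i * p i / (\<rho> \<bullet> e i)) = 1"
    by (simp add: sum_subtractf sum_freq[OF n] first_order_condition_freq[OF n \<rho> v])
  moreover have "freq n j * p j / (\<rho> \<bullet> e j) \<le> (\<Sum>i\<in>UNIV. freq n i * p i / (\<rho> \<bullet> e i))"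
    using \<rho> by (intro member_le_sum divide_nonneg_nonneg mult_nonneg_nonneg freq_nonneg[OF n] p_nonneg)
      (auto simp: is_max_def model_def)
  ultimately have "freq n j * p j \<le> \<rho> \<bullet> e j"
    using q[OF j] by (simp add: divide_le_eq)
  moreover have "p j / 2 * p j \<le> freq n j * p j"
    using near_ge_half[OF n] by (intro mult_right_mono p_nonneg)
  ultimately show ?thesis using c_le[OF j] by (simp add: power2_eq_square)
qed

text \<open>Arises from bounding each of the \<open>CARD('j)\<close> quotients of a squared
  frequency error by a probability by \<delta>^2 / c.\<close>

definition C1 :: real where "C1 = sqrt (CARD('j) / c)"

lemma C1_nonneg: "C1 \<ge> 0" using c_pos by (simp add: C1_def)

text \<open>Multiplying the first-order condition in the direction \<open>\<rho> - \<rho>\<^sub>0\<close> out gives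
  \<open>\<Sum> y\<^sup>2 / q = \<Sum> x y / q\<close> for \<open>x = freq - p\<close>, \<open>y = q - p\<close>.\<close>

lemma mle_prob_bound:
  assumes n: "near n \<delta>" and \<rho>: "is_max n \<rho>"
  shows "\<bar>\<rho> \<bullet> e j - p j\<bar> \<le> C1 * \<delta>"
proof -
  note S = near_supported[OF n]
  note \<delta> = near_nonneg[OF n]
  define q where "q i = \<rho> \<bullet> e i" for i
  define x where "x i = freq n i - p i" for i
  define y where "y i = q i - p i" for i
  have v: "\<rho> - \<rho>\<^sub>0 \<in> V" using \<rho> \<rho>0_model by (simp add: is_max_def model_diff_V)
  have y: "y i = (\<rho> - \<rho>\<^sub>0) \<bullet> e i" for i by (simp add: y_def q_def p_def inner_diff_left)
  have qp: "q i > 0" if "e i \<noteq> 0" for i using is_max_pos[OF S \<rho> that] by (simp add: q_def)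
  have z: "q i = 0 \<and> y i = 0" if "e i = 0" for i using that by (simp add: q_def y)
  have q01: "0 \<le> q i" "q i \<le> 1" for i
    using \<rho> model_le_1[of \<rho> i] by (auto simp: is_max_def q_def model_def)
  have "(y i)\<^sup>2 / q i = y i + x i * y i / q i - freq n i * y i / q i" for i
  proof (cases "e i = 0")
    case False
    then show ?thesis using qp[OF False] by (simp add: x_def y_def field_simps power2_eq_square)
  qed (simp add: z)
  then have "(\<Sum>i\<in>UNIV. (y i)\<^sup>2 / q i)
      = (\<Sum>i\<in>UNIV. y i) + (\<Sum>i\<in>UNIV. x i * y i / q i) - (\<Sum>i\<in>UNIV. freq n i * y i / q i)"
    by (simp add: sum.distrib sum_subtractf)
  also have "(\<Sum>i\<in>UNIV. y i) = 0" using v by (simp add: y V_def)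
  also have "(\<Sum>i\<in>UNIV. freq n i * y i / q i) = 0"
    using first_order_condition_freq[OF n \<rho> v] by (simp add: y q_def)
  finally have "(\<Sum>i\<in>UNIV. (y i)\<^sup>2 / q i) = (\<Sum>i\<in>UNIV. x i * y i / q i)" by simp
  \<comment> \<open>Half of the sum being estimated reappears on the right and is absorbed by the
    left side.\<close>
  also have "\<dots> \<le> (\<Sum>i\<in>UNIV. (x i)\<^sup>2 / q i / 2 + (y i)\<^sup>2 / q i / 2)"
  proof (rule sum_mono)
    fix i
    have "x i * y i \<le> ((x i)\<^sup>2 + (y i)\<^sup>2) / 2"
      using sum_squares_bound[of "x i" "y i"] by simp
    then have "x i * y i / q i \<le> ((x i)\<^sup>2 + (y i)\<^sup>2) / 2 / q i"
      using q01 by (intro divide_right_mono)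
    then show "x i * y i / q i \<le> (x i)\<^sup>2 / q i / 2 + (y i)\<^sup>2 / q i / 2"
      by (simp add: add_divide_distrib mult.commute)
  qed
  also have "\<dots> = (\<Sum>i\<in>UNIV. (x i)\<^sup>2 / q i) / 2 + (\<Sum>i\<in>UNIV. (y i)\<^sup>2 / q i) / 2"
    by (simp add: sum.distrib sum_divide_distrib)
  finally have "(\<Sum>i\<in>UNIV. (y i)\<^sup>2 / q i) \<le> (\<Sum>i\<in>UNIV. (x i)\<^sup>2 / q i)" by simp
  also have "\<dots> \<le> (\<Sum>i::'j\<in>UNIV. \<delta>\<^sup>2 / c)"
  proof (rule sum_mono)
    fix i
    show "(x i)\<^sup>2 / q i \<le> \<delta>\<^sup>2 / c"
    proof (cases "e i = 0")
      case False
      have "(x i)\<^sup>2 \<le> \<delta>\<^sup>2"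
        using near_le[OF n, of i] \<delta> by (simp add: x_def flip: abs_le_square_iff)
      then show ?thesis
        using mle_lower_bound[OF n \<rho> False] c_pos by (intro frac_le) (auto simp: q_def)
    qed (use z c_pos in auto)
  qed
  also have "\<dots> = (C1 * \<delta>)\<^sup>2"
    using c_pos by (simp add: C1_def power_mult_distrib)
  finally have le: "(\<Sum>i\<in>UNIV. (y i)\<^sup>2 / q i) \<le> (C1 * \<delta>)\<^sup>2" .
  have "(y j)\<^sup>2 \<le> (y j)\<^sup>2 / q j"
  proof (cases "e j = 0")
    case False
    then show ?thesis using qp[OF False] q01[of j] by (simp add: le_divide_eq mult_left_le)
  qed (simp add: z)
  also have "\<dots> \<le> (\<Sum>i\<in>UNIV. (y i)\<^sup>2 / q i)"
    using q01 by (intro member_le_sum) auto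
  finally have "(y j)\<^sup>2 \<le> (C1 * \<delta>)\<^sup>2" using le by linarith
  then have "\<bar>y j\<bar> \<le> C1 * \<delta>"
    using C1_nonneg \<delta> by (simp add: abs_le_square_iff[symmetric])
  then show ?thesis by (simp add: y_def q_def)
qed

text \<open>The bounds on the single probabilities bound the Fisher form, and coercivity passes to
  the norm.\<close>

lemma mle_bound:
  "\<exists>C\<ge>0. \<forall>n \<delta> \<rho>. near n \<delta> \<longrightarrow> is_max n \<rho> \<longrightarrow> norm (\<rho> - \<rho>\<^sub>0) \<le> C * \<delta>"
proof -
  obtain \<kappa> where \<kappa>: "\<kappa> > 0" "\<And>x. x \<in> H \<Longrightarrow> \<kappa> * (norm x)\<^sup>2 \<le> B x x"
    using B_coercive by blast
  define C where "C = sqrt (CARD('j) / c / \<kappa>) * C1"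
  have C: "C \<ge> 0" using \<kappa>(1) c_pos C1_nonneg by (simp add: C_def)
  have "norm (\<rho> - \<rho>\<^sub>0) \<le> C * \<delta>" if n: "near n \<delta>" and \<rho>: "is_max n \<rho>" for n \<delta> \<rho>
  proof -
    have "\<rho> - \<rho>\<^sub>0 \<in> V" using \<rho> \<rho>0_model by (simp add: is_max_def model_diff_V)
    then have "\<kappa> * (norm (\<rho> - \<rho>\<^sub>0))\<^sup>2 \<le> B (\<rho> - \<rho>\<^sub>0) (\<rho> - \<rho>\<^sub>0)"
      using \<kappa>(2) V_subset by blast
    also have "\<dots> \<le> (\<Sum>j::'j\<in>UNIV. (C1 * \<delta>)\<^sup>2 / c)"
      unfolding B_def
    proof (rule sum_mono)
      fix j
      show "((\<rho> - \<rho>\<^sub>0) \<bullet> e j) * ((\<rho> - \<rho>\<^sub>0) \<bullet> e j) / p j \<le> (C1 * \<delta>)\<^sup>2 / c"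
      proof (cases "e j = 0")
        case False
        have "((\<rho> - \<rho>\<^sub>0) \<bullet> e j)\<^sup>2 \<le> (C1 * \<delta>)\<^sup>2"
          using mle_prob_bound[OF n \<rho>, of j] C1_nonneg near_nonneg[OF n]
          by (simp add: p_def inner_diff_left flip: abs_le_square_iff)
        then show ?thesis
          using c_le_p[OF False] c_pos by (intro frac_le) (auto simp: power2_eq_square)
      qed (use c_pos in auto)
    qed
    also have "\<dots> = \<kappa> * (C * \<delta>)\<^sup>2"
      using \<kappa>(1) c_pos by (simp add: C_def power_mult_distrib)
    finally have "(norm (\<rho> - \<rho>\<^sub>0))\<^sup>2 \<le> (C * \<delta>)\<^sup>2" using \<kappa>(1) by simp
    then show ?thesis using C near_nonneg[OF n] by (simp add: power2_le_iff_abs_le)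
  qed
  then show ?thesis using C by blast
qed

text \<open>The error \<open>w\<close> is tested against itself in \<open>B\<close>. The first-order
  condition in direction \<open>w\<close> cancels all terms linear in the deviations and leaves
  products of two of them, so that \<kappa> |w|^2 \<le> |w| K \<delta>^2.\<close>

lemma mle_linearization:
  "\<exists>C\<ge>0. \<forall>n \<delta> \<rho>. near n \<delta> \<longrightarrow> is_max n \<rho> \<longrightarrow>
    norm (\<rho> - \<rho>\<^sub>0 - (\<Sum>j\<in>UNIV. freq n j *\<^sub>R a j)) \<le> C * \<delta>\<^sup>2"
proof -
  obtain \<kappa> where \<kappa>: "\<kappa> > 0" "\<And>x. x \<in> H \<Longrightarrow> \<kappa> * (norm x)\<^sup>2 \<le> B x x"
    using B_coercive by blast
  define K where "K = (\<Sum>j\<in>UNIV. norm (e j) * ((1 + C1) * C1 / (c * c)))"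
  have K: "K \<ge> 0" unfolding K_def using C1_nonneg c_pos by (intro sum_nonneg) auto
  have "norm (\<rho> - \<rho>\<^sub>0 - (\<Sum>j\<in>UNIV. freq n j *\<^sub>R a j)) \<le> K / \<kappa> * \<delta>\<^sup>2"
    if n: "near n \<delta>" and \<rho>: "is_max n \<rho>" for n \<delta> \<rho>
  proof -
    note S = near_supported[OF n]
    note \<delta> = near_nonneg[OF n]
    define q where "q i = \<rho> \<bullet> e i" for i
    define x where "x i = freq n i - p i" for i
    define y where "y i = q i - p i" for i
    have h: "\<rho> - \<rho>\<^sub>0 \<in> V" using \<rho> \<rho>0_model by (simp add: is_max_def model_diff_V)
    have y: "y i = (\<rho> - \<rho>\<^sub>0) \<bullet> e i" for i by (simp add: y_def q_def p_def inner_diff_left)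
    define w where "w = \<rho> - \<rho>\<^sub>0 - (\<Sum>j\<in>UNIV. freq n j *\<^sub>R a j)"
    have w: "w \<in> V" unfolding w_def by (intro subspace_diff[OF subspace_V] h sum_a_in_V)
    have "(\<Sum>j\<in>UNIV. freq n j *\<^sub>R a j) = (\<Sum>j\<in>UNIV. x j *\<^sub>R a j)"
      using sum_p_a by (simp add: x_def scaleR_diff_left sum_subtractf)
    then have "B w w = B w (\<rho> - \<rho>\<^sub>0) - B w (\<Sum>j\<in>UNIV. x j *\<^sub>R a j)"
      by (simp add: w_def B_diff_right)
    also have "\<dots> = (\<Sum>j\<in>UNIV. (w \<bullet> e j) * y j / p j) - (\<Sum>j\<in>UNIV. x j * ((w \<bullet> e j) / p j))"
      by (simp add: B_sum_right B_scale_right B_V_a[OF w] y) (simp add: B_def)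
    also have "\<dots> = (\<Sum>j\<in>UNIV. (w \<bullet> e j) * y j / p j - x j * ((w \<bullet> e j) / p j))"
      by (simp add: sum_subtractf)
    \<comment> \<open>With freq = p + x and q = p + y the denominators \<open>p\<close> are
      exchanged for \<open>q\<close>. The first term sums to 0 on \<open>V\<close>, the last is the
      first-order condition, and the middle one is quadratic.\<close>
    also have "\<dots> = (\<Sum>j\<in>UNIV. (w \<bullet> e j) + (w \<bullet> e j) * ((y j - x j) * y j / (q j * p j))
        - freq n j * (w \<bullet> e j) / q j)"
    proof (intro sum.cong refl)
      fix j
      show "(w \<bullet> e j) * y j / p j - x j * ((w \<bullet> e j) / p j)
          = (w \<bullet> e j) + (w \<bullet> e j) * ((y j - x j) * y j / (q j * p j)) - freq n j * (w \<bullet> e j) / q j"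
      proof (cases "e j = 0")
        case False
        have "q j > 0" "p j > 0"
          using is_max_pos[OF S \<rho> False] p_pos[OF False] by (auto simp: q_def)
        then show ?thesis by (simp add: x_def y_def field_simps)
      qed simp
    qed
    also have "\<dots> = (\<Sum>j\<in>UNIV. (w \<bullet> e j)) + (\<Sum>j\<in>UNIV. (w \<bullet> e j) * ((y j - x j) * y j / (q j * p j)))
        - (\<Sum>j\<in>UNIV. freq n j * (w \<bullet> e j) / q j)"
      by (simp add: sum.distrib sum_subtractf)
    also have "\<dots> = (\<Sum>j\<in>UNIV. (w \<bullet> e j) * ((y j - x j) * y j / (q j * p j)))"
      using w first_order_condition_freq[OF n \<rho> w] by (simp add: V_def q_def)
    also have "\<dots> \<le> (\<Sum>j\<in>UNIV. norm w * norm (e j) * ((1 + C1) * C1 / (c * c)) * \<delta>\<^sup>2)"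
    proof (rule sum_mono)
      fix j
      show "(w \<bullet> e j) * ((y j - x j) * y j / (q j * p j))
          \<le> norm w * norm (e j) * ((1 + C1) * C1 / (c * c)) * \<delta>\<^sup>2"
      proof (cases "e j = 0")
        case False
        have yj: "\<bar>y j\<bar> \<le> C1 * \<delta>" using mle_prob_bound[OF n \<rho>] by (simp add: y_def q_def)
        have "\<bar>x j\<bar> \<le> \<delta>" using near_le[OF n] by (simp add: x_def)
        then have "\<bar>y j - x j\<bar> \<le> (1 + C1) * \<delta>" using yj by (simp add: distrib_right)
        then have "\<bar>(y j - x j) * y j\<bar> \<le> ((1 + C1) * \<delta>) * (C1 * \<delta>)"
          unfolding abs_mult using yj \<delta> C1_nonneg by (intro mult_mono) auto
        moreover have "c * c \<le> q j * p j"
          using mle_lower_bound[OF n \<rho> False] c_le_p[OF False] c_pos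
          by (intro mult_mono) (auto simp: q_def)
        ultimately have "\<bar>(y j - x j) * y j\<bar> / (q j * p j) \<le> ((1 + C1) * \<delta>) * (C1 * \<delta>) / (c * c)"
          using c_pos by (intro frac_le) auto
        moreover have "q j * p j > 0" using \<open>c * c \<le> q j * p j\<close> c_pos mult_pos_pos[of c c] by linarith
        ultimately have "\<bar>(y j - x j) * y j / (q j * p j)\<bar> \<le> ((1 + C1) * \<delta>) * (C1 * \<delta>) / (c * c)"
          by (simp add: abs_divide)
        moreover have "\<bar>w \<bullet> e j\<bar> \<le> norm w * norm (e j)" by (rule Cauchy_Schwarz_ineq2)
        ultimately have "\<bar>(w \<bullet> e j) * ((y j - x j) * y j / (q j * p j))\<bar>
            \<le> norm w * norm (e j) * (((1 + C1) * \<delta>) * (C1 * \<delta>) / (c * c))"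
          unfolding abs_mult[of "w \<bullet> e j"] by (intro mult_mono) auto
        then have "(w \<bullet> e j) * ((y j - x j) * y j / (q j * p j))
            \<le> norm w * norm (e j) * (((1 + C1) * \<delta>) * (C1 * \<delta>) / (c * c))"
          by (rule abs_le_D1)
        also have "\<dots> = norm w * norm (e j) * ((1 + C1) * C1 / (c * c)) * \<delta>\<^sup>2"
          by (simp add: power2_eq_square mult_ac)
        finally show ?thesis .
      qed simp
    qed
    also have "\<dots> = norm w * (K * \<delta>\<^sup>2)"
      by (simp add: K_def sum_distrib_left sum_distrib_right mult_ac)
    finally have "\<kappa> * (norm w)\<^sup>2 \<le> norm w * (K * \<delta>\<^sup>2)"
      using \<kappa>(2)[of w] w V_subset by force
    then have "\<kappa> * norm w \<le> K * \<delta>\<^sup>2"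
      using K by (cases "norm w = 0") (auto simp: power2_eq_square)
    then show ?thesis using \<kappa>(1) by (simp add: w_def field_simps)
  qed
  then show ?thesis using K \<kappa>(1) by (intro exI[of _ "K / \<kappa>"]) auto
qed

text \<open>The log-likelihood is expanded at the maximiser, where the linear term vanishes. The
  quadratic coefficient freq / q^2 differs from the Fisher coefficient 1 / p by O(\<delta>), and the
  displacement is at most \<delta>; every error is thus of order N \<delta>^3.\<close>

lemma lik_ratio:
  "\<exists>C\<ge>0. \<exists>\<delta>0>0. \<forall>n \<delta> \<rho> \<sigma>. near n \<delta> \<longrightarrow> \<delta> \<le> \<delta>0 \<longrightarrow> is_max n \<rho> \<longrightarrow> \<sigma> \<in> model \<longrightarrow> norm (\<sigma> - \<rho>) \<le> \<delta> \<longrightarrow>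
    \<bar>lik n \<sigma> / lik n \<rho> - exp (- (sample_size n * B (\<sigma> - \<rho>) (\<sigma> - \<rho>)) / 2)\<bar> \<le> C * sample_size n * \<delta> ^ 3"
proof -
  \<comment> \<open>Bounds all effect norms at once; the summand 1 makes it safe to divide
    by.\<close>
  define D where "D = 1 + (\<Sum>j\<in>UNIV. norm (e j))"
  have D: "D \<ge> 1" by (simp add: D_def sum_nonneg)
  have eD: "norm (e j) \<le> D" for j
    using member_le_sum[of j UNIV "\<lambda>j. norm (e j)"] by (simp add: D_def)
  \<comment> \<open>The first summand is the cubic remainder of the logarithm, the second the price
    of exchanging freq / q^2 for 1 / p.\<close>
  define K where "K = 2 * (D / c) ^ 3 + (1 + 2 * C1) / c ^ 3 * D\<^sup>2 / 2"
  have K: "K \<ge> 0" using D c_pos C1_nonneg by (simp add: K_def)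
  have "\<bar>lik n \<sigma> / lik n \<rho> - exp (- (sample_size n * B (\<sigma> - \<rho>) (\<sigma> - \<rho>)) / 2)\<bar> \<le> (CARD('j) * K) * sample_size n * \<delta> ^ 3"
    if n: "near n \<delta>" and \<delta>2: "\<delta> \<le> c / (2 * D)" and \<rho>: "is_max n \<rho>" and \<sigma>: "\<sigma> \<in> model"
      and d: "norm (\<sigma> - \<rho>) \<le> \<delta>" for n \<delta> \<rho> \<sigma>
  proof -
    note S = near_supported[OF n]
    note \<delta> = near_nonneg[OF n]
    note N = near_size[OF n]
    define v where "v = \<sigma> - \<rho>"
    have v: "v \<in> V" using \<rho> \<sigma> by (simp add: v_def is_max_def model_diff_V)
    define q where "q i = \<rho> \<bullet> e i" for i
    define z where "z i = v \<bullet> e i" for i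
    have q: "q i \<ge> c" "q i > 0" "q i \<le> 1" if "e i \<noteq> 0" for i
      using mle_lower_bound[OF n \<rho> that] c_pos \<rho> model_le_1[of \<rho> i] by (auto simp: q_def is_max_def)
    have z: "\<bar>z i\<bar> \<le> D * \<delta>" for i
    proof -
      have "\<bar>z i\<bar> \<le> norm v * norm (e i)" unfolding z_def by (rule Cauchy_Schwarz_ineq2)
      also have "\<dots> \<le> \<delta> * D" using d eD \<delta> by (intro mult_mono) (auto simp: v_def)
      finally show ?thesis by (simp add: mult.commute)
    qed
    have zq: "\<bar>z i / q i\<bar> \<le> D / c * \<delta>" if "e i \<noteq> 0" for i
    proof -
      have "\<bar>z i\<bar> / q i \<le> D * \<delta> / c" using z[of i] q[OF that] c_pos by (intro frac_le) auto
      then show ?thesis using q(2)[OF that] by (simp add: abs_divide)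
    qed
    \<comment> \<open>The threshold c / (2D) for \<delta> exists to reach the range of
      \<open>ln_one_plus_second_order\<close>.\<close>
    have half: "\<bar>z i / q i\<bar> \<le> 1 / 2" if "e i \<noteq> 0" for i
    proof -
      have "D / c * \<delta> \<le> D / c * (c / (2 * D))" using \<delta>2 D c_pos by (intro mult_left_mono) auto
      also have "\<dots> = 1 / 2" using D c_pos by simp
      finally show ?thesis using zq[OF that] by linarith
    qed
    have \<sigma>q: "\<sigma> \<bullet> e i = q i * (1 + z i / q i)" if "e i \<noteq> 0" for i
      using q(2)[OF that] by (simp add: q_def z_def v_def inner_diff_left field_simps)
    have pos1: "1 + z i / q i > 0" if "e i \<noteq> 0" for i
      using half[OF that] by linarith
    have \<sigma>pos: "\<sigma> \<bullet> e i > 0" if "e i \<noteq> 0" for i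
      unfolding \<sigma>q[OF that] using q(2)[OF that] pos1[OF that] by (intro mult_pos_pos) auto
    define E where "E = (\<Sum>j\<in>UNIV. n j * ln (1 + z j / q j))"
    have lik\<sigma>: "lik n \<sigma> = lik n \<rho> * exp E"
    proof -
      have "n j * ln (\<sigma> \<bullet> e j) = n j * ln (\<rho> \<bullet> e j) + n j * ln (1 + z j / q j)" for j
      proof (cases "e j = 0")
        case False
        have "ln (\<sigma> \<bullet> e j) = ln (q j) + ln (1 + z j / q j)"
          unfolding \<sigma>q[OF False] by (rule ln_mult_pos[OF q(2)[OF False] pos1[OF False]])
        then show ?thesis by (simp add: q_def distrib_left)
      qed (simp add: supportedD(1)[OF S])
      then have "(\<Sum>j\<in>UNIV. n j * ln (\<sigma> \<bullet> e j)) = (\<Sum>j\<in>UNIV. n j * ln (\<rho> \<bullet> e j)) + E"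
        by (simp add: E_def sum.distrib)
      then show ?thesis
        using lik_eq_exp[of n \<sigma>] lik_eq_exp[of n \<rho>] supportedD(1)[OF S] \<sigma>pos q(2)
        by (simp add: exp_add q_def)
    qed
    have lik\<rho>: "lik n \<rho> > 0"
      using lik_eq_exp[of n \<rho>] supportedD(1)[OF S] q(2) by (simp add: q_def)
    have "lik n \<rho> * exp E \<le> lik n \<rho>"
      using \<rho> \<sigma> unfolding lik\<sigma>[symmetric] by (simp add: is_max_def)
    then have E0: "E \<le> 0" using lik\<rho> by simp
    have foc: "(\<Sum>j\<in>UNIV. n j * (z j / q j)) = 0"
      using first_order_condition[OF S \<rho> v] by (simp add: z_def q_def)
    have "\<bar>E + sample_size n * B v v / 2\<bar>
        = \<bar>\<Sum>j\<in>UNIV. n j * ln (1 + z j / q j) - n j * (z j / q j) + sample_size n * (z j * z j / p j) / 2\<bar>"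
      unfolding sum.distrib sum_subtractf foc
      by (simp add: E_def B_def sum_distrib_left sum_divide_distrib z_def)
    also have "\<dots> \<le> (\<Sum>j\<in>UNIV. \<bar>n j * ln (1 + z j / q j) - n j * (z j / q j) + sample_size n * (z j * z j / p j) / 2\<bar>)"
      by (rule sum_abs)
    also have "\<dots> \<le> (\<Sum>j::'j\<in>UNIV. sample_size n * (K * \<delta> ^ 3))"
    proof (rule sum_mono)
      fix j
      show "\<bar>n j * ln (1 + z j / q j) - n j * (z j / q j) + sample_size n * (z j * z j / p j) / 2\<bar> \<le> sample_size n * (K * \<delta> ^ 3)"
      proof (cases "e j = 0")
        case True
        then show ?thesis using N K \<delta> by (simp add: z_def)
      next
        case False
        define u where "u = z j / q j"
        define \<nu> where "\<nu> = freq n j"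
        have nj: "real (n j) = sample_size n * \<nu>" using N by (simp add: \<nu>_def freq_def)
        have \<nu>: "0 \<le> \<nu>" "\<nu> \<le> 1" using freq_nonneg[OF n] freq_le_1[OF n] by (auto simp: \<nu>_def)
        have p: "p j > 0" "p j \<le> 1" "c \<le> p j" using p_pos[OF False] p_le_1 c_le_p[OF False] by auto
        note q = q[OF False]
        have "\<bar>ln (1 + u) - u + u\<^sup>2 / 2\<bar> \<le> 2 * \<bar>u\<bar> ^ 3"
          using half[OF False] by (intro ln_one_plus_second_order) (simp add: u_def)
        also have "\<dots> \<le> 2 * (D / c * \<delta>) ^ 3"
          using zq[OF False] by (intro mult_left_mono power_mono) (auto simp: u_def)
        finally have "\<bar>\<nu> * (ln (1 + u) - u + u\<^sup>2 / 2)\<bar> \<le> 1 * (2 * (D / c * \<delta>) ^ 3)"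
          unfolding abs_mult using \<nu> by (intro mult_mono) auto
        then have A: "\<bar>\<nu> * (ln (1 + u) - u + u\<^sup>2 / 2)\<bar> \<le> 2 * (D / c) ^ 3 * \<delta> ^ 3"
          by (simp only: power_mult_distrib mult_1_left mult_ac)
        have x: "\<bar>\<nu> - p j\<bar> \<le> \<delta>" using near_le[OF n] by (simp add: \<nu>_def)
        have y: "\<bar>q j - p j\<bar> \<le> C1 * \<delta>" using mle_prob_bound[OF n \<rho>] by (simp add: q_def)
        \<comment> \<open>Inserting p^2 between \<nu> p and q^2 exposes the two differences that are
          known to be O(\<delta>).\<close>
        have "\<nu> / (q j)\<^sup>2 - 1 / p j = ((\<nu> - p j) * p j - (q j - p j) * (q j + p j)) / ((q j)\<^sup>2 * p j)"
          using p q by (simp add: field_simps power2_eq_square)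
        moreover have "\<bar>(\<nu> - p j) * p j - (q j - p j) * (q j + p j)\<bar> \<le> (1 + 2 * C1) * \<delta>"
        proof -
          have "\<bar>(\<nu> - p j) * p j\<bar> \<le> \<delta> * 1"
            unfolding abs_mult using x p \<delta> by (intro mult_mono) auto
          moreover have "\<bar>(q j - p j) * (q j + p j)\<bar> \<le> (C1 * \<delta>) * 2"
            unfolding abs_mult using y p q \<delta> C1_nonneg by (intro mult_mono) auto
          ultimately show ?thesis by (simp add: distrib_right)
        qed
        moreover have "c ^ 3 \<le> (q j)\<^sup>2 * p j"
        proof -
          have "c ^ 3 = c\<^sup>2 * c" by (simp add: power3_eq_cube power2_eq_square)
          also have "\<dots> \<le> (q j)\<^sup>2 * p j"
            using p q c_pos by (intro mult_mono power_mono) auto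
          finally show ?thesis .
        qed
        ultimately have "\<bar>\<nu> / (q j)\<^sup>2 - 1 / p j\<bar> \<le> (1 + 2 * C1) * \<delta> / c ^ 3"
          using c_pos p q by (simp add: abs_divide abs_mult frac_le)
        moreover have "(z j)\<^sup>2 \<le> (D * \<delta>)\<^sup>2"
          using z[of j] \<delta> D by (simp flip: abs_le_square_iff)
        ultimately have "\<bar>(\<nu> / (q j)\<^sup>2 - 1 / p j) * (z j)\<^sup>2\<bar> \<le> ((1 + 2 * C1) * \<delta> / c ^ 3) * (D * \<delta>)\<^sup>2"
          unfolding abs_mult using \<delta> C1_nonneg c_pos by (intro mult_mono) auto
        then have Bd: "\<bar>(\<nu> / (q j)\<^sup>2 - 1 / p j) * (z j)\<^sup>2 / 2\<bar> \<le> (1 + 2 * C1) / c ^ 3 * D\<^sup>2 / 2 * \<delta> ^ 3"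
        proof -
          assume *: "\<bar>(\<nu> / (q j)\<^sup>2 - 1 / p j) * (z j)\<^sup>2\<bar> \<le> ((1 + 2 * C1) * \<delta> / c ^ 3) * (D * \<delta>)\<^sup>2"
          have "((1 + 2 * C1) * \<delta> / c ^ 3) * (D * \<delta>)\<^sup>2 = (1 + 2 * C1) / c ^ 3 * D\<^sup>2 * \<delta> ^ 3"
            by (simp only: power_mult_distrib power3_eq_cube power2_eq_square
                times_divide_eq_left times_divide_eq_right mult_ac)
          with * have le: "\<bar>(\<nu> / (q j)\<^sup>2 - 1 / p j) * (z j)\<^sup>2\<bar> \<le> (1 + 2 * C1) / c ^ 3 * D\<^sup>2 * \<delta> ^ 3"
            by (simp only:)
          have eq2: "\<bar>(\<nu> / (q j)\<^sup>2 - 1 / p j) * (z j)\<^sup>2 / 2\<bar> = \<bar>(\<nu> / (q j)\<^sup>2 - 1 / p j) * (z j)\<^sup>2\<bar> / 2"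
            by (simp only: abs_divide abs_numeral)
          have eq3: "(1 + 2 * C1) / c ^ 3 * D\<^sup>2 / 2 * \<delta> ^ 3 = (1 + 2 * C1) / c ^ 3 * D\<^sup>2 * \<delta> ^ 3 / 2"
            by (simp only: times_divide_eq_left times_divide_eq_right mult_ac)
          show ?thesis unfolding eq2 eq3 by (rule divide_right_mono[OF le]) simp
        qed
        have "n j * ln (1 + z j / q j) - n j * (z j / q j) + sample_size n * (z j * z j / p j) / 2
            = sample_size n * (\<nu> * (ln (1 + u) - u + u\<^sup>2 / 2) - (\<nu> / (q j)\<^sup>2 - 1 / p j) * (z j)\<^sup>2 / 2)"
          unfolding nj u_def power_divide by (simp add: algebra_simps power2_eq_square diff_divide_distrib)
        also have "\<bar>\<dots>\<bar> = sample_size n * \<bar>\<nu> * (ln (1 + u) - u + u\<^sup>2 / 2) - (\<nu> / (q j)\<^sup>2 - 1 / p j) * (z j)\<^sup>2 / 2\<bar>"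
          using N by (simp add: abs_mult)
        also have "\<dots> \<le> sample_size n * (K * \<delta> ^ 3)"
        proof (rule mult_left_mono)
          have "\<bar>\<nu> * (ln (1 + u) - u + u\<^sup>2 / 2) - (\<nu> / (q j)\<^sup>2 - 1 / p j) * (z j)\<^sup>2 / 2\<bar>
              \<le> \<bar>\<nu> * (ln (1 + u) - u + u\<^sup>2 / 2)\<bar> + \<bar>(\<nu> / (q j)\<^sup>2 - 1 / p j) * (z j)\<^sup>2 / 2\<bar>"
            by (rule abs_triangle_ineq4)
          also have "\<dots> \<le> 2 * (D / c) ^ 3 * \<delta> ^ 3 + (1 + 2 * C1) / c ^ 3 * D\<^sup>2 / 2 * \<delta> ^ 3"
            by (rule add_mono[OF A Bd])
          also have "\<dots> = K * \<delta> ^ 3" by (simp only: K_def distrib_right)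
          finally show "\<bar>\<nu> * (ln (1 + u) - u + u\<^sup>2 / 2) - (\<nu> / (q j)\<^sup>2 - 1 / p j) * (z j)\<^sup>2 / 2\<bar> \<le> K * \<delta> ^ 3" .
        qed (use N in simp)
        finally show ?thesis .
      qed
    qed
    also have "\<dots> = (CARD('j) * K) * sample_size n * \<delta> ^ 3" by simp
    finally have main: "\<bar>E - (- (sample_size n * B v v) / 2)\<bar> \<le> (CARD('j) * K) * sample_size n * \<delta> ^ 3" by simp
    have "lik n \<sigma> / lik n \<rho> = exp E" using lik\<sigma> lik\<rho> by simp
    moreover have "\<bar>exp E - exp (- (sample_size n * B v v) / 2)\<bar> \<le> \<bar>E - (- (sample_size n * B v v) / 2)\<bar>"
      using E0 N B_nonneg[of v] by (intro abs_exp_diff_le) auto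
    ultimately show ?thesis using main by (simp only: v_def)
  qed
  then show ?thesis
    using K D c_pos by (intro exI[of _ "CARD('j) * K"] conjI exI[of _ "c / (2 * D)"]) auto
qed

end

section \<open>Large samples\<close>

lemma counts_Suc: "counts (Suc N) \<omega> j = counts N \<omega> j + (if \<omega> N = j then 1 else 0)"
proof -
  have "{i. i < Suc N \<and> \<omega> i = j} = {i. i < N \<and> \<omega> i = j} \<union> (if \<omega> N = j then {N} else {})"
    by (auto simp: less_Suc_eq)
  then show ?thesis by (auto simp: counts_def)
qed

text \<open>Passes from the counts, in which the estimate is expressed, to the independent trials,
  to which the limit theorem applies.\<close>

lemma sum_counts:
  fixes f :: "'j::finite \<Rightarrow> 'b::real_vector"
  shows "(\<Sum>j\<in>UNIV. real (counts N \<omega> j) *\<^sub>R f j) = (\<Sum>i<N. f (\<omega> i))"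
proof (induction N)
  case (Suc N)
  have "(\<Sum>j\<in>UNIV. real (counts (Suc N) \<omega> j) *\<^sub>R f j)
      = (\<Sum>j\<in>UNIV. real (counts N \<omega> j) *\<^sub>R f j + (if \<omega> N = j then f j else 0))"
    by (intro sum.cong) (auto simp: counts_Suc scaleR_left_distrib)
  then show ?case by (simp add: sum.distrib Suc)
qed (simp add: counts_def)

lemma abs_cos_diff_le: "\<bar>cos x - cos y\<bar> \<le> \<bar>x - y\<bar>" for x y :: real
  using field_differentiable_bound[of UNIV cos "\<lambda>t. - sin t" 1 x y]
  by (auto intro!: derivative_eq_intros)

context linear_model
begin

definition pm :: "'j pmf" where "pm = embed_pmf p"

lemma pmf_pm: "pmf pm j = p j"
  unfolding pm_def
  using p_nonneg sum_p
  by (intro pmf_embed_pmf) (auto simp: nn_integral_count_space_finite sum_ennreal)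

definition samp :: "(nat \<Rightarrow> 'j) measure" where "samp = (\<Pi>\<^sub>M i\<in>UNIV. measure_pmf pm)"

sublocale samp: prob_space samp
  unfolding samp_def by (intro prob_space_PiM measure_pmf.prob_space_axioms)

lemma space_samp [simp]: "space samp = UNIV"
  by (simp add: samp_def space_PiM)

lemma measurable_coordinate: "(\<lambda>\<omega>. \<omega> i) \<in> measurable samp (measure_pmf pm)"
  unfolding samp_def by measurable

lemma borel_measurable_coordinate: "(\<lambda>\<omega>. h (\<omega> i)) \<in> borel_measurable samp"
  for h :: "'j \<Rightarrow> real"
  by (rule measurable_compose[OF measurable_coordinate]) simp

lemma distr_coordinate: "distr samp (measure_pmf pm) (\<lambda>\<omega>. \<omega> i) = measure_pmf pm"
  unfolding samp_def by (rule distr_PiM_component) (auto intro: measure_pmf.prob_space_axioms)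

lemma expectation_coordinate:
  fixes h :: "'j \<Rightarrow> real"
  shows "samp.expectation (\<lambda>\<omega>. h (\<omega> i)) = (\<Sum>j\<in>UNIV. p j * h j)"
proof -
  have "samp.expectation (\<lambda>\<omega>. h (\<omega> i)) = (\<integral>j. h j \<partial>distr samp (measure_pmf pm) (\<lambda>\<omega>. \<omega> i))"
    by (rule integral_distr[symmetric, OF measurable_coordinate]) simp
  also have "\<dots> = (\<Sum>j\<in>UNIV. pmf pm j *\<^sub>R h j)"
    unfolding distr_coordinate by (rule integral_measure_pmf) auto
  finally show ?thesis by (simp add: pmf_pm)
qed

lemma integrable_coordinates:
  fixes h :: "(nat \<Rightarrow> 'j) \<Rightarrow> real"
  assumes "h \<in> borel_measurable samp" "\<And>\<omega>. \<bar>h \<omega>\<bar> \<le> K"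
  shows "integrable samp h"
  using assms by (intro samp.integrable_const_bound[of _ K]) auto

lemma abs_le_sum_abs:
  fixes h :: "'j \<Rightarrow> real"
  shows "\<bar>h j\<bar> \<le> (\<Sum>j\<in>UNIV. \<bar>h j\<bar>)"
  by (rule member_le_sum) auto

text \<open>Independence means that the joint law is the product of the marginals; here the joint
  map is the identity and the measure is that product by construction.\<close>

lemma indep_coordinates:
  fixes h :: "'j \<Rightarrow> real"
  shows "samp.indep_vars (\<lambda>_. borel) (\<lambda>i \<omega>. h (\<omega> i)) UNIV"
proof -
  have "distr samp (\<Pi>\<^sub>M i\<in>UNIV. measure_pmf pm) (\<lambda>\<omega>. \<lambda>i\<in>UNIV. \<omega> i) = distr samp samp (\<lambda>\<omega>. \<omega>)"
    by (intro distr_cong) (auto simp: samp_def)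
  also have "\<dots> = samp" by (rule distr_id)
  also have "\<dots> = (\<Pi>\<^sub>M i\<in>UNIV. distr samp (measure_pmf pm) (\<lambda>\<omega>. \<omega> i))"
    by (simp add: distr_coordinate) (simp add: samp_def)
  finally have "samp.indep_vars (\<lambda>_. measure_pmf pm) (\<lambda>i \<omega>. \<omega> i) UNIV"
    by (rule samp.indep_vars_iff_distr_eq_PiM[THEN iffD2, OF UNIV_not_empty measurable_coordinate])
  then show ?thesis
    by (rule samp.indep_vars_compose2[where Y = "\<lambda>_. h"]) simp
qed

text \<open>Count vectors over finitely many outcomes form a countable type, so measurable level
  sets suffice. Every function of the counts is then measurable, including the maximiser picked by
  \<open>SOME\<close>.\<close>

lemma measurable_counts: "counts N \<in> measurable samp (count_space UNIV)"
proof -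
  have "counts N -` {n} \<inter> space samp \<in> sets samp" for n
  proof -
    have m: "(\<lambda>\<omega>. \<Sum>i<N. if \<omega> i = j then 1 else 0 :: real) \<in> borel_measurable samp" for j
      by (intro borel_measurable_sum borel_measurable_coordinate[where h = "\<lambda>k. if k = j then 1 else 0"])
    have "real (counts N \<omega> j) = (\<Sum>i<N. if \<omega> i = j then 1 else 0)" for \<omega> :: "nat \<Rightarrow> 'j" and j
      by (induction N) (auto simp: counts_Suc, simp add: counts_def)
    then have "counts N -` {n} \<inter> space samp
        = (\<Inter>j. (\<lambda>\<omega>. \<Sum>i<N. if \<omega> i = j then 1 else 0 :: real) -` {real (n j)} \<inter> space samp)"
      by (auto simp: fun_eq_iff simp flip: of_nat_eq_iff[where ?'a = real])
    also have "\<dots> \<in> sets samp"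
      using measurable_sets[OF m] by (intro sets.countable_INT') auto
    finally show ?thesis .
  qed
  then show ?thesis
    by (subst measurable_count_space_eq2_countable) auto
qed

lemma measurable_fun_counts:
  fixes g :: "('j \<Rightarrow> nat) \<Rightarrow> 'b::topological_space"
  shows "(\<lambda>\<omega>. g (counts N \<omega>)) \<in> borel_measurable samp"
  by (rule measurable_compose[OF measurable_counts]) simp

lemma sets_counts: "{\<omega>\<in>space samp. Q (counts N \<omega>)} \<in> sets samp"
  using measurable_sets[OF measurable_counts, of "{n. Q n}" N] by (simp add: vimage_def Int_def conj_commute)

lemma sample_size_counts: "sample_size (counts N \<omega>) = N"
  using sum_counts[of N \<omega> "\<lambda>_. 1::real"] by (simp add: sample_size_def)

section \<open>Concentration of the observed frequencies\<close>

lemma second_moment_sum: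
  fixes h :: "'j \<Rightarrow> real"
  assumes mean: "(\<Sum>j\<in>UNIV. p j * h j) = 0"
  shows "samp.expectation (\<lambda>\<omega>. (\<Sum>i<N. h (\<omega> i))\<^sup>2) = N * (\<Sum>j\<in>UNIV. p j * (h j)\<^sup>2)"
proof -
  let ?K = "\<Sum>j\<in>UNIV. \<bar>h j\<bar>"
  have int: "integrable samp (\<lambda>\<omega>. h (\<omega> i))" for i
    by (rule integrable_coordinates[of _ ?K]) (auto intro: borel_measurable_coordinate abs_le_sum_abs)
  have prod: "samp.expectation (\<lambda>\<omega>. h (\<omega> i) * h (\<omega> k)) = (if i = k then \<Sum>j\<in>UNIV. p j * (h j)\<^sup>2 else 0)"
    and int2: "integrable samp (\<lambda>\<omega>. h (\<omega> i) * h (\<omega> k))" for i k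
  proof -
    show "integrable samp (\<lambda>\<omega>. h (\<omega> i) * h (\<omega> k))"
      by (rule integrable_coordinates[of _ "?K * ?K"])
        (auto simp: abs_mult intro!: borel_measurable_times borel_measurable_coordinate mult_mono abs_le_sum_abs sum_nonneg)
    show "samp.expectation (\<lambda>\<omega>. h (\<omega> i) * h (\<omega> k)) = (if i = k then \<Sum>j\<in>UNIV. p j * (h j)\<^sup>2 else 0)"
    proof (cases "i = k")
      case True
      then show ?thesis using expectation_coordinate[of "\<lambda>j. (h j)\<^sup>2" k] by (simp add: power2_eq_square)
    next
      case False
      have "samp.expectation (\<lambda>\<omega>. \<Prod>l\<in>{i, k}. h (\<omega> l)) = (\<Prod>l\<in>{i, k}. samp.expectation (\<lambda>\<omega>. h (\<omega> l)))"
        by (rule samp.indep_vars_lebesgue_integral)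
          (auto intro: samp.indep_vars_subset[OF indep_coordinates] int)
      then show ?thesis using False by (simp add: expectation_coordinate mean)
    qed
  qed
  have "samp.expectation (\<lambda>\<omega>. (\<Sum>i<N. h (\<omega> i))\<^sup>2)
      = samp.expectation (\<lambda>\<omega>. \<Sum>i<N. \<Sum>k<N. h (\<omega> i) * h (\<omega> k))"
    by (simp add: power2_eq_square sum_product)
  also have "\<dots> = (\<Sum>i<N. \<Sum>k<N. if i = k then \<Sum>j\<in>UNIV. p j * (h j)\<^sup>2 else 0)"
    by (simp add: Bochner_Integration.integral_sum Bochner_Integration.integrable_sum int2 prod)
  finally show ?thesis by simp
qed

text \<open>Chebyshev's inequality for the sum of the centred indicators \<open>h\<close> of outcome
  \<open>j\<close>, whose variance per trial is at most 1.\<close>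

lemma freq_deviation_prob:
  assumes "R > 0" "N > 0"
  shows "samp.prob {\<omega>\<in>space samp. \<bar>freq (counts N \<omega>) j - p j\<bar> \<ge> R / sqrt N} \<le> 1 / R\<^sup>2"
proof -
  define h where "h i = (if i = j then 1 else 0) - p j" for i
  have "(\<Sum>i\<in>UNIV. p i * (if i = j then 1 else 0)) = (\<Sum>i\<in>UNIV. if i = j then p j else 0)"
    by (intro sum.cong) auto
  then have mean: "(\<Sum>i\<in>UNIV. p i * h i) = 0"
    by (simp add: h_def right_diff_distrib sum_subtractf sum_p flip: sum_distrib_right)
  have S: "(\<Sum>i<N. h (\<omega> i)) = N * (freq (counts N \<omega>) j - p j)" for \<omega>
  proof -
    have "(\<Sum>i<N. h (\<omega> i)) = (\<Sum>i\<in>UNIV. real (counts N \<omega> i) *\<^sub>R h i)" by (rule sum_counts[symmetric])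
    also have "\<dots> = (\<Sum>i\<in>UNIV. (if i = j then real (counts N \<omega> j) else 0)) - sample_size (counts N \<omega>) * p j"
      unfolding sample_size_def sum_distrib_right sum_subtractf[symmetric]
      by (intro sum.cong) (auto simp: h_def right_diff_distrib)
    finally show ?thesis using \<open>N > 0\<close> by (simp add: sample_size_counts freq_def right_diff_distrib)
  qed
  define X where "X \<omega> = (\<Sum>i<N. h (\<omega> i))" for \<omega>
  have Xm [measurable]: "X \<in> borel_measurable samp"
    unfolding X_def by (intro borel_measurable_sum borel_measurable_coordinate)
  define K where "K = (\<Sum>i\<in>UNIV. \<bar>h i\<bar>)"
  have XK: "\<bar>X \<omega>\<bar> \<le> N * K" for \<omega>
  proof -
    have "\<bar>X \<omega>\<bar> \<le> (\<Sum>i<N. \<bar>h (\<omega> i)\<bar>)" unfolding X_def by (rule sum_abs)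
    also have "\<dots> \<le> (\<Sum>i<N. K)" unfolding K_def by (intro sum_mono abs_le_sum_abs)
    finally show ?thesis by simp
  qed
  have int2: "integrable samp (\<lambda>\<omega>. (X \<omega>)\<^sup>2)"
  proof (rule integrable_coordinates[of _ "(N * K)\<^sup>2"])
    show "\<bar>(X \<omega>)\<^sup>2\<bar> \<le> (N * K)\<^sup>2" for \<omega>
      using power_mono[OF XK[of \<omega>], of 2] by simp
  qed measurable
  have EX: "samp.expectation X = 0"
    unfolding X_def
    by (subst Bochner_Integration.integral_sum)
      (auto simp: expectation_coordinate mean intro!: integrable_coordinates[of _ K] borel_measurable_coordinate
        abs_le_sum_abs[of h, folded K_def])
  have "samp.prob {\<omega>\<in>space samp. \<bar>X \<omega> - samp.expectation X\<bar> \<ge> R * sqrt N} \<le> samp.variance X / (R * sqrt N)\<^sup>2"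
    using \<open>R > 0\<close> \<open>N > 0\<close> by (intro samp.Chebyshev_inequality Xm int2) simp
  also have "samp.variance X = N * (\<Sum>i\<in>UNIV. p i * (h i)\<^sup>2)"
    by (simp add: EX) (simp add: X_def second_moment_sum[OF mean])
  also have "\<dots> / (R * sqrt N)\<^sup>2 = (\<Sum>i\<in>UNIV. p i * (h i)\<^sup>2) / R\<^sup>2"
    using \<open>N > 0\<close> by (simp add: power_mult_distrib)
  also have "\<dots> \<le> 1 / R\<^sup>2"
  proof (rule divide_right_mono)
    have "(\<Sum>i\<in>UNIV. p i * (h i)\<^sup>2) \<le> (\<Sum>i\<in>UNIV. p i * 1)"
      using p_nonneg[of j] p_le_1[of j]
      by (intro sum_mono mult_left_mono p_nonneg) (auto simp: h_def abs_square_le_1)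
    then show "(\<Sum>i\<in>UNIV. p i * (h i)\<^sup>2) \<le> 1" by (simp add: sum_p)
  qed simp
  also have "{\<omega>\<in>space samp. \<bar>X \<omega> - samp.expectation X\<bar> \<ge> R * sqrt N}
      = {\<omega>\<in>space samp. \<bar>freq (counts N \<omega>) j - p j\<bar> \<ge> R / sqrt N}"
  proof -
    have "R * sqrt N \<le> \<bar>N * d\<bar> \<longleftrightarrow> R / sqrt N \<le> \<bar>d\<bar>" for d :: real
    proof -
      have "real N = sqrt N * sqrt N" by simp
      then have "\<bar>N * d\<bar> = (sqrt N * \<bar>d\<bar>) * sqrt N" by (simp add: abs_mult)
      then show ?thesis using \<open>N > 0\<close> by (simp add: divide_le_eq mult.commute)
    qed
    then show ?thesis by (simp only: EX X_def S diff_zero)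
  qed
  finally show ?thesis .
qed

text \<open>The relative bound in \<open>near\<close> demands exact zero counts for vacuous
  outcomes. A deviation inequality cannot give this, but such outcomes have probability 0.\<close>

lemma AE_counts_vacuous: "AE \<omega> in samp. \<forall>N j. e j = 0 \<longrightarrow> counts N \<omega> j = 0"
proof -
  have "AE \<omega> in samp. \<forall>i. e (\<omega> i) \<noteq> 0"
  proof (subst AE_all_countable, rule allI)
    fix i
    have "AE j in measure_pmf pm. e j \<noteq> 0"
      using p_zero by (auto simp: AE_measure_pmf_iff set_pmf_eq pmf_pm)
    then show "AE \<omega> in samp. e (\<omega> i) \<noteq> 0"
      unfolding samp_def by (intro AE_PiM_component) (auto intro: measure_pmf.prob_space_axioms)
  qed
  then show ?thesis
  proof eventually_elim
    case (elim \<omega>)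
    then have "{i. i < N \<and> \<omega> i = j} = {}" if "e j = 0" for N j using that by auto
    then show ?case by (simp add: counts_def)
  qed
qed

lemma near_prob:
  assumes "R > 0"
  shows "\<forall>\<^sub>F N in sequentially.
    samp.prob {\<omega>\<in>space samp. near (counts N \<omega>) (R / sqrt N)} \<ge> 1 - CARD('j) / R\<^sup>2"
proof -
  \<comment> \<open>Once R / sqrt N is below c / 2, the absolute bound implies the relative one at
    every nonzero effect, as \<open>c \<le> p j\<close> there.\<close>
  have "(\<lambda>N. R / sqrt (real N)) \<longlonglongrightarrow> 0"
    by real_asymp
  then have "\<forall>\<^sub>F N in sequentially. R / sqrt (real N) < c / 2"
    by (rule order_tendstoD) (use c_pos in simp)
  moreover have "\<forall>\<^sub>F N in sequentially. N > 0" by (rule eventually_gt_at_top)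
  ultimately show ?thesis
  proof eventually_elim
    case (elim N)
    let ?bad = "\<lambda>j. {\<omega>\<in>space samp. \<bar>freq (counts N \<omega>) j - p j\<bar> \<ge> R / sqrt N}"
    let ?near = "{\<omega>\<in>space samp. near (counts N \<omega>) (R / sqrt N)}"
    have bad_sets: "?bad j \<in> sets samp" for j by (rule sets_counts)
    have "samp.prob (\<Union>j. ?bad j) \<le> (\<Sum>j\<in>UNIV. samp.prob (?bad j))"
      using bad_sets by (intro samp.finite_measure_subadditive_finite) auto
    also have "\<dots> \<le> (\<Sum>j::'j\<in>UNIV. 1 / R\<^sup>2)"
      using elim assms by (intro sum_mono freq_deviation_prob)
    finally have "samp.prob (\<Union>j. ?bad j) \<le> CARD('j) / R\<^sup>2" by simp
    moreover have "samp.prob (space samp - (\<Union>j. ?bad j)) = 1 - samp.prob (\<Union>j. ?bad j)"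
      using bad_sets by (intro samp.prob_compl) auto
    moreover have "samp.prob (space samp - (\<Union>j. ?bad j)) \<le> samp.prob ?near"
    proof (rule samp.finite_measure_mono_AE)
      show "?near \<in> sets samp" by (rule sets_counts)
      show "AE \<omega> in samp. \<omega> \<in> space samp - (\<Union>j. ?bad j) \<longrightarrow> \<omega> \<in> ?near"
        using AE_counts_vacuous
      proof eventually_elim
        case (elim \<omega>)
        show ?case
        proof
          assume "\<omega> \<in> space samp - (\<Union>j. ?bad j)"
          then have d: "\<bar>freq (counts N \<omega>) j - p j\<bar> < R / sqrt N" for j
            by (auto simp: not_le)
          have "\<bar>freq (counts N \<omega>) j - p j\<bar> \<le> p j / 2" for j
          proof (cases "e j = 0")
            case True
            then show ?thesis using elim by (simp add: freq_def p_zero)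
          next
            case False
            then show ?thesis
              using d[of j] c_le_p[OF False] \<open>R / sqrt N < c / 2\<close> by linarith
          qed
          then show "\<omega> \<in> ?near"
            using d \<open>N > 0\<close> by (auto simp: near_def freq_def sample_size_counts less_imp_le)
        qed
      qed
    qed
    ultimately show ?case by linarith
  qed
qed

lemma near_prob_ge:
  assumes "\<epsilon> > 0"
  shows "\<exists>L>0. \<forall>R\<ge>L. \<forall>\<^sub>F N in sequentially.
    samp.prob {\<omega>\<in>space samp. near (counts N \<omega>) (R / sqrt N)} \<ge> 1 - \<epsilon>"
proof -
  define L where "L = sqrt (CARD('j) / \<epsilon>)"
  have L: "L > 0" "L\<^sup>2 = CARD('j) / \<epsilon>" using assms by (auto simp: L_def)
  have "\<forall>\<^sub>F N in sequentially. samp.prob {\<omega>\<in>space samp. near (counts N \<omega>) (R / sqrt N)} \<ge> 1 - \<epsilon>"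
    if R: "R \<ge> L" for R
  proof -
    have "CARD('j) / R\<^sup>2 \<le> CARD('j) / L\<^sup>2"
      using L(1) R by (intro divide_left_mono power_mono) (auto simp: zero_less_mult_iff)
    also have "\<dots> = \<epsilon>" using assms by (simp add: L(2))
    finally have le: "1 - \<epsilon> \<le> 1 - CARD('j) / R\<^sup>2" by simp
    have "R > 0" using L(1) R by linarith
    from near_prob[OF this] show ?thesis
      by eventually_elim (rule order_trans[OF le])
  qed
  then show ?thesis using L(1) by blast
qed

text \<open>Separates the two limits: the threshold for \<open>N\<close> may depend on
  \<open>R\<close>, and \<open>R\<close> is fixed first, according to the desired
  probability.\<close>

lemma prob_tendsto_1I:
  assumes "\<And>R. R \<ge> L \<Longrightarrow> R > 0 \<Longrightarrow> \<forall>\<^sub>F N in sequentially. \<forall>\<omega>. near (counts N \<omega>) (R / sqrt N) \<longrightarrow> Q N (counts N \<omega>)"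
  shows "(\<lambda>N. samp.prob {\<omega>\<in>space samp. Q N (counts N \<omega>)}) \<longlonglongrightarrow> 1"
proof (rule order_tendstoI)
  fix b :: real assume "1 < b"
  then show "\<forall>\<^sub>F N in sequentially. samp.prob {\<omega>\<in>space samp. Q N (counts N \<omega>)} < b"
    by (intro always_eventually allI le_less_trans[OF samp.prob_le_1])
next
  fix b :: real assume "b < 1"
  define \<epsilon> where "\<epsilon> = (1 - b) / 2"
  have \<epsilon>: "\<epsilon> > 0" "b < 1 - \<epsilon>" using \<open>b < 1\<close> by (auto simp: \<epsilon>_def field_simps)
  obtain L' where L': "L' > 0" "\<And>R. R \<ge> L' \<Longrightarrow> \<forall>\<^sub>F N in sequentially.
      samp.prob {\<omega>\<in>space samp. near (counts N \<omega>) (R / sqrt N)} \<ge> 1 - \<epsilon>"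
    using near_prob_ge[OF \<epsilon>(1)] by blast
  define R where "R = max L L'"
  have R: "R > 0" "R \<ge> L" "R \<ge> L'" using L'(1) by (auto simp: R_def)
  show "\<forall>\<^sub>F N in sequentially. b < samp.prob {\<omega>\<in>space samp. Q N (counts N \<omega>)}"
    using L'(2)[OF R(3)] assms[OF R(2,1)]
  proof eventually_elim
    case (elim N)
    have "samp.prob {\<omega>\<in>space samp. near (counts N \<omega>) (R / sqrt N)} \<le> samp.prob {\<omega>\<in>space samp. Q N (counts N \<omega>)}"
      using elim(2) by (intro samp.finite_measure_mono sets_counts) auto
    then show ?case using elim(1) \<epsilon>(2) by linarith
  qed
qed

text \<open>The same choice as made by \<open>arg_max\<close>, so that it agrees with
  \<open>ml_estimate\<close> for all data, including data with several maximisers.\<close>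

definition mle :: "('j \<Rightarrow> nat) \<Rightarrow> 'a" where "mle n = (SOME \<rho>. is_max n \<rho>)"

lemma is_max_mle: "is_max n (mle n)"
  unfolding mle_def by (rule someI_ex[OF ex_is_max])

lemma prob_unique_max: "(\<lambda>N. samp.prob {\<omega>\<in>space samp. \<exists>!\<rho>. is_max (counts N \<omega>) \<rho>}) \<longlonglongrightarrow> 1"
  by (rule prob_tendsto_1I, intro always_eventually allI impI)
    (metis is_max_mle is_max_unique near_supported)

lemma prob_lik_ratio:
  assumes "R > 0" "\<epsilon> > 0"
  shows "(\<lambda>N. samp.prob {\<omega>\<in>space samp. \<forall>\<rho>\<in>model. norm (\<rho> - mle (counts N \<omega>)) \<le> R / sqrt N \<longrightarrow>
    \<bar>lik (counts N \<omega>) \<rho> / lik (counts N \<omega>) (mle (counts N \<omega>))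
      - exp (- (N * B (\<rho> - mle (counts N \<omega>)) (\<rho> - mle (counts N \<omega>))) / 2)\<bar> \<le> \<epsilon>}) \<longlonglongrightarrow> 1"
\<comment> \<open>With R' at least R, the single scale \<delta> = R' / sqrt N covers both the
  frequency deviation and the neighbourhood of the estimate; the error N \<delta>^3 is then of order
  1 / sqrt N.\<close>
proof (rule prob_tendsto_1I[where L = R])
  fix R' assume R': "R' \<ge> R" "R' > 0"
  obtain C \<delta>0 where C: "C \<ge> 0" "\<delta>0 > 0" and
    bound: "\<And>n \<delta> \<rho> \<sigma>. near n \<delta> \<Longrightarrow> \<delta> \<le> \<delta>0 \<Longrightarrow> is_max n \<rho> \<Longrightarrow> \<sigma> \<in> model \<Longrightarrow> norm (\<sigma> - \<rho>) \<le> \<delta> \<Longrightarrow>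
      \<bar>lik n \<sigma> / lik n \<rho> - exp (- (sample_size n * B (\<sigma> - \<rho>) (\<sigma> - \<rho>)) / 2)\<bar> \<le> C * sample_size n * \<delta> ^ 3"
    using lik_ratio by blast
  have "(\<lambda>N. R' / sqrt (real N)) \<longlonglongrightarrow> 0" by real_asymp
  then have "\<forall>\<^sub>F N in sequentially. R' / sqrt (real N) < \<delta>0"
    by (rule order_tendstoD) (use C in simp)
  moreover have "(\<lambda>N. real N * (R' / sqrt (real N)) ^ 3) \<longlonglongrightarrow> 0"
    using R'(2) by real_asymp
  then have "(\<lambda>N. C * real N * (R' / sqrt (real N)) ^ 3) \<longlonglongrightarrow> 0"
    unfolding mult.assoc by (rule tendsto_mult_right_zero)
  then have "\<forall>\<^sub>F N in sequentially. C * real N * (R' / sqrt (real N)) ^ 3 < \<epsilon>"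
    by (rule order_tendstoD) (use assms in simp)
  ultimately show "\<forall>\<^sub>F N in sequentially. \<forall>\<omega>. near (counts N \<omega>) (R' / sqrt N) \<longrightarrow>
    (\<forall>\<rho>\<in>model. norm (\<rho> - mle (counts N \<omega>)) \<le> R / sqrt N \<longrightarrow>
    \<bar>lik (counts N \<omega>) \<rho> / lik (counts N \<omega>) (mle (counts N \<omega>))
      - exp (- (N * B (\<rho> - mle (counts N \<omega>)) (\<rho> - mle (counts N \<omega>))) / 2)\<bar> \<le> \<epsilon>)"
  proof eventually_elim
    case (elim N)
    show ?case
    proof (intro allI impI ballI)
      fix \<omega> \<rho>
      assume n: "near (counts N \<omega>) (R' / sqrt N)" and \<rho>: "\<rho> \<in> model"
        and d: "norm (\<rho> - mle (counts N \<omega>)) \<le> R / sqrt N"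
      have "R / sqrt N \<le> R' / sqrt N" using R' by (intro divide_right_mono) auto
      then have "norm (\<rho> - mle (counts N \<omega>)) \<le> R' / sqrt N" using d by linarith
      from bound[OF n less_imp_le[OF elim(1)] is_max_mle \<rho> this]
      show "\<bar>lik (counts N \<omega>) \<rho> / lik (counts N \<omega>) (mle (counts N \<omega>))
        - exp (- (N * B (\<rho> - mle (counts N \<omega>)) (\<rho> - mle (counts N \<omega>))) / 2)\<bar> \<le> \<epsilon>"
        using elim(2) by (simp add: sample_size_counts)
    qed
  qed
qed

subsection \<open>Asymptotic normality\<close>

definition limit_law :: "'a measure" where "limit_law = gaussian_on V (\<lambda>x. B x x)"

lemma B_measurable [measurable]: "(\<lambda>x. B x x) \<in> borel_measurable borel"
  unfolding B_def by measurable

lemma prob_space_limit_law: "prob_space limit_law"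
proof -
  obtain \<kappa> where \<kappa>: "\<kappa> > 0" "\<And>x. x \<in> H \<Longrightarrow> \<kappa> * (norm x)\<^sup>2 \<le> B x x"
    using B_coercive by blast
  show ?thesis
    unfolding limit_law_def
    by (rule prob_space_gaussian_on[OF subspace_V B_measurable \<kappa>(1)]) (use \<kappa>(2) V_subset in auto)
qed

text \<open>\<open>riesz t\<close> is the dual direction required by
  \<open>distr_gaussian_on_inner\<close>: moving along it produces the cross term in
  \<open>t \<bullet> x\<close>.\<close>

lemma distr_limit_law:
  assumes "t \<bullet> riesz t = 1"
  shows "distr limit_law borel (\<lambda>x. t \<bullet> x) = std_normal_distribution"
proof -
  obtain \<kappa> where \<kappa>: "\<kappa> > 0" "\<And>x. x \<in> H \<Longrightarrow> \<kappa> * (norm x)\<^sup>2 \<le> B x x"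
    using B_coercive by blast
  show ?thesis
    unfolding limit_law_def
  proof (rule distr_gaussian_on_inner[OF subspace_V B_measurable \<kappa>(1) _ riesz_in_V assms])
    show "\<kappa> * (norm x)\<^sup>2 \<le> B x x" if "x \<in> V" for x using \<kappa>(2) that V_subset by blast
    fix x s assume x: "x \<in> V"
    have "B (x + s *\<^sub>R riesz t) (x + s *\<^sub>R riesz t)
        = B x x + s * B x (riesz t) + (s * B x (riesz t) + s * (s * B (riesz t) (riesz t)))"
      by (simp add: B_add_right B_scale_right B_commute[of "x + s *\<^sub>R riesz t"] B_commute[of "riesz t" x] distrib_left)
    also have "\<dots> = B x x + 2 * s * (t \<bullet> x) + s\<^sup>2"
      using assms by (simp add: B_V_riesz[OF x] B_V_riesz[OF riesz_in_V] power2_eq_square)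
    finally show "B (x + s *\<^sub>R riesz t) (x + s *\<^sub>R riesz t) = B x x + 2 * s * (t \<bullet> x) + s\<^sup>2" .
  qed
qed

definition lin :: "nat \<Rightarrow> ('j \<Rightarrow> nat) \<Rightarrow> 'a" where
  "lin N n = sqrt N *\<^sub>R (\<Sum>j\<in>UNIV. freq n j *\<^sub>R a j)"

lemma inner_lin:
  assumes "\<sigma> > 0"
  shows "t \<bullet> lin N (counts N \<omega>) = \<sigma> * ((\<Sum>i<N. t \<bullet> a (\<omega> i)) / sqrt (N * \<sigma>\<^sup>2))"
proof (cases "N = 0")
  case False
  have "(\<Sum>i<N. t \<bullet> a (\<omega> i)) = (\<Sum>j\<in>UNIV. real (counts N \<omega> j) * (t \<bullet> a j))"
    using sum_counts[of N \<omega> "\<lambda>j. t \<bullet> a j"] by simp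
  moreover have "t \<bullet> lin N (counts N \<omega>) = sqrt N / N * (\<Sum>j\<in>UNIV. real (counts N \<omega> j) * (t \<bullet> a j))"
    by (simp add: lin_def inner_sum_right freq_def sample_size_counts flip: sum_divide_distrib)
  moreover have "sqrt N / N = 1 / sqrt N" using False by (simp add: field_simps)
  ultimately show ?thesis using assms by (simp add: real_sqrt_mult)
qed (simp add: lin_def)

text \<open>If the variance of the projection is 0, then \<open>t\<close> vanishes on
  \<open>V\<close> and both sides equal \<open>cos d\<close>. Otherwise the one-dimensional central
  limit theorem applies after division by the standard deviation.\<close>

lemma lin_cos_convergence:
  "(\<lambda>N. samp.expectation (\<lambda>\<omega>. cos (t \<bullet> lin N (counts N \<omega>) + d))) \<longlonglongrightarrow> (\<integral>x. cos (t \<bullet> x + d) \<partial>limit_law)"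
proof -
  interpret L: prob_space limit_law by (rule prob_space_limit_law)
  have sets_L [measurable_cong]: "sets limit_law = sets borel" by (simp add: limit_law_def)
  define h where "h j = t \<bullet> a j" for j
  have mean: "(\<Sum>j\<in>UNIV. p j * h j) = 0"
    using sum_p_a by (simp add: h_def flip: inner_scaleR_right inner_sum_right)
  have var: "t \<bullet> riesz t = (\<Sum>j\<in>UNIV. p j * (h j)\<^sup>2)" by (simp add: inner_riesz h_def)
  have var_nonneg: "t \<bullet> riesz t \<ge> 0" unfolding var by (intro sum_nonneg) (simp add: p_nonneg)
  show ?thesis
  proof (cases "t \<bullet> riesz t = 0")
    case True
    have "B (riesz t) (riesz t) = 0" using B_V_riesz[OF riesz_in_V] True by simp
    then have "riesz t = 0" using riesz_in_V V_subset B_eq_0 by blast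
    then have tV: "t \<bullet> x = 0" if "x \<in> V" for x using B_V_riesz[OF that, of t] by (simp add: B_def)
    have "lin N n \<in> V" for N n
      unfolding lin_def by (intro subspace_scale[OF subspace_V] sum_a_in_V)
    then have "samp.expectation (\<lambda>\<omega>. cos (t \<bullet> lin N (counts N \<omega>) + d)) = cos d" for N
      by (simp add: tV samp.prob_space[simplified])
    moreover have "(\<integral>x. cos (t \<bullet> x + d) \<partial>limit_law) = (\<integral>x. cos d \<partial>limit_law)"
    proof (rule integral_cong_AE)
      show "AE x in limit_law. cos (t \<bullet> x + d) = cos d"
        using AE_gaussian_on[OF subspace_V B_measurable] unfolding limit_law_def
        by eventually_elim (simp add: tV)
    qed (simp_all add: sets_L)
    ultimately show ?thesis by (simp add: L.prob_space)
  next
    case False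
    define \<sigma> where "\<sigma> = sqrt (t \<bullet> riesz t)"
    have \<sigma>: "\<sigma> > 0" "\<sigma>\<^sup>2 = t \<bullet> riesz t" using False var_nonneg by (auto simp: \<sigma>_def)
    let ?S = "\<lambda>(N::nat) (\<omega>::nat \<Rightarrow> 'j). (\<Sum>i<N. h (\<omega> i)) / sqrt (N * \<sigma>\<^sup>2)"
    have clt: "weak_conv_m (\<lambda>N. distr samp borel (?S N)) std_normal_distribution"
    proof (rule samp.central_limit_theorem_zero_mean[where \<mu> = "distr (measure_pmf pm) borel h"])
      show "samp.indep_vars (\<lambda>i. borel) (\<lambda>i \<omega>. h (\<omega> i)) UNIV" by (rule indep_coordinates)
      show E0: "samp.expectation (\<lambda>\<omega>. h (\<omega> i)) = 0" for i by (simp add: expectation_coordinate mean)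
      show "integrable samp (\<lambda>\<omega>. (h (\<omega> i))\<^sup>2)" for i
        using abs_le_sum_abs[of "\<lambda>j. (h j)\<^sup>2"]
        by (intro integrable_coordinates[of _ "\<Sum>j\<in>UNIV. \<bar>(h j)\<^sup>2\<bar>"] borel_measurable_coordinate) auto
      show "samp.variance (\<lambda>\<omega>. h (\<omega> i)) = \<sigma>\<^sup>2" for i
        by (simp add: E0 expectation_coordinate[of "\<lambda>j. (h j)\<^sup>2"] \<sigma>(2) var)
      show "distr samp borel (\<lambda>\<omega>. h (\<omega> i)) = distr (measure_pmf pm) borel h" for i
      proof -
        have "distr (distr samp (measure_pmf pm) (\<lambda>\<omega>. \<omega> i)) borel h = distr samp borel (h \<circ> (\<lambda>\<omega>. \<omega> i))"
          by (rule distr_distr[OF _ measurable_coordinate]) simp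
        then show ?thesis by (simp only: distr_coordinate comp_def)
      qed
    qed (rule \<sigma>(1))
    have S_meas [measurable]: "?S N \<in> borel_measurable samp" for N
      by (intro borel_measurable_divide borel_measurable_sum borel_measurable_coordinate)
    have "(\<lambda>N. \<integral>y. cos (\<sigma> * y + d) \<partial>distr samp borel (?S N))
        \<longlonglongrightarrow> (\<integral>y. cos (\<sigma> * y + d) \<partial>std_normal_distribution)"
    proof (rule weak_conv_imp_integral_bdd_continuous_conv[OF _ _ clt])
      show "real_distribution (distr samp borel (?S N))" for N
        by (rule samp.real_distribution_distr) measurable
      show "real_distribution std_normal_distribution"
        by (rule real_dist_normal_dist)
      show "isCont (\<lambda>y. cos (\<sigma> * y + d)) x" for x by (intro continuous_intros)
      show "norm (cos (\<sigma> * y + d)) \<le> 1" for y by simp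
    qed
    also have "(\<lambda>N. \<integral>y. cos (\<sigma> * y + d) \<partial>distr samp borel (?S N))
        = (\<lambda>N. samp.expectation (\<lambda>\<omega>. cos (t \<bullet> lin N (counts N \<omega>) + d)))"
    proof
      fix N
      have "(\<integral>y. cos (\<sigma> * y + d) \<partial>distr samp borel (?S N)) = samp.expectation (\<lambda>\<omega>. cos (\<sigma> * ?S N \<omega> + d))"
        by (rule integral_distr[OF S_meas]) measurable
      then show "(\<integral>y. cos (\<sigma> * y + d) \<partial>distr samp borel (?S N))
          = samp.expectation (\<lambda>\<omega>. cos (t \<bullet> lin N (counts N \<omega>) + d))"
        by (simp only: inner_lin[OF \<sigma>(1)] h_def)
    qed
    also have "(\<integral>y. cos (\<sigma> * y + d) \<partial>std_normal_distribution) = (\<integral>x. cos (t \<bullet> x + d) \<partial>limit_law)"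
    proof -
      \<comment> \<open>The variance \<open>t \<bullet> riesz t\<close> is quadratic in
        \<open>t\<close>, so this multiple has variance 1.\<close>
      define t' where "t' = (1 / \<sigma>) *\<^sub>R t"
      have "t' \<bullet> riesz t' = (t \<bullet> riesz t) / \<sigma>\<^sup>2"
        unfolding inner_riesz by (simp add: t'_def power_divide sum_divide_distrib)
      then have "t' \<bullet> riesz t' = 1" using \<sigma> False by simp
      then have "distr limit_law borel (\<lambda>x. t' \<bullet> x) = std_normal_distribution" by (rule distr_limit_law)
      then have "(\<integral>y. cos (\<sigma> * y + d) \<partial>std_normal_distribution) = (\<integral>x. cos (\<sigma> * (t' \<bullet> x) + d) \<partial>limit_law)"
        using integral_distr[of "\<lambda>x. t' \<bullet> x" limit_law borel "\<lambda>y. cos (\<sigma> * y + d)"] by simp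
      then show ?thesis using \<sigma>(1) by (simp add: t'_def)
    qed
    finally show ?thesis .
  qed
qed

text \<open>A Slutsky argument: on the good event the rescaled estimate differs from
  \<open>lin\<close> by sqrt N times O(\<delta>^2), which tends to 0, so both have the same limits
  of cosine expectations. Tightness comes from \<open>mle_bound\<close>.\<close>

theorem mle_asymptotically_normal:
  fixes f :: "'a \<Rightarrow> real"
  assumes f: "continuous_on UNIV f" "bounded (range f)"
  shows "(\<lambda>N. samp.expectation (\<lambda>\<omega>. f (sqrt N *\<^sub>R (mle (counts N \<omega>) - \<rho>\<^sub>0)))) \<longlonglongrightarrow> (\<integral>x. f x \<partial>limit_law)"
proof (rule samp.convergence_in_distribution_from_cos[OF _ prob_space_limit_law _ _ _ f])
  let ?Y = "\<lambda>N \<omega>. sqrt (real N) *\<^sub>R (mle (counts N \<omega>) - \<rho>\<^sub>0)"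
  show "samp.random_variable borel (?Y N)" for N
    by (rule measurable_fun_counts[where g = "\<lambda>n. sqrt (real N) *\<^sub>R (mle n - \<rho>\<^sub>0)"])
  show "sets limit_law = sets borel" by (simp add: limit_law_def)
  show "\<exists>R0. \<forall>R\<ge>R0. \<forall>\<^sub>F N in sequentially. samp.prob {\<omega>\<in>space samp. norm (?Y N \<omega>) > R} \<le> \<epsilon>"
    if "\<epsilon> > 0" for \<epsilon>
  proof -
    obtain C where C: "C \<ge> 0" "\<And>n \<delta> \<rho>. near n \<delta> \<Longrightarrow> is_max n \<rho> \<Longrightarrow> norm (\<rho> - \<rho>\<^sub>0) \<le> C * \<delta>"
      using mle_bound by blast
    obtain R1 where R1: "\<forall>\<^sub>F N in sequentially.
        samp.prob {\<omega>\<in>space samp. near (counts N \<omega>) (R1 / sqrt N)} \<ge> 1 - \<epsilon>"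
      using near_prob_ge[OF \<open>\<epsilon> > 0\<close>] by blast
    have "\<forall>\<^sub>F N in sequentially. samp.prob {\<omega>\<in>space samp. norm (?Y N \<omega>) > R} \<le> \<epsilon>" if R: "R \<ge> C * R1" for R
      using R1 eventually_gt_at_top[of 0]
    proof eventually_elim
      case (elim N)
      let ?near = "{\<omega>\<in>space samp. near (counts N \<omega>) (R1 / sqrt N)}"
      have "norm (?Y N \<omega>) \<le> R" if "near (counts N \<omega>) (R1 / sqrt N)" for \<omega>
      proof -
        have "norm (?Y N \<omega>) = sqrt N * norm (mle (counts N \<omega>) - \<rho>\<^sub>0)" by simp
        also have "\<dots> \<le> sqrt N * (C * (R1 / sqrt N))"
          by (intro mult_left_mono C(2)[OF that is_max_mle]) simp
        also have "\<dots> = C * R1" using elim(2) by simp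
        finally show ?thesis using R by linarith
      qed
      then have "samp.prob {\<omega>\<in>space samp. norm (?Y N \<omega>) > R} \<le> samp.prob (space samp - ?near)"
        by (intro samp.finite_measure_mono sets.compl_sets sets_counts) (auto simp: not_le[symmetric])
      also have "\<dots> = 1 - samp.prob ?near" by (intro samp.prob_compl sets_counts)
      finally show ?case using elim(1) by linarith
    qed
    then show ?thesis by blast
  qed
  show "(\<lambda>N. samp.expectation (\<lambda>\<omega>. cos (t \<bullet> ?Y N \<omega> + d))) \<longlonglongrightarrow> (\<integral>x. cos (t \<bullet> x + d) \<partial>limit_law)" for t d
  proof -
    let ?D = "\<lambda>N \<omega>. cos (t \<bullet> ?Y N \<omega> + d) - cos (t \<bullet> lin N (counts N \<omega>) + d)"
    have m: "(\<lambda>\<omega>. cos (t \<bullet> ?Y N \<omega> + d)) \<in> borel_measurable samp"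
      "(\<lambda>\<omega>. cos (t \<bullet> lin N (counts N \<omega>) + d)) \<in> borel_measurable samp" for N
      using measurable_fun_counts[where g = "\<lambda>n. cos (t \<bullet> (sqrt (real N) *\<^sub>R (mle n - \<rho>\<^sub>0)) + d)"]
        measurable_fun_counts[where g = "\<lambda>n. cos (t \<bullet> lin N n + d)"] by auto
    have int: "integrable samp (\<lambda>\<omega>. cos (t \<bullet> ?Y N \<omega> + d))"
      "integrable samp (\<lambda>\<omega>. cos (t \<bullet> lin N (counts N \<omega>) + d))" for N
      using m by (auto intro!: integrable_coordinates[of _ 1])
    obtain C where C: "C \<ge> 0" "\<And>n \<delta> \<rho>. near n \<delta> \<Longrightarrow> is_max n \<rho> \<Longrightarrow>
        norm (\<rho> - \<rho>\<^sub>0 - (\<Sum>j\<in>UNIV. freq n j *\<^sub>R a j)) \<le> C * \<delta>\<^sup>2"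
      using mle_linearization by blast
    have "(\<lambda>N. samp.expectation (?D N)) \<longlonglongrightarrow> 0"
    proof (rule LIMSEQ_I)
      fix r :: real assume "r > 0"
      \<comment> \<open>Off the good event two cosines differ by at most 2, which costs 2 (r/8) =
        r/4; on it the difference stays below r/2.\<close>
      obtain R where R: "R > 0" "\<forall>\<^sub>F N in sequentially.
          samp.prob {\<omega>\<in>space samp. near (counts N \<omega>) (R / sqrt N)} \<ge> 1 - r / 8"
        using near_prob_ge[of "r / 8"] \<open>r > 0\<close> by auto
      have "(\<lambda>N. sqrt (real N) * (R / sqrt (real N))\<^sup>2) \<longlonglongrightarrow> 0"
        using R(1) by real_asymp
      then have "(\<lambda>N. (norm t * C) * (sqrt (real N) * (R / sqrt (real N))\<^sup>2)) \<longlonglongrightarrow> 0"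
        by (rule tendsto_mult_right_zero)
      then have "(\<lambda>N. norm t * (sqrt (real N) * (C * (R / sqrt (real N))\<^sup>2))) \<longlonglongrightarrow> 0"
        by (simp only: mult_ac)
      then have "\<forall>\<^sub>F N in sequentially. norm t * (sqrt (real N) * (C * (R / sqrt (real N))\<^sup>2)) < r / 2"
        by (rule order_tendstoD) (use \<open>r > 0\<close> in simp)
      then have "\<forall>\<^sub>F N in sequentially. norm (samp.expectation (?D N)) < r"
        using R(2)
      proof eventually_elim
        case (elim N)
        let ?near = "{\<omega>\<in>space samp. near (counts N \<omega>) (R / sqrt N)}"
        have Dle: "\<bar>?D N \<omega>\<bar> \<le> r / 2" if "near (counts N \<omega>) (R / sqrt N)" for \<omega>
        proof -
          have "\<bar>?D N \<omega>\<bar> \<le> \<bar>(t \<bullet> ?Y N \<omega> + d) - (t \<bullet> lin N (counts N \<omega>) + d)\<bar>"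
            by (rule abs_cos_diff_le)
          also have "\<dots> = \<bar>t \<bullet> (sqrt N *\<^sub>R (mle (counts N \<omega>) - \<rho>\<^sub>0 - (\<Sum>j\<in>UNIV. freq (counts N \<omega>) j *\<^sub>R a j)))\<bar>"
            by (simp add: lin_def inner_diff_right right_diff_distrib)
          also have "\<dots> \<le> norm t * norm (sqrt N *\<^sub>R (mle (counts N \<omega>) - \<rho>\<^sub>0 - (\<Sum>j\<in>UNIV. freq (counts N \<omega>) j *\<^sub>R a j)))"
            by (rule Cauchy_Schwarz_ineq2)
          also have "\<dots> \<le> norm t * (sqrt N * (C * (R / sqrt N)\<^sup>2))"
            using C(2)[OF that is_max_mle] by (auto intro!: mult_left_mono)
          finally show ?thesis using elim(1) by linarith
        qed
        have ind: "integrable samp (indicator (space samp - ?near) :: _ \<Rightarrow> real)"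
          using sets.compl_sets[OF sets_counts]
          by (intro integrable_coordinates[of _ 1]) (auto split: split_indicator)
        have "\<bar>samp.expectation (?D N)\<bar> \<le> samp.expectation (\<lambda>\<omega>. \<bar>?D N \<omega>\<bar>)"
          by (rule integral_abs_bound)
        also have "\<dots> \<le> samp.expectation (\<lambda>\<omega>. r / 2 + 2 * indicator (space samp - ?near) \<omega>)"
        proof (rule integral_mono)
          fix \<omega>
          have "\<bar>?D N \<omega>\<bar> \<le> 2"
            using abs_cos_le_one[of "t \<bullet> ?Y N \<omega> + d"] abs_cos_le_one[of "t \<bullet> lin N (counts N \<omega>) + d"]
            by linarith
          then show "\<bar>?D N \<omega>\<bar> \<le> r / 2 + 2 * indicator (space samp - ?near) \<omega>"
            using Dle[of \<omega>] \<open>r > 0\<close> by (auto split: split_indicator)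
        qed (use int ind in auto)
        also have "\<dots> = r / 2 + 2 * samp.prob (space samp - ?near)"
          using ind by (subst Bochner_Integration.integral_add) (auto simp: samp.prob_space[simplified])
        also have "samp.prob (space samp - ?near) = 1 - samp.prob ?near"
          by (intro samp.prob_compl sets_counts)
        finally show ?case using elim(2) \<open>r > 0\<close> by simp
      qed
      then show "\<exists>no. \<forall>N\<ge>no. norm (samp.expectation (?D N) - 0) < r"
        by (simp add: eventually_sequentially)
    qed
    moreover have "samp.expectation (?D N) + samp.expectation (\<lambda>\<omega>. cos (t \<bullet> lin N (counts N \<omega>) + d))
        = samp.expectation (\<lambda>\<omega>. cos (t \<bullet> ?Y N \<omega> + d))" for N
      using Bochner_Integration.integral_diff[OF int(1)[of N] int(2)[of N]] by linarith
    ultimately show ?thesis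
      using tendsto_add[OF _ lin_cos_convergence[of t d], of "\<lambda>N. samp.expectation (?D N)" 0]
      by (simp only: add_0)
  qed
qed

end

section \<open>Quantum state tomography\<close>

context linear_model
begin

text \<open>Identifies the subspace carrying the limiting Gaussian. All of \<open>V\<close> is
  reached because \<open>\<rho>\<^sub>0\<close> is a relative interior point of the model.\<close>

lemma direction_space_model: "direction_space model = V"
proof
  show "direction_space model \<subseteq> V"
    unfolding direction_space_def
    by (rule span_minimal[OF _ subspace_V]) (auto intro: model_diff_V)
  show "V \<subseteq> direction_space model"
  proof
    fix v assume v: "v \<in> V"
    \<comment> \<open>A step so short that no probability changes by more than \<open>c\<close>,
      which is at most each nonvacuous \<open>p j\<close>; the 1 prevents division by 0.\<close>
    define s where "s = c / (1 + (\<Sum>j\<in>UNIV. \<bar>v \<bullet> e j\<bar>))"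
    have den: "1 + (\<Sum>j\<in>UNIV. \<bar>v \<bullet> e j\<bar>) > 0" by (intro add_pos_nonneg sum_nonneg) auto
    have s: "s > 0" using c_pos den by (simp add: s_def)
    have "0 \<le> \<rho>\<^sub>0 \<bullet> e j + s * (v \<bullet> e j)" for j
    proof (cases "e j = 0")
      case False
      have "\<bar>v \<bullet> e j\<bar> \<le> 1 + (\<Sum>j\<in>UNIV. \<bar>v \<bullet> e j\<bar>)"
        using member_le_sum[of j UNIV "\<lambda>j. \<bar>v \<bullet> e j\<bar>"] by simp
      then have "s * \<bar>v \<bullet> e j\<bar> \<le> s * (1 + (\<Sum>j\<in>UNIV. \<bar>v \<bullet> e j\<bar>))"
        using s by (intro mult_left_mono) auto
      also have "\<dots> = c" using den by (simp add: s_def)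
      also have "c \<le> \<rho>\<^sub>0 \<bullet> e j" using c_le_p[OF False] by (simp add: p_def)
      finally have "\<bar>s * (v \<bullet> e j)\<bar> \<le> \<rho>\<^sub>0 \<bullet> e j" using s by (simp add: abs_mult)
      then show ?thesis by linarith
    qed simp
    then have "\<rho>\<^sub>0 + s *\<^sub>R v \<in> model"
      using \<rho>0_in total v subspace_H
      by (auto simp: model_def V_def inner_add_left sum.distrib subspace_def simp flip: sum_distrib_left)
    then have "(\<rho>\<^sub>0 + s *\<^sub>R v) - \<rho>\<^sub>0 \<in> direction_space model"
      unfolding direction_space_def using \<rho>0_model by (intro span_base) blast
    then have "s *\<^sub>R v \<in> direction_space model" by simp
    then have "(1 / s) *\<^sub>R (s *\<^sub>R v) \<in> direction_space model"
      unfolding direction_space_def by (rule span_scale)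
    then show "v \<in> direction_space model" using s by simp
  qed
qed

end

section \<open>Scores and Fisher information of a POVM\<close>

lemma GDERIV_inner_right: "GDERIV (\<lambda>x. x \<bullet> a) x :> a"
  unfolding gderiv_def by (auto intro!: derivative_eq_intros)

lemma GDERIV_unique: "GDERIV f x :> D \<Longrightarrow> GDERIV f x :> D' \<Longrightarrow> D = D'"
  unfolding gderiv_def
  by (drule (1) has_derivative_unique) (metis inner_commute vector_eq_rdot)

text \<open>With the convention \<open>ln 0 = 0\<close> the function has a value at a zero of the
  pairing, but it is unbounded below nearby, so it is discontinuous and has no gradient there. This
  turns existence of the scores into positivity of the probabilities.\<close>

lemma GDERIV_ln_inner_nonzero:
  fixes a :: "'a::real_inner"
  assumes "GDERIV (\<lambda>x. ln (x \<bullet> a)) x :> D" and "a \<noteq> 0"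
  shows "x \<bullet> a \<noteq> 0"
proof
  assume x: "x \<bullet> a = 0"
  \<comment> \<open>Chosen so that the pairing with \<open>a\<close> is exp (-n), whose logarithm is
    -n.\<close>
  define y where "y n = x + (exp (- real n) / (a \<bullet> a)) *\<^sub>R a" for n
  have "(\<lambda>n. exp (- real n)) \<longlonglongrightarrow> 0" by real_asymp
  then have "(\<lambda>n. x + (exp (- real n) / (a \<bullet> a)) *\<^sub>R a) \<longlonglongrightarrow> x + (0 / (a \<bullet> a)) *\<^sub>R a"
    by (intro tendsto_intros) (use \<open>a \<noteq> 0\<close> in auto)
  then have y: "y \<longlonglongrightarrow> x" by (simp add: y_def[abs_def])
  have "isCont (\<lambda>x. ln (x \<bullet> a)) x"
    using assms(1) unfolding gderiv_def by (rule has_derivative_continuous)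
  then have "(\<lambda>n. ln (y n \<bullet> a)) \<longlonglongrightarrow> ln (x \<bullet> a)"
    using y by (rule isCont_tendsto_compose)
  moreover have "ln (y n \<bullet> a) = - real n" for n
    using x \<open>a \<noteq> 0\<close> by (simp add: y_def inner_add_left)
  ultimately have "(\<lambda>n. - real n) \<longlonglongrightarrow> 0" by (simp add: x)
  then have "\<forall>\<^sub>F n in sequentially. - 1 < - real n" by (rule order_tendstoD) simp
  then obtain n0 where "\<And>n. n \<ge> n0 \<Longrightarrow> - 1 < - real n" by (auto simp: eventually_sequentially)
  from this[of "max 1 n0"] show False by simp
qed

context
  fixes E :: "'j::finite \<Rightarrow> complex^'n^'n" and \<rho>\<^sub>0 :: "complex^'n^'n"
  assumes povm: "povm E" and state: "\<rho>\<^sub>0 \<in> density_matrices" and score_ex: "fisher_exists E \<rho>\<^sub>0"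
begin

lemma effect_hermitian: "E j \<in> hermitian_matrices"
  using povm by (simp add: povm_def positive_semidefinite_def)

lemma born_effect: "born \<rho> (E j) = \<rho> \<bullet> E j"
  by (rule born_eq_inner[OF effect_hermitian])

lemma density_hermitian: "\<rho> \<in> density_matrices \<Longrightarrow> \<rho> \<in> hermitian_matrices"
  by (simp add: density_matrices_def positive_semidefinite_def)

lemma density_effect_nonneg: "\<rho> \<in> density_matrices \<Longrightarrow> 0 \<le> \<rho> \<bullet> E j"
  using povm by (intro inner_psd_nonneg) (auto simp: povm_def density_matrices_def)

lemma density_effect_sum: "\<rho> \<in> density_matrices \<Longrightarrow> (\<Sum>j\<in>UNIV. \<rho> \<bullet> E j) = 1"
proof -
  assume \<rho>: "\<rho> \<in> density_matrices"
  have "(\<Sum>j\<in>UNIV. \<rho> \<bullet> E j) = \<rho> \<bullet> mat 1"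
    using povm by (simp add: povm_def flip: inner_sum_right)
  moreover have "complex_of_real (\<rho> \<bullet> mat 1) = 1"
    using trace_hermitian_eq[OF density_hermitian[OF \<rho>]] \<rho> by (simp add: density_matrices_def)
  ultimately show ?thesis by simp
qed

lemma outcome_pmf_eq: "pmf (outcome_pmf E \<rho>\<^sub>0) j = \<rho>\<^sub>0 \<bullet> E j"
  unfolding outcome_pmf_def born_effect
  using density_effect_nonneg[OF state] density_effect_sum[OF state]
  by (intro pmf_embed_pmf) (auto simp: nn_integral_count_space_finite sum_ennreal)

lemma effect_pos: "E j \<noteq> 0 \<Longrightarrow> \<rho>\<^sub>0 \<bullet> E j > 0"
proof -
  assume E: "E j \<noteq> 0"
  obtain S where "GDERIV (\<lambda>\<sigma>. ln (\<sigma> \<bullet> E j)) \<rho>\<^sub>0 :> S"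
    using score_ex by (auto simp: fisher_exists_def is_score_def born_effect)
  then have "\<rho>\<^sub>0 \<bullet> E j \<noteq> 0" using E by (rule GDERIV_ln_inner_nonzero)
  then show "\<rho>\<^sub>0 \<bullet> E j > 0" using density_effect_nonneg[OF state, of j] by linarith
qed

lemma score_eq: "score E \<rho>\<^sub>0 j = (1 / (\<rho>\<^sub>0 \<bullet> E j)) *\<^sub>R E j"
proof -
  have "GDERIV (\<lambda>\<sigma>. ln (\<sigma> \<bullet> E j)) \<rho>\<^sub>0 :> (1 / (\<rho>\<^sub>0 \<bullet> E j)) *\<^sub>R E j"
  proof (cases "E j = 0")
    case True
    then show ?thesis by (simp add: GDERIV_const)
  next
    case False
    show ?thesis
      using GDERIV_DERIV_compose[OF GDERIV_inner_right DERIV_ln_divide[OF effect_pos[OF False]]] .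
  qed
  then have *: "is_score E \<rho>\<^sub>0 j ((1 / (\<rho>\<^sub>0 \<bullet> E j)) *\<^sub>R E j)"
    by (simp add: is_score_def born_effect)
  show ?thesis
    unfolding score_def
  proof (rule the_equality)
    fix S assume "is_score E \<rho>\<^sub>0 j S"
    then show "S = (1 / (\<rho>\<^sub>0 \<bullet> E j)) *\<^sub>R E j"
      using * unfolding is_score_def by (rule GDERIV_unique)
  qed (rule *)
qed

lemma fisher_information_eq:
  "fisher_information E \<rho>\<^sub>0 N Y = real N *\<^sub>R (\<Sum>j\<in>UNIV. ((E j \<bullet> Y) / (\<rho>\<^sub>0 \<bullet> E j)) *\<^sub>R E j)"
proof -
  have "measure_pmf.expectation (outcome_pmf E \<rho>\<^sub>0) (\<lambda>j. (score E \<rho>\<^sub>0 j \<bullet> Y) *\<^sub>R score E \<rho>\<^sub>0 j)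
      = (\<Sum>j\<in>UNIV. (\<rho>\<^sub>0 \<bullet> E j) *\<^sub>R ((score E \<rho>\<^sub>0 j \<bullet> Y) *\<^sub>R score E \<rho>\<^sub>0 j))"
    unfolding outcome_pmf_eq[symmetric] by (rule integral_measure_pmf) auto
  also have "\<dots> = (\<Sum>j\<in>UNIV. ((E j \<bullet> Y) / (\<rho>\<^sub>0 \<bullet> E j)) *\<^sub>R E j)"
  proof (intro sum.cong refl)
    fix j
    show "(\<rho>\<^sub>0 \<bullet> E j) *\<^sub>R ((score E \<rho>\<^sub>0 j \<bullet> Y) *\<^sub>R score E \<rho>\<^sub>0 j) = ((E j \<bullet> Y) / (\<rho>\<^sub>0 \<bullet> E j)) *\<^sub>R E j"
      using effect_pos[of j] by (cases "E j = 0") (auto simp: score_eq)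
  qed
  finally show ?thesis by (simp add: fisher_information_def)
qed

lemma linear_model_povm:
  assumes "fisher_invertible E \<rho>\<^sub>0 1"
  shows "linear_model E hermitian_matrices \<rho>\<^sub>0"
proof
  show "subspace (hermitian_matrices :: (complex^'n^'n) set)" by (rule subspace_hermitian)
  show "bij_betw (\<lambda>y. \<Sum>j\<in>UNIV. ((E j \<bullet> y) / (\<rho>\<^sub>0 \<bullet> E j)) *\<^sub>R E j) hermitian_matrices hermitian_matrices"
    using assms by (simp add: fisher_invertible_def fisher_information_eq[abs_def])
qed (simp_all add: effect_hermitian density_hermitian[OF state] effect_pos density_effect_sum[OF state])

text \<open>A dictionary between the notions for POVMs and those of the locale, under which the
  N-sample quadratic form becomes N times \<open>B\<close>.\<close>

lemma LAN_linear_model: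
  assumes "fisher_invertible E \<rho>\<^sub>0 1"
  shows "LAN E \<rho>\<^sub>0 (linear_model.model E hermitian_matrices)"
proof -
  interpret linear_model E hermitian_matrices \<rho>\<^sub>0
    by (rule linear_model_povm[OF assms])
  have samples: "samples E \<rho>\<^sub>0 = samp"
    by (simp add: samples_def samp_def pm_def outcome_pmf_def born_effect p_def[abs_def])
  have lik: "likelihood E = lik"
    by (simp add: fun_eq_iff likelihood_def lik_def born_effect)
  have max: "is_ml_estimate E model = is_max"
    by (auto simp: fun_eq_iff is_ml_estimate_def is_max_def is_arg_max_def lik not_less)
  have mle: "ml_estimate E model = mle"
    using max by (simp add: fun_eq_iff ml_estimate_def arg_max_def mle_def is_ml_estimate_def)
  have form: "fisher_quadratic_form E \<rho>\<^sub>0 N X = N * B X X" for N X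
    using inner_F[of X X]
    by (simp add: fisher_quadratic_form_def fisher_information_eq F_def p_def)
  show ?thesis
    unfolding LAN_def
  proof (intro conjI)
    show "model \<subseteq> hermitian_matrices" by (auto simp: model_def)
    show "ml_well_defined E \<rho>\<^sub>0 model"
      unfolding ml_well_defined_def samples max by (rule prob_unique_max)
    have "fisher_quadratic_form E \<rho>\<^sub>0 1 = (\<lambda>x. B x x)" by (simp add: fun_eq_iff form)
    then show "ml_asymptotically_normal E \<rho>\<^sub>0 model"
      unfolding ml_asymptotically_normal_def samples mle direction_space_model
      using mle_asymptotically_normal by (simp add: limit_law_def)
    show "likelihood_locally_gaussian E \<rho>\<^sub>0 model"
      unfolding likelihood_locally_gaussian_def samples mle lik form Let_def minus_mult_left[symmetric]
      using prob_lik_ratio by simp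
  qed
qed

end

theorem lemma5:
  fixes E :: "'j::finite \<Rightarrow> complex^'n^'n" and \<rho>\<^sub>0 :: "complex^'n^'n"
  assumes "povm E"
    and "\<rho>\<^sub>0 \<in> density_matrices"
    and "fisher_exists E \<rho>\<^sub>0"
    and "\<And>N. N \<ge> 1 \<Longrightarrow> fisher_invertible E \<rho>\<^sub>0 N"
  shows "MP_LAN E \<rho>\<^sub>0 density_matrices"
proof -
  have inv: "fisher_invertible E \<rho>\<^sub>0 1" by (rule assms(4)) simp
  interpret linear_model E hermitian_matrices \<rho>\<^sub>0
    by (rule linear_model_povm[OF assms(1-3) inv])
  \<comment> \<open>Nonnegativity of the pairings comes from \<open>inner_psd_nonneg\<close>. The
    model tests positivity on the effects only, so it may also contain Hermitian matrices that are
    not positive.\<close>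
  have "density_matrices \<subseteq> model"
    using density_hermitian[OF assms(1-3)] density_effect_nonneg[OF assms(1-3)]
      density_effect_sum[OF assms(1-3)]
    by (auto simp: model_def)
  then show ?thesis
    unfolding MP_LAN_def using convex_density_matrices LAN_linear_model[OF assms(1-3) inv] by blast
qed

end
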